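(* Let $(R,\mathfrak m)$ be a one-dimensional, Cohen-Macaulay, analytically unramified (Noetherian) local ring with embedding dimension $\nu$, such that the residue field $\Bbbk = R/\mathfrak m$ is infinite, and let $(x)$ be a minimal reduction of $\mathfrak m$. Let $\overline R$ be the integral closure of $R$ in its total ring of fractions and let $\mathfrak c = R:\overline R$ be the conductor. Then $$e(R)\le (\nu-1)\,\ell(R/\mathfrak c)+1.$$ Moreover, equality $e(R)=(\nu-1)\,\ell(R/\mathfrak c)+1$ holds if and only if either $R$ is a discrete valuation ring or $\ell(R/\mathfrak c)=1$.
   Context: Analytically unramified means that the $\mathfrak m$-adic completion $\hat R$ is reduced; in the present one-dimensional Cohen-Macaulay setting this is equivalent to $\overline R$ being a finite $R$-module. $Q(R)$ denotes the total ring of fractions of $R$, and $\mathfrak c = R:\overline R=\{z\in Q(R) : z\overline R\subseteq R\}$ is the conductor, an ideal of both $R$ and $\overline R$ such that $R/\mathfrak c$ has finite length ($\mathfrak c=R$ exactly when $R$ is a DVR). $\ell$ denotes length as an $R$-module, $e(R)$ is the (Hilbert-Samuel) multiplicity of $R$ with respect to $\mathfrak m$, and $\nu=\dim_{\Bbbk}\mathfrak m/\mathfrak m^2$ is the embedding dimension. A minimal reduction of $\mathfrak m$ is a reduction that is minimal with respect to inclusion; here it is a principal ideal $(x)$ generated by a non-zero divisor. *)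

theory Defs
  imports
    Complex_Main
    "HOL-Library.Extended_Nat"
    "HOL-Algebra.Ideal_Product"
    "HOL-Algebra.QuotRing"
    "HOL-Algebra.Ring_Divisibility"
    "HOL-Algebra.Polynomials"
    "Jordan_Normal_Form.Missing_VectorSpace"
begin

section \<open>Local rings\<close>

locale local_ring = cring R for R (structure) +
  fixes m
  assumes maximal_ideal: "maximalideal m R"
    and maximal_ideal_unique: "maximalideal M R \<Longrightarrow> M = m"

definition dvr :: "('a, 'b) ring_scheme \<Rightarrow> bool"
  where "dvr R \<longleftrightarrow> principal_domain R \<and> (\<exists>m. local_ring R m) \<and> \<not> field R"

definition reduced_ring :: "('a, 'b) ring_scheme \<Rightarrow> bool"
  where "reduced_ring R \<longleftrightarrow>
    (\<forall>a \<in> carrier R. \<forall>n::nat. a [^]\<^bsub>R\<^esub> n = \<zero>\<^bsub>R\<^esub> \<longrightarrow> a = \<zero>\<^bsub>R\<^esub>)"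

abbreviation ideal_pow :: "('a, 'b) ring_scheme \<Rightarrow> 'a set \<Rightarrow> nat \<Rightarrow> 'a set"
  where "ideal_pow R I n \<equiv> I [^]\<^bsub>ideals_set R\<^esub> n"


section \<open>Krull dimension, depth and the Cohen--Macaulay property\<close>

definition krull_dim :: "('a, 'b) ring_scheme \<Rightarrow> enat"
  where "krull_dim R =
    (SUP n \<in> {n. \<exists>P. (\<forall>i\<le>n. primeideal (P i) R) \<and> (\<forall>i<n. P i \<subset> P (Suc i))}. enat n)"

definition nonzero_divisors :: "('a, 'b) ring_scheme \<Rightarrow> 'a set"
  where "nonzero_divisors R =
    {s \<in> carrier R. \<forall>a \<in> carrier R. s \<otimes>\<^bsub>R\<^esub> a = \<zero>\<^bsub>R\<^esub> \<longrightarrow> a = \<zero>\<^bsub>R\<^esub>}"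

definition regular_sequence :: "('a, 'b) ring_scheme \<Rightarrow> 'a list \<Rightarrow> bool"
  where "regular_sequence R xs \<longleftrightarrow>
    set xs \<subseteq> carrier R \<and> genideal R (set xs) \<noteq> carrier R \<and>
    (\<forall>i < length xs.
      let I = genideal R (set (take i xs)) in I +>\<^bsub>R\<^esub> xs ! i \<in> nonzero_divisors (R Quot I))"

definition depth :: "('a, 'b) ring_scheme \<Rightarrow> 'a set \<Rightarrow> enat"
  where "depth R m = (SUP xs \<in> {xs. regular_sequence R xs \<and> set xs \<subseteq> m}. enat (length xs))"

text \<open>Meant for Noetherian local rings with maximal ideal \<open>m\<close>.\<close>
definition cohen_macaulay :: "('a, 'b) ring_scheme \<Rightarrow> 'a set \<Rightarrow> bool"
  where "cohen_macaulay R m \<longleftrightarrow> depth R m = krull_dim R"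


section \<open>Completion\<close>

text \<open>The inverse limit of the rings \<open>R/I\<^sup>n\<close>.  The transition map \<open>R/I\<^sup>n\<^sup>+\<^sup>1 \<rightarrow> R/I\<^sup>n\<close> sends a coset
  of \<open>I\<^sup>n\<^sup>+\<^sup>1\<close> to the unique coset of \<open>I\<^sup>n\<close> containing it, so compatibility of a family of cosets is
  inclusion.\<close>
definition completion :: "('a, 'b) ring_scheme \<Rightarrow> 'a set \<Rightarrow> (nat \<Rightarrow> 'a set) ring"
  where "completion R I =
    \<lparr>carrier = {f. (\<forall>n. f n \<in> carrier (R Quot ideal_pow R I n)) \<and> (\<forall>n. f (Suc n) \<subseteq> f n)},
     monoid.mult = (\<lambda>f g n. f n \<otimes>\<^bsub>R Quot ideal_pow R I n\<^esub> g n),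
     one = (\<lambda>n. \<one>\<^bsub>R Quot ideal_pow R I n\<^esub>),
     zero = (\<lambda>n. \<zero>\<^bsub>R Quot ideal_pow R I n\<^esub>),
     add = (\<lambda>f g n. f n \<oplus>\<^bsub>R Quot ideal_pow R I n\<^esub> g n)\<rparr>"

definition analytically_unramified :: "('a, 'b) ring_scheme \<Rightarrow> 'a set \<Rightarrow> bool"
  where "analytically_unramified R m \<longleftrightarrow> reduced_ring (completion R m)"


section \<open>Length, multiplicity and embedding dimension\<close>

definition module_length :: "('a, 'b) ring_scheme \<Rightarrow> ('a, 'c, 'd) module_scheme \<Rightarrow> enat"
  where "module_length R M =
    (SUP n \<in> {n. \<exists>N. (\<forall>i\<le>n. Module.submodule (N i) R M) \<and> (\<forall>i<n. N i \<subset> N (Suc i))}. enat n)"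

text \<open>\<open>R/I\<close> as an \<open>R\<close>-module.\<close>
definition quot_module :: "('a, 'b) ring_scheme \<Rightarrow> 'a set \<Rightarrow> ('a, 'a set) module"
  where "quot_module R I =
    ring.extend (R Quot I) \<lparr>smult = (\<lambda>r A. (I +>\<^bsub>R\<^esub> r) \<otimes>\<^bsub>R Quot I\<^esub> A)\<rparr>"

text \<open>\<open>e(R) = lim d! \<ell>(R/m\<^sup>n) / n\<^sup>d\<close> with \<open>d = dim R\<close>.  Over a Noetherian local ring the dimension
  and the lengths are finite.\<close>
definition hilbert_samuel_multiplicity :: "('a, 'b) ring_scheme \<Rightarrow> 'a set \<Rightarrow> real"
  where "hilbert_samuel_multiplicity R m =
    (let d = the_enat (krull_dim R) in
      lim (\<lambda>n. fact d * real (the_enat (module_length R (quot_module R (ideal_pow R m n)))) / real n ^ d))"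

text \<open>\<open>m/m\<^sup>2\<close> as a vector space over \<open>R/m\<close>: the class of \<open>a\<close> acts on the class of \<open>x\<close> by giving the
  class of \<open>a x\<close>.  The ring fields \<open>mult\<close> and \<open>one\<close> play no role in a module.\<close>
definition cotangent_space :: "('a, 'b) ring_scheme \<Rightarrow> 'a set \<Rightarrow> ('a set, 'a set) module"
  where "cotangent_space R m =
    \<lparr>carrier = (\<lambda>x. ideal_pow R m 2 +>\<^bsub>R\<^esub> x) ` m,
     monoid.mult = undefined, one = undefined,
     zero = ideal_pow R m 2, add = set_add R,
     smult = rcoset_mult R (ideal_pow R m 2)\<rparr>"

definition embedding_dim :: "('a, 'b) ring_scheme \<Rightarrow> 'a set \<Rightarrow> nat"
  where "embedding_dim R m = vectorspace.dim (R Quot m) (cotangent_space R m)"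


section \<open>Reductions\<close>

definition reduction :: "('a, 'b) ring_scheme \<Rightarrow> 'a set \<Rightarrow> 'a set \<Rightarrow> bool"
  where "reduction R J I \<longleftrightarrow>
    ideal J R \<and> J \<subseteq> I \<and> (\<exists>n. J \<cdot>\<^bsub>R\<^esub> ideal_pow R I n = ideal_pow R I (Suc n))"

definition minimal_reduction :: "('a, 'b) ring_scheme \<Rightarrow> 'a set \<Rightarrow> 'a set \<Rightarrow> bool"
  where "minimal_reduction R J I \<longleftrightarrow>
    reduction R J I \<and> (\<forall>K. reduction R K I \<and> K \<subseteq> J \<longrightarrow> K = J)"


section \<open>Total ring of fractions, integral closure and conductor\<close>

text \<open>No auxiliary factor is needed in the equivalence of fractions, because the denominators are
  non-zero-divisors.\<close>
definition frac_rel :: "('a, 'b) ring_scheme \<Rightarrow> (('a \<times> 'a) \<times> ('a \<times> 'a)) set"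
  where "frac_rel R =
    {((a, s), (b, t)). a \<in> carrier R \<and> b \<in> carrier R \<and>
      s \<in> nonzero_divisors R \<and> t \<in> nonzero_divisors R \<and> a \<otimes>\<^bsub>R\<^esub> t = b \<otimes>\<^bsub>R\<^esub> s}"

definition mk_frac :: "('a, 'b) ring_scheme \<Rightarrow> 'a \<Rightarrow> 'a \<Rightarrow> ('a \<times> 'a) set"
  where "mk_frac R a s = frac_rel R `` {(a, s)}"

definition total_frac_ring :: "('a, 'b) ring_scheme \<Rightarrow> ('a \<times> 'a) set ring"
  where "total_frac_ring R =
    \<lparr>carrier = (carrier R \<times> nonzero_divisors R) // frac_rel R,
     monoid.mult = (\<lambda>A B. \<Union>(a, s) \<in> A. \<Union>(b, t) \<in> B. mk_frac R (a \<otimes>\<^bsub>R\<^esub> b) (s \<otimes>\<^bsub>R\<^esub> t)),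
     one = mk_frac R \<one>\<^bsub>R\<^esub> \<one>\<^bsub>R\<^esub>,
     zero = mk_frac R \<zero>\<^bsub>R\<^esub> \<one>\<^bsub>R\<^esub>,
     add = (\<lambda>A B. \<Union>(a, s) \<in> A. \<Union>(b, t) \<in> B.
       mk_frac R (a \<otimes>\<^bsub>R\<^esub> t \<oplus>\<^bsub>R\<^esub> b \<otimes>\<^bsub>R\<^esub> s) (s \<otimes>\<^bsub>R\<^esub> t))\<rparr>"

definition frac_embed :: "('a, 'b) ring_scheme \<Rightarrow> 'a \<Rightarrow> ('a \<times> 'a) set"
  where "frac_embed R a = mk_frac R a \<one>\<^bsub>R\<^esub>"

definition integral_over :: "('q, 'c) ring_scheme \<Rightarrow> 'q set \<Rightarrow> 'q \<Rightarrow> bool"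
  where "integral_over Q K z \<longleftrightarrow>
    (\<exists>p \<in> carrier (K[X]\<^bsub>Q\<^esub>). p \<noteq> [] \<and> Polynomials.lead_coeff p = \<one>\<^bsub>Q\<^esub> \<and> ring.eval Q p z = \<zero>\<^bsub>Q\<^esub>)"

definition integral_closure :: "('a, 'b) ring_scheme \<Rightarrow> ('a \<times> 'a) set set"
  where "integral_closure R =
    {z \<in> carrier (total_frac_ring R). integral_over (total_frac_ring R) (frac_embed R ` carrier R) z}"

definition conductor :: "('a, 'b) ring_scheme \<Rightarrow> ('a \<times> 'a) set set"
  where "conductor R =
    {z \<in> carrier (total_frac_ring R).
      \<forall>w \<in> integral_closure R. z \<otimes>\<^bsub>total_frac_ring R\<^esub> w \<in> frac_embed R ` carrier R}"

text \<open>The conductor is contained in the image of \<open>R\<close>; this is the same ideal inside \<open>R\<close> itself.\<close>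
definition conductor_ideal :: "('a, 'b) ring_scheme \<Rightarrow> 'a set"
  where "conductor_ideal R = {a \<in> carrier R. frac_embed R a \<in> conductor R}"


section \<open>The constructions are well defined\<close>

context cring
begin


lemma nzdD: "s \<in> nonzero_divisors R \<Longrightarrow> s \<in> carrier R"
  "\<lbrakk>s \<in> nonzero_divisors R; a \<in> carrier R; s \<otimes> a = \<zero>\<rbrakk> \<Longrightarrow> a = \<zero>"
  unfolding nonzero_divisors_def by blast+

lemma nzd_one: "\<one> \<in> nonzero_divisors R"
  by (auto simp: nonzero_divisors_def)

lemma nzd_mult: "\<lbrakk>s \<in> nonzero_divisors R; t \<in> nonzero_divisors R\<rbrakk> \<Longrightarrow> s \<otimes> t \<in> nonzero_divisors R"
  unfolding nonzero_divisors_def mem_Collect_eq by (metis m_assoc m_closed)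

lemma nzd_cancel:
  assumes "s \<in> nonzero_divisors R" "a \<in> carrier R" "b \<in> carrier R" "s \<otimes> a = s \<otimes> b"
  shows "a = b"
proof -
  have s: "s \<in> carrier R" using assms nzdD by auto
  have "s \<otimes> (a \<ominus> b) = \<zero>"
    using assms s by (simp add: minus_eq r_distr r_minus r_neg)
  then have "a \<ominus> b = \<zero>" using assms nzdD(2) by auto
  then show ?thesis using assms by (simp add: r_right_minus_eq)
qed

lemma equiv_frac_rel: "equiv (carrier R \<times> nonzero_divisors R) (frac_rel R)"
proof (rule equivI)
  show "refl_on (carrier R \<times> nonzero_divisors R) (frac_rel R)"
    by (auto simp: refl_on_def frac_rel_def)
  show "sym (frac_rel R)" by (auto simp: sym_def frac_rel_def)
  show "frac_rel R \<subseteq> (carrier R \<times> nonzero_divisors R) \<times> (carrier R \<times> nonzero_divisors R)"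
    by (auto simp: frac_rel_def)
  show "trans (frac_rel R)"
  proof (rule transI, clarsimp simp: frac_rel_def)
    fix a s b t c u
    assume c: "a \<in> carrier R" "b \<in> carrier R" "c \<in> carrier R"
      and n: "s \<in> nonzero_divisors R" "t \<in> nonzero_divisors R" "u \<in> nonzero_divisors R"
      and e: "a \<otimes> t = b \<otimes> s" "b \<otimes> u = c \<otimes> t"
    note k = n[THEN nzdD(1)]
    have "t \<otimes> (a \<otimes> u) = (a \<otimes> t) \<otimes> u" using c k by (simp add: m_ac)
    also have "\<dots> = (b \<otimes> u) \<otimes> s" unfolding e(1) using c k by (simp add: m_ac)
    also have "\<dots> = t \<otimes> (c \<otimes> s)" unfolding e(2) using c k by (simp add: m_ac)
    finally show "a \<otimes> u = c \<otimes> s" using nzd_cancel[OF n(2)] c k by auto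
  qed
qed

lemma mk_frac_eq_iff:
  assumes "a \<in> carrier R" "b \<in> carrier R" "s \<in> nonzero_divisors R" "t \<in> nonzero_divisors R"
  shows "mk_frac R a s = mk_frac R b t \<longleftrightarrow> a \<otimes> t = b \<otimes> s"
  unfolding mk_frac_def using eq_equiv_class_iff[OF equiv_frac_rel, of "(a,s)" "(b,t)"] assms
  by (simp add: frac_rel_def)

lemma mk_frac_mult:
  assumes c: "a \<in> carrier R" "b \<in> carrier R" and n: "s \<in> nonzero_divisors R" "t \<in> nonzero_divisors R"
  shows "mk_frac R a s \<otimes>\<^bsub>total_frac_ring R\<^esub> mk_frac R b t = mk_frac R (a \<otimes> b) (s \<otimes> t)"
proof -
  have "mk_frac R (fst x \<otimes> fst y) (snd x \<otimes> snd y) = mk_frac R (a \<otimes> b) (s \<otimes> t)"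
    if "x \<in> mk_frac R a s" "y \<in> mk_frac R b t" for x y
  proof -
    obtain a' s' b' t' where xy: "x = (a', s')" "y = (b', t')" by (cases x, cases y)
    have h: "a' \<in> carrier R" "s' \<in> nonzero_divisors R" "a \<otimes> s' = a' \<otimes> s"
       "b' \<in> carrier R" "t' \<in> nonzero_divisors R" "b \<otimes> t' = b' \<otimes> t"
      using that xy by (auto simp: mk_frac_def frac_rel_def)
    note k = h(2,5)[THEN nzdD(1)] n[THEN nzdD(1)]
    have "(a' \<otimes> b') \<otimes> (s \<otimes> t) = (a' \<otimes> s) \<otimes> (b' \<otimes> t)" using c h(1,4) k by (simp add: m_ac)
    also have "\<dots> = (a \<otimes> s') \<otimes> (b \<otimes> t')" using h by simp
    also have "\<dots> = (a \<otimes> b) \<otimes> (s' \<otimes> t')" using c h(1,4) k by (simp add: m_ac)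
    finally show ?thesis using c h n xy by (subst mk_frac_eq_iff) (auto simp: nzd_mult)
  qed
  moreover have "(a, s) \<in> mk_frac R a s" "(b, t) \<in> mk_frac R b t"
    using assms by (auto simp: mk_frac_def frac_rel_def)
  ultimately show ?thesis
    unfolding total_frac_ring_def by (simp add: case_prod_beta') blast
qed

lemma mk_frac_add:
  assumes c: "a \<in> carrier R" "b \<in> carrier R" and n: "s \<in> nonzero_divisors R" "t \<in> nonzero_divisors R"
  shows "mk_frac R a s \<oplus>\<^bsub>total_frac_ring R\<^esub> mk_frac R b t = mk_frac R (a \<otimes> t \<oplus> b \<otimes> s) (s \<otimes> t)"
proof -
  have "mk_frac R (fst x \<otimes> snd y \<oplus> fst y \<otimes> snd x) (snd x \<otimes> snd y) = mk_frac R (a \<otimes> t \<oplus> b \<otimes> s) (s \<otimes> t)"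
    if "x \<in> mk_frac R a s" "y \<in> mk_frac R b t" for x y
  proof -
    obtain a' s' b' t' where xy: "x = (a', s')" "y = (b', t')" by (cases x, cases y)
    have h: "a' \<in> carrier R" "s' \<in> nonzero_divisors R" "a \<otimes> s' = a' \<otimes> s"
       "b' \<in> carrier R" "t' \<in> nonzero_divisors R" "b \<otimes> t' = b' \<otimes> t"
      using that xy by (auto simp: mk_frac_def frac_rel_def)
    note k = h(2,5)[THEN nzdD(1)] n[THEN nzdD(1)]
    have "(a' \<otimes> t' \<oplus> b' \<otimes> s') \<otimes> (s \<otimes> t) = (a' \<otimes> s) \<otimes> (t' \<otimes> t) \<oplus> (b' \<otimes> t) \<otimes> (s' \<otimes> s)"
      using c h(1,4) k by (simp add: m_ac l_distr r_distr)
    also have "\<dots> = (a \<otimes> s') \<otimes> (t' \<otimes> t) \<oplus> (b \<otimes> t') \<otimes> (s' \<otimes> s)" using h by simp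
    also have "\<dots> = (a \<otimes> t \<oplus> b \<otimes> s) \<otimes> (s' \<otimes> t')" using c h(1,4) k by (simp add: m_ac l_distr r_distr)
    finally show ?thesis using c h n k xy by (subst mk_frac_eq_iff) (auto simp: nzd_mult)
  qed
  moreover have "(a, s) \<in> mk_frac R a s" "(b, t) \<in> mk_frac R b t"
    using assms by (auto simp: mk_frac_def frac_rel_def)
  ultimately show ?thesis
    unfolding total_frac_ring_def by (simp add: case_prod_beta') blast
qed

lemma carrier_total_frac_ring:
  "carrier (total_frac_ring R) = {mk_frac R a s | a s. a \<in> carrier R \<and> s \<in> nonzero_divisors R}"
  by (auto simp: total_frac_ring_def quotient_def mk_frac_def)

lemma frac_one_zero: "\<one>\<^bsub>total_frac_ring R\<^esub> = mk_frac R \<one> \<one>" "\<zero>\<^bsub>total_frac_ring R\<^esub> = mk_frac R \<zero> \<one>"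
  by (auto simp: total_frac_ring_def)

lemma cring_total_frac_ring: "cring (total_frac_ring R)"
proof (rule cringI)
  show "abelian_group (total_frac_ring R)"
  proof (rule abelian_groupI, goal_cases)
    case (6 x)
    then obtain a s where x: "x = mk_frac R a s" "a \<in> carrier R" "s \<in> nonzero_divisors R" by (auto simp: carrier_total_frac_ring)
    then have "mk_frac R (\<ominus> a) s \<oplus>\<^bsub>total_frac_ring R\<^esub> x = \<zero>\<^bsub>total_frac_ring R\<^esub>"
      using nzdD(1)[OF x(3)] by (simp add: mk_frac_add frac_one_zero mk_frac_eq_iff nzd_mult nzd_one l_minus l_neg)
    moreover have "mk_frac R (\<ominus> a) s \<in> carrier (total_frac_ring R)" using x by (auto simp: carrier_total_frac_ring)
    ultimately show ?case by blast
  next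
    case (3 x y z)
    then show ?case
      by (auto simp: carrier_total_frac_ring frac_one_zero mk_frac_add mk_frac_eq_iff nzdD nzd_mult nzd_one l_distr r_distr m_ac a_ac)
  next
    case (4 x y)
    then show ?case
      by (auto simp: carrier_total_frac_ring frac_one_zero mk_frac_add mk_frac_eq_iff nzdD nzd_mult nzd_one l_distr r_distr m_ac a_ac)
  next
    case (5 x)
    then show ?case
      by (auto simp: carrier_total_frac_ring frac_one_zero mk_frac_add mk_frac_eq_iff nzdD nzd_mult nzd_one l_distr r_distr m_ac a_ac)
  next
    case (1 x y)
    then obtain a s b t where "x = mk_frac R a s" "a \<in> carrier R" "s \<in> nonzero_divisors R"
      "y = mk_frac R b t" "b \<in> carrier R" "t \<in> nonzero_divisors R" unfolding carrier_total_frac_ring by blast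
    then show ?case unfolding carrier_total_frac_ring mem_Collect_eq
      by (intro exI[of _ "a \<otimes> t \<oplus> b \<otimes> s"] exI[of _ "s \<otimes> t"]) (simp add: mk_frac_add nzd_mult nzdD)
  next
    case 2 show ?case using nzd_one by (auto simp: carrier_total_frac_ring frac_one_zero)
  qed
  show "comm_monoid (total_frac_ring R)"
  proof (rule comm_monoidI, goal_cases)
    case (1 x y)
    then obtain a s b t where "x = mk_frac R a s" "a \<in> carrier R" "s \<in> nonzero_divisors R"
      "y = mk_frac R b t" "b \<in> carrier R" "t \<in> nonzero_divisors R" unfolding carrier_total_frac_ring by blast
    then show ?case unfolding carrier_total_frac_ring mem_Collect_eq
      by (intro exI[of _ "a \<otimes> b"] exI[of _ "s \<otimes> t"]) (simp add: mk_frac_mult nzd_mult nzdD)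
  next
    case 2 show ?case using nzd_one by (auto simp: carrier_total_frac_ring frac_one_zero)
  next
    case (3 x y z)
    then show ?case by (auto simp: carrier_total_frac_ring mk_frac_mult mk_frac_eq_iff nzdD nzd_mult nzd_one m_ac)
  next
    case (4 x)
    then show ?case by (auto simp: carrier_total_frac_ring frac_one_zero mk_frac_mult mk_frac_eq_iff nzdD nzd_mult nzd_one m_ac)
  next
    case (5 x y)
    then show ?case by (auto simp: carrier_total_frac_ring mk_frac_mult mk_frac_eq_iff nzdD nzd_mult nzd_one m_ac)
  qed
next
  fix x y z assume "x \<in> carrier (total_frac_ring R)" "y \<in> carrier (total_frac_ring R)" "z \<in> carrier (total_frac_ring R)"
  then obtain a s b t c u where e: "x = mk_frac R a s" "y = mk_frac R b t" "z = mk_frac R c u"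
    and c: "a \<in> carrier R" "b \<in> carrier R" "c \<in> carrier R"
    and n: "s \<in> nonzero_divisors R" "t \<in> nonzero_divisors R" "u \<in> nonzero_divisors R"
    unfolding carrier_total_frac_ring by blast
  note k = n[THEN nzdD(1)]
  have "mk_frac R ((a \<otimes> t \<oplus> b \<otimes> s) \<otimes> c) (s \<otimes> t \<otimes> u) =
    mk_frac R (a \<otimes> c \<otimes> (t \<otimes> u) \<oplus> b \<otimes> c \<otimes> (s \<otimes> u)) (s \<otimes> u \<otimes> (t \<otimes> u))"
    using c n k by (subst mk_frac_eq_iff) (auto simp: nzd_mult l_distr r_distr m_ac)
  then show "(x \<oplus>\<^bsub>total_frac_ring R\<^esub> y) \<otimes>\<^bsub>total_frac_ring R\<^esub> z = x \<otimes>\<^bsub>total_frac_ring R\<^esub> z \<oplus>\<^bsub>total_frac_ring R\<^esub> y \<otimes>\<^bsub>total_frac_ring R\<^esub> z"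
    using c n k unfolding e by (simp add: mk_frac_mult mk_frac_add nzd_mult)
qed

lemma frac_embed_hom: "frac_embed R \<in> ring_hom R (total_frac_ring R)"
proof (rule ring_hom_memI)
  show "frac_embed R a \<in> carrier (total_frac_ring R)" if "a \<in> carrier R" for a
    using that nzd_one unfolding carrier_total_frac_ring frac_embed_def by blast
qed (simp_all add: frac_embed_def mk_frac_mult mk_frac_add frac_one_zero nzd_one)

lemma frac_embed_inj: "inj_on (frac_embed R) (carrier R)"
  by (auto simp: inj_on_def frac_embed_def mk_frac_eq_iff nzd_one)

lemma ideal_pow_ideal: assumes "ideal I R" shows "ideal (ideal_pow R I n) R"
  by (induct n) (auto simp: ideals_set_def oneideal intro!: ideal_prod_is_ideal assms[unfolded ideals_set_def])

lemma module_quot_module: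
  assumes "ideal I R" shows "module R (quot_module R I)"
proof -
  interpret I: ideal I R by fact
  interpret Q: cring "R Quot I" by (rule I.quotient_is_cring) (rule is_cring)
  have h: "r \<in> carrier R \<Longrightarrow> I +> r \<in> carrier (R Quot I)" for r
    by (auto simp: FactRing_def A_RCOSETS_def')
  have hom: "r \<in> carrier R \<Longrightarrow> s \<in> carrier R \<Longrightarrow> I +> (r \<oplus> s) = (I +> r) \<oplus>\<^bsub>R Quot I\<^esub> (I +> s)"
     "r \<in> carrier R \<Longrightarrow> s \<in> carrier R \<Longrightarrow> I +> (r \<otimes> s) = (I +> r) \<otimes>\<^bsub>R Quot I\<^esub> (I +> s)"
     "I +> \<one> = \<one>\<^bsub>R Quot I\<^esub>" for r s
    using I.rcos_ring_hom by (auto simp: ring_hom_def)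
  have ag: "abelian_group (quot_module R I)"
    by (rule abelian_groupI)
      (use Q.l_neg Q.a_inv_closed in \<open>auto simp: quot_module_def ring.defs Q.a_ac\<close>)
  show ?thesis
    by (rule moduleI[OF is_cring ag])
      (auto simp: quot_module_def ring.defs h hom Q.l_distr Q.r_distr Q.m_assoc)
qed

end

lemma (in local_ring) vectorspace_cotangent_space: "vectorspace (R Quot m) (cotangent_space R m)"
proof -
  interpret m: maximalideal m R by (rule maximal_ideal)
  have idm: "ideal m R" by (rule m.is_ideal)
  define J where "J = ideal_pow R m 2"
  have J: "J = m \<cdot> m" 
  proof -
    have "J = (carrier R \<cdot> m) \<cdot> m" unfolding J_def by (simp add: numeral_2_eq_2 ideals_set_def)
    also have "carrier R \<cdot> m = m" using ideal_prod_one idm ideal_prod_commute oneideal by metis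
    finally show ?thesis .
  qed
  interpret J: ideal J R unfolding J_def by (rule ideal_pow_ideal[OF idm])
  have Jm: "J \<subseteq> m" using J ideal_prod_inter idm by auto
  interpret k: field "R Quot m" by (rule m.quotient_is_field) (rule is_cring)
  have car: "carrier (R Quot m) = {m +> a | a. a \<in> carrier R}"
    by (auto simp: FactRing_def A_RCOSETS_def')
  have act: "rcoset_mult R J (m +> a) (J +> x) = J +> (a \<otimes> x)" if "a \<in> carrier R" "x \<in> m" for a x
  proof -
    have xc: "x \<in> carrier R" using that m.Icarr by auto
    have "J +> (a' \<otimes> x') = J +> (a \<otimes> x)" if ax: "a' \<in> m +> a" "x' \<in> J +> x" for a' x'
    proof -
      obtain p q where p: "p \<in> m" "a' = p \<oplus> a" and q: "q \<in> J" "x' = q \<oplus> x"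
        using ax unfolding a_r_coset_def' by blast
      have pq: "p \<in> carrier R" "q \<in> carrier R" using p q m.Icarr J.Icarr by auto
      have "p \<otimes> x \<in> J" unfolding J using p \<open>x \<in> m\<close> by (auto intro: ideal_prod.prod)
      moreover have "a' \<otimes> q \<in> J" using q p pq \<open>a \<in> carrier R\<close> by (auto intro: J.I_l_closed)
      ultimately have j: "a' \<otimes> q \<oplus> p \<otimes> x \<in> J" by auto
      have "a' \<otimes> x' = (a' \<otimes> q \<oplus> p \<otimes> x) \<oplus> a \<otimes> x"
        using p q pq xc \<open>a \<in> carrier R\<close> by (simp add: l_distr r_distr a_assoc)
      then have "a' \<otimes> x' \<in> J +> (a \<otimes> x)" using j by (auto simp: a_r_coset_def')
      then show ?thesis using J.a_repr_independence' xc \<open>a \<in> carrier R\<close> m_closed by metis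
    qed
    moreover have "a \<in> m +> a" "x \<in> J +> x" using that xc m.a_rcos_self J.a_rcos_self by auto
    ultimately show ?thesis unfolding rcoset_mult_def by blast
  qed
  let ?V = "cotangent_space R m"
  have V: "carrier ?V = (\<lambda>x. J +> x) ` m" "\<zero>\<^bsub>?V\<^esub> = J" "(\<oplus>\<^bsub>?V\<^esub>) = set_add R" "(\<odot>\<^bsub>?V\<^esub>) = rcoset_mult R J"
    by (simp_all add: cotangent_space_def J_def)
  have mc: "x \<in> m \<Longrightarrow> x \<in> carrier R" for x using m.Icarr by auto
  have m0: "\<zero> \<in> m" by simp
  have J0: "J +> \<zero> = J" by (simp add: J.a_rcos_const)
  have add: "(J +> x) <+> (J +> y) = J +> (x \<oplus> y)" if "x \<in> m" "y \<in> m" for x y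
    using that mc J.a_rcos_sum by auto
  have ag: "abelian_group ?V"
  proof (rule abelian_groupI, unfold V, goal_cases)
    case (6 x) then obtain a where a: "a \<in> m" "x = J +> a" by auto
    have "\<ominus> a \<in> m" using a by auto
    then show ?case using a mc by (intro bexI[of _ "J +> (\<ominus> a)"]) (auto simp: add l_neg J0)
  next case (5 x) then show ?case using add[OF m0] J0 mc by auto
  next case 2 show ?case using J0 m0 by blast
  next case (4 x y) then show ?case by (auto simp: add mc a_ac)
  next case (3 x y z) then show ?case by (auto simp: add mc a_ac)
  next case (1 x y) then show ?case by (auto simp: add)
  qed
  have qadd: "(m +> a) \<oplus>\<^bsub>R Quot m\<^esub> (m +> b) = m +> (a \<oplus> b)"
    "(m +> a) \<otimes>\<^bsub>R Quot m\<^esub> (m +> b) = m +> (a \<otimes> b)" if "a \<in> carrier R" "b \<in> carrier R" for a b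
    using that m.rcos_ring_hom by (auto simp: ring_hom_def)
  have q1: "\<one>\<^bsub>R Quot m\<^esub> = m +> \<one>" by (simp add: FactRing_def)
  have "module (R Quot m) ?V"
    apply (rule moduleI[OF k.is_cring ag])
    unfolding V car q1
    by (auto simp: act add qadd mc l_distr r_distr m_assoc m.I_l_closed)
  then show ?thesis by (intro vectorspace.intro k.field_axioms)
qed

context cring
begin

lemma ideal_pow_Suc_subset: assumes "ideal I R" shows "ideal_pow R I (Suc n) \<subseteq> ideal_pow R I n"
  using ideal_prod_inter[OF ideal_pow_ideal[OF assms, of n] assms] by (simp add: ideals_set_def)

lemma cring_completion:
  assumes I: "ideal I R" shows "cring (completion R I)"
proof -
  let ?Q = "\<lambda>n. R Quot ideal_pow R I n"
  have P: "ideal (ideal_pow R I n) R" for n by (rule ideal_pow_ideal[OF I])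
  have Q: "cring (?Q n)" for n by (rule ideal.quotient_is_cring[OF P is_cring])
  have hom: "(\<lambda>r. ideal_pow R I n +> r) \<in> ring_hom R (?Q n)" for n
    by (rule ideal.rcos_ring_hom[OF P])
  have car: "carrier (?Q n) = {ideal_pow R I n +> r | r. r \<in> carrier R}" for n
    by (auto simp: FactRing_def A_RCOSETS_def')
  have rep: "ideal_pow R I (Suc n) +> r \<subseteq> ideal_pow R I n +> r" for n r
    using ideal_pow_Suc_subset[OF I, of n] unfolding a_r_coset_def' by blast
  have uniq: "ideal_pow R I n +> r = ideal_pow R I n +> s"
    if "ideal_pow R I (Suc n) +> r \<subseteq> ideal_pow R I n +> s" "r \<in> carrier R" "s \<in> carrier R" for n r s
  proof -
    interpret a: ideal "ideal_pow R I n" R by (rule P)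
    interpret b: ideal "ideal_pow R I (Suc n)" R by (rule P)
    have "r \<in> ideal_pow R I n +> s" using that b.a_rcos_self by blast
    then show ?thesis using a.a_repr_independence' that by metis
  qed
  have com: "(\<forall>n. f n \<in> carrier (?Q n)) \<and> (\<forall>n. f (Suc n) \<subseteq> f n) \<longleftrightarrow>
      (\<forall>n. \<exists>r \<in> carrier R. f n = ideal_pow R I n +> r \<and> f (Suc n) = ideal_pow R I (Suc n) +> r)" for f
  proof (intro iffI allI, goal_cases)
    case (1 n)
    then have "f n \<in> carrier (?Q n)" "f (Suc n) \<in> carrier (?Q (Suc n))" by blast+
    then obtain r s where rs: "r \<in> carrier R" "s \<in> carrier R" "f n = ideal_pow R I n +> r" "f (Suc n) = ideal_pow R I (Suc n) +> s"
      unfolding car by blast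
    then show ?case using uniq[of n s r] 1 by metis
  next
    case 2
    show ?case
    proof (intro conjI allI)
      fix n
      obtain r where "r \<in> carrier R" "f n = ideal_pow R I n +> r" "f (Suc n) = ideal_pow R I (Suc n) +> r" using 2 by blast
      then show "f n \<in> carrier (?Q n)" "f (Suc n) \<subseteq> f n" using rep unfolding car by auto
    qed
  qed
  define C where "C = {f. \<forall>n. \<exists>r \<in> carrier R. f n = ideal_pow R I n +> r \<and> f (Suc n) = ideal_pow R I (Suc n) +> r}"
  have Ccar: "carrier (completion R I) = C" unfolding completion_def C_def using com by auto
  have CQ: "f n \<in> carrier (?Q n)" if "f \<in> C" for f n using that unfolding C_def car by blast
  have Cadd: "(\<lambda>n. f n \<oplus>\<^bsub>?Q n\<^esub> g n) \<in> C" and Cmult: "(\<lambda>n. f n \<otimes>\<^bsub>?Q n\<^esub> g n) \<in> C" if fg: "f \<in> C" "g \<in> C" for f g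
  proof -
    { fix n
      obtain r s where rs: "r \<in> carrier R" "f n = ideal_pow R I n +> r" "f (Suc n) = ideal_pow R I (Suc n) +> r"
        "s \<in> carrier R" "g n = ideal_pow R I n +> s" "g (Suc n) = ideal_pow R I (Suc n) +> s"
        using fg unfolding C_def by blast
      have "f n \<oplus>\<^bsub>?Q n\<^esub> g n = ideal_pow R I n +> (r \<oplus> s)"
        "f (Suc n) \<oplus>\<^bsub>?Q (Suc n)\<^esub> g (Suc n) = ideal_pow R I (Suc n) +> (r \<oplus> s)"
        "f n \<otimes>\<^bsub>?Q n\<^esub> g n = ideal_pow R I n +> (r \<otimes> s)"
        "f (Suc n) \<otimes>\<^bsub>?Q (Suc n)\<^esub> g (Suc n) = ideal_pow R I (Suc n) +> (r \<otimes> s)"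
        unfolding rs(2,3,5,6) by (rule ring_hom_add[OF hom rs(1,4), symmetric]
          ring_hom_mult[OF hom rs(1,4), symmetric])+
      then have "\<exists>q\<in>carrier R. f n \<oplus>\<^bsub>?Q n\<^esub> g n = ideal_pow R I n +> q \<and> f (Suc n) \<oplus>\<^bsub>?Q (Suc n)\<^esub> g (Suc n) = ideal_pow R I (Suc n) +> q"
       "\<exists>q\<in>carrier R. f n \<otimes>\<^bsub>?Q n\<^esub> g n = ideal_pow R I n +> q \<and> f (Suc n) \<otimes>\<^bsub>?Q (Suc n)\<^esub> g (Suc n) = ideal_pow R I (Suc n) +> q"
        using rs(1,4) by blast+ }
    then show "(\<lambda>n. f n \<oplus>\<^bsub>?Q n\<^esub> g n) \<in> C" "(\<lambda>n. f n \<otimes>\<^bsub>?Q n\<^esub> g n) \<in> C" unfolding C_def by blast+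
  qed
  have K: "(\<lambda>n. ideal_pow R I n +> r) \<in> C" if "r \<in> carrier R" for r using that unfolding C_def by blast
  have k1: "\<one>\<^bsub>?Q n\<^esub> = ideal_pow R I n +> \<one>" "\<zero>\<^bsub>?Q n\<^esub> = ideal_pow R I n +> \<zero>" for n
    using ring_hom_one[OF hom] ring_hom_zero[OF hom ring_axioms cring.axioms(1)[OF Q]] by metis+
  note S = Ccar Cadd Cmult completion_def
  have ops: "(\<lambda>n. \<one>\<^bsub>?Q n\<^esub>) \<in> C" "(\<lambda>n. \<zero>\<^bsub>?Q n\<^esub>) \<in> C" unfolding k1 using K by auto
  have neg: "\<exists>g \<in> C. \<forall>n. g n \<oplus>\<^bsub>?Q n\<^esub> f n = \<zero>\<^bsub>?Q n\<^esub>" if f: "f \<in> C" for f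
  proof -
    have "(\<lambda>n. (ideal_pow R I n +> \<ominus> \<one>) \<otimes>\<^bsub>?Q n\<^esub> f n) \<in> C" using Cmult[OF K f] by auto
    moreover have "((ideal_pow R I n +> \<ominus> \<one>) \<otimes>\<^bsub>?Q n\<^esub> f n) \<oplus>\<^bsub>?Q n\<^esub> f n = \<zero>\<^bsub>?Q n\<^esub>" for n
    proof -
      obtain r where r: "r \<in> carrier R" "f n = ideal_pow R I n +> r" using f unfolding C_def by blast
      have "\<ominus> \<one> \<otimes> r \<oplus> r = \<zero>" using r by (simp add: l_minus l_neg)
      then show ?thesis unfolding r k1 using r ring_hom_add[OF hom] ring_hom_mult[OF hom]
        by (metis a_inv_closed m_closed one_closed)
    qed
    ultimately show ?thesis by (intro bexI[of _ "\<lambda>n. (ideal_pow R I n +> \<ominus> \<one>) \<otimes>\<^bsub>?Q n\<^esub> f n"]) auto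
  qed
  have M: "carrier (completion R I) = C"
    "f \<oplus>\<^bsub>completion R I\<^esub> g = (\<lambda>n. f n \<oplus>\<^bsub>?Q n\<^esub> g n)" "f \<otimes>\<^bsub>completion R I\<^esub> g = (\<lambda>n. f n \<otimes>\<^bsub>?Q n\<^esub> g n)"
    "\<zero>\<^bsub>completion R I\<^esub> = (\<lambda>n. \<zero>\<^bsub>?Q n\<^esub>)" "\<one>\<^bsub>completion R I\<^esub> = (\<lambda>n. \<one>\<^bsub>?Q n\<^esub>)" for f g
    by (simp_all add: Ccar) (simp_all add: completion_def)
  have ring: "ring (?Q n)" for n using Q cring.axioms(1) by blast
  show ?thesis
  proof (rule cringI)
    show "abelian_group (completion R I)"
    proof (rule abelian_groupI, goal_cases)
      case 6 then show ?case unfolding M using neg by (simp add: fun_eq_iff)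
    qed (auto simp: M CQ Cadd ops fun_eq_iff ring.ring_simprules[OF ring])
    show "comm_monoid (completion R I)"
      by (rule comm_monoidI) (auto simp: M CQ Cmult ops fun_eq_iff ring.ring_simprules[OF ring] cring.cring_simprules[OF Q] monoid.r_one[OF ring.is_monoid[OF ring]])
  qed (auto simp: M CQ fun_eq_iff ring.ring_simprules[OF ring])
qed

lemma conductor_eq_conductor_ideal:
  assumes "\<one> \<noteq> \<zero>"
  shows "conductor R = frac_embed R ` conductor_ideal R"
proof -
  interpret Q: cring "total_frac_ring R" by (rule cring_total_frac_ring)
  have sub: "subring (frac_embed R ` carrier R) (total_frac_ring R)"
    using ring_hom_ring.img_is_subring[OF ring_hom_ringI2[OF ring_axioms Q.ring_axioms frac_embed_hom] carrier_is_subring] .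
  have one: "\<one>\<^bsub>total_frac_ring R\<^esub> \<in> frac_embed R ` carrier R" using subringE(3)[OF sub] .
  have n: "\<one>\<^bsub>total_frac_ring R\<^esub> \<noteq> \<zero>\<^bsub>total_frac_ring R\<^esub>"
    using assms by (simp add: frac_one_zero mk_frac_eq_iff nzd_one)
  let ?p = "[\<one>\<^bsub>total_frac_ring R\<^esub>, \<ominus>\<^bsub>total_frac_ring R\<^esub> \<one>\<^bsub>total_frac_ring R\<^esub>]"
  have "?p \<in> carrier ((frac_embed R ` carrier R)[X]\<^bsub>total_frac_ring R\<^esub>)"
    using n one subringE(5)[OF sub one] by (simp add: univ_poly_def polynomial_def)
  moreover have "Q.eval ?p \<one>\<^bsub>total_frac_ring R\<^esub> = \<zero>\<^bsub>total_frac_ring R\<^esub>" by (simp add: Q.r_neg)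
  ultimately have "\<one>\<^bsub>total_frac_ring R\<^esub> \<in> integral_closure R"
    unfolding integral_closure_def integral_over_def
    by (intro CollectI conjI Q.one_closed bexI[of _ ?p]) auto
  then have "z \<in> frac_embed R ` carrier R" if "z \<in> conductor R" for z
    using that Q.r_one[of z] unfolding conductor_def by force
  moreover have "frac_embed R a \<in> conductor R \<Longrightarrow> a \<in> carrier R \<Longrightarrow> a \<in> conductor_ideal R" for a
    by (simp add: conductor_ideal_def)
  ultimately show ?thesis by (auto simp: conductor_ideal_def)
qed
end

end

theory Submission
  imports Defs
begin

text \<open>Since \<open>m\<^sup>N\<^sup>+\<^sup>1 = x m\<^sup>N\<close>, the multiplicity is \<open>e = \<ell>(R/xR) = \<ell>(m/xR) + 1\<close>. For \<open>y\<close> in \<open>m\<close> the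
  fraction \<open>y/x\<close> is integral over \<open>R\<close>, hence \<open>m c \<subseteq> xR\<close> for the conductor \<open>c\<close>. If \<open>R\<close> is not a
  discrete valuation ring, then \<open>c \<subseteq> m\<close>; as \<open>x\<close> is not in \<open>m\<^sup>2\<close>, the module \<open>m/xR\<close> has \<open>\<nu> - 1\<close>
  generators, each killed by \<open>c + xR\<close>, so \<open>e - 1 \<le> (\<nu> - 1) \<ell>(R/(c + xR)) \<le> (\<nu> - 1) \<ell>(R/c)\<close>.
  Equality forces \<open>x\<close> into \<open>c\<close>, and then \<open>m\<close> too, because \<open>y = x (y/x)\<close>; conversely \<open>c = m\<close>
  gives \<open>m\<^sup>2 \<subseteq> xR\<close>, so that \<open>\<ell>(m/xR) = \<nu> - 1\<close>.

  The length of \<open>R/c\<close> is finite because a power of \<open>x\<close> is a common denominator of all integral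
  fractions. Indeed \<open>y/x\<^sup>n\<close> is integral iff its powers have a common denominator, and then it
  satisfies a monic equation of degree at most \<open>e\<close>. Unbounded denominators would therefore yield a
  nonzero nilpotent element in the completion.\<close>

text \<open>The obstacle is the finite length of R/c, which amounts to a bound on the denominators
  of integral fractions. The completion can supply it because the degree bound does not depend on
  the denominator. Clearing denominators in a monic equation of degree i for y/x^n writes y^i as a
  combination of terms divisible by x^n, so y^e lies in x^n R. As e is the same for all n, this
  survives the passage to a limit of such numerators; exponents growing with n would say nothing
  about the limit. The bound is e because \<ell>(A/xA) = \<ell>(R/xR) for every ideal A that
  contains a power of x. The same identity makes the Hilbert function linear with slope e. Integral
  fractions are handled inside R: every non-zero-divisor divides a power of x, so a fraction is a
  numerator over some x^n, and the numerators of the integral ones form an ideal \<open>H n\<close>.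
  All lengths then become lengths of chains of ideals of R.\<close>

no_notation Sum_Type.Plus (infixr \<open><+>\<close> 65)

section \<open>Lengths of chains of sets\<close>

text \<open>The supremum of \<open>module_length\<close> with an arbitrary family in place of the
  submodules, so that chains in different structures can be compared by plain maps between
  sets.\<close>

definition height :: "'a set set \<Rightarrow> enat"
  where "height S =
    (SUP n \<in> {n. \<exists>N. (\<forall>i\<le>n. N i \<in> S) \<and> (\<forall>i<n. N i \<subset> N (Suc i))}. enat n)"

text \<open>A chain of \<open>n\<close> steps of which only the top member is recorded. This is all
  that is needed to extend it, and it provides an induction rule, unlike the indexing functions in
  \<open>height\<close>.\<close>

inductive chain_to :: "'a set set \<Rightarrow> 'a set \<Rightarrow> nat \<Rightarrow> bool" for S
  where
    base: "V \<in> S \<Longrightarrow> chain_to S V 0"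
  | step: "\<lbrakk>chain_to S V n; V \<subset> Y; Y \<in> S\<rbrakk> \<Longrightarrow> chain_to S Y (Suc n)"

lemma chain_to_in: "chain_to S V n \<Longrightarrow> V \<in> S"
  by (erule chain_to.cases) auto

lemma chain_to_iff:
  "chain_to S V n \<longleftrightarrow> (\<exists>N. (\<forall>i\<le>n. N i \<in> S) \<and> (\<forall>i<n. N i \<subset> N (Suc i)) \<and> N n = V)"
proof
  assume "chain_to S V n"
  then show "\<exists>N. (\<forall>i\<le>n. N i \<in> S) \<and> (\<forall>i<n. N i \<subset> N (Suc i)) \<and> N n = V"
  proof induction
    case (base V)
    then show ?case by (intro exI[of _ "\<lambda>_. V"]) auto
  next
    case (step V n Y)
    then obtain N where "\<forall>i\<le>n. N i \<in> S" "\<forall>i<n. N i \<subset> N (Suc i)" "N n = V" by blast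
    then show ?case using step by (intro exI[of _ "N(Suc n := Y)"]) (auto simp: less_Suc_eq le_Suc_eq)
  qed
next
  assume "\<exists>N. (\<forall>i\<le>n. N i \<in> S) \<and> (\<forall>i<n. N i \<subset> N (Suc i)) \<and> N n = V"
  then obtain N where N: "\<forall>i\<le>n. N i \<in> S" "\<forall>i<n. N i \<subset> N (Suc i)" "N n = V" by blast
  have "chain_to S (N k) k" if "k \<le> n" for k
    using that
  proof (induction k)
    case 0 then show ?case using N by (auto intro: chain_to.base)
  next
    case (Suc k)
    then show ?case using N by (intro chain_to.step[of S "N k"]) auto
  qed
  then show "chain_to S V n" using N by blast
qed

lemma height_eq: "height S = (SUP n \<in> {n. \<exists>V. chain_to S V n}. enat n)"
  unfolding height_def chain_to_iff by simp

lemma height_le_iff: "height S \<le> k \<longleftrightarrow> (\<forall>V n. chain_to S V n \<longrightarrow> enat n \<le> k)"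
  unfolding height_eq SUP_le_iff by blast

lemma chain_le_height: "chain_to S V n \<Longrightarrow> enat n \<le> height S"
  using height_le_iff by blast

lemma chain_to_truncate:
  assumes "chain_to S V n" "k \<le> n" shows "\<exists>Y. chain_to S Y k"
  using assms
proof (induction rule: chain_to.induct)
  case (base V) then show ?case by (auto intro: chain_to.base)
next
  case (step V n Y)
  show ?case
  proof (cases "k \<le> n")
    case True then show ?thesis using step.IH by blast
  next
    case False
    then have "k = Suc n" using step.prems by simp
    then show ?thesis using chain_to.step[OF step.hyps] by blast
  qed
qed

lemma height_ge_obtain:
  assumes "enat k \<le> height S" "S \<noteq> {}"
  obtains V where "chain_to S V k"
proof (cases k)
  case 0 then show ?thesis using assms that by (auto intro: chain_to.base)
next
  case (Suc l)
  have "\<not> height S \<le> enat l"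
  proof
    assume "height S \<le> enat l"
    with assms(1) have "enat k \<le> enat l" by (rule order_trans)
    then show False using Suc by simp
  qed
  then obtain V n where n: "chain_to S V n" "\<not> enat n \<le> enat l" unfolding height_le_iff by blast
  then have "k \<le> n" using Suc by simp
  then show ?thesis using chain_to_truncate[OF n(1)] that by blast
qed

lemma height_mono_map:
  assumes "\<And>V. V \<in> S \<Longrightarrow> f V \<in> T"
    and "\<And>V Y. \<lbrakk>V \<in> S; Y \<in> S; V \<subset> Y\<rbrakk> \<Longrightarrow> f V \<subset> f Y"
  shows "height S \<le> height T"
proof -
  have "chain_to T (f V) n" if "chain_to S V n" for V n
    using that
  proof induction
    case (base V) then show ?case using assms by (auto intro: chain_to.base)
  next
    case (step V n Y)
    then have "f V \<subset> f Y" using assms(2) chain_to_in[OF step.hyps(1)] by blast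
    then show ?case using step assms(1) by (intro chain_to.step[of T "f V"])
  qed
  then show ?thesis unfolding height_le_iff using chain_le_height by blast
qed

text \<open>Every strict step in \<open>S\<close> is strict under \<open>f\<close> or under
  \<open>g\<close>, so the steps of a chain are shared out between its two images once repetitions
  are dropped.\<close>

lemma height_le_add:
  assumes "\<And>V. V \<in> S \<Longrightarrow> f V \<in> T" and "\<And>V. V \<in> S \<Longrightarrow> g V \<in> U"
    and "\<And>V Y. \<lbrakk>V \<in> S; Y \<in> S; V \<subset> Y\<rbrakk> \<Longrightarrow> f V \<subseteq> f Y \<and> g V \<subseteq> g Y \<and> (f V \<noteq> f Y \<or> g V \<noteq> g Y)"
  shows "height S \<le> height T + height U"
proof -
  have "\<exists>p q. chain_to T (f V) p \<and> chain_to U (g V) q \<and> n \<le> p + q" if "chain_to S V n" for V n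
    using that
  proof induction
    case (base V) then show ?case using assms(1,2) by (blast intro: chain_to.base)
  next
    case (step V n Y)
    then obtain p q where pq: "chain_to T (f V) p" "chain_to U (g V) q" "n \<le> p + q" by blast
    have XY: "f V \<subseteq> f Y" "g V \<subseteq> g Y" "f V \<noteq> f Y \<or> g V \<noteq> g Y"
      using assms(3)[OF chain_to_in[OF step.hyps(1)]] step.hyps by auto
    have p: "\<exists>p'. chain_to T (f Y) p' \<and> p' = (if f V = f Y then p else Suc p)"
      using pq(1) XY(1) assms(1)[OF step.hyps(3)] by (auto intro: chain_to.step)
    have q: "\<exists>q'. chain_to U (g Y) q' \<and> q' = (if g V = g Y then q else Suc q)"
      using pq(2) XY(2) assms(2)[OF step.hyps(3)] by (auto intro: chain_to.step)
    from p q pq(3) XY(3) show ?case by (force split: if_splits)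
  qed
  moreover have "enat n \<le> height T + height U"
    if "chain_to T V p" "chain_to U Y q" "n \<le> p + q" for V Y n p q
  proof -
    have "enat n \<le> enat p + enat q" using that by simp
    also have "\<dots> \<le> height T + height U" using that by (intro add_mono chain_le_height)
    finally show ?thesis .
  qed
  ultimately show ?thesis unfolding height_le_iff by blast
qed

text \<open>A chain in \<open>T\<close> is continued by one in \<open>U\<close>. If the top of the
  first is the bottom of the second, the two are glued there; otherwise the junction adds a
  step.\<close>

lemma height_add_le:
  assumes "T \<subseteq> S" "U \<subseteq> S" "T \<noteq> {}" "U \<noteq> {}" and TU: "\<And>V Y. \<lbrakk>V \<in> T; Y \<in> U\<rbrakk> \<Longrightarrow> V \<subseteq> Y"
  shows "height T + height U \<le> height S"
proof -
  have *: "enat (p + q) \<le> height S" if p: "enat p \<le> height T" and q: "enat q \<le> height U" for p q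
  proof -
    obtain V where V: "chain_to T V p" using height_ge_obtain[OF p] assms by blast
    obtain Y where Y: "chain_to U Y q" using height_ge_obtain[OF q] assms by blast
    have XS: "chain_to S V p"
      using V by induction (use assms in \<open>auto intro: chain_to.intros\<close>)
    from Y have "\<exists>r. chain_to S Y r \<and> p + q \<le> r"
    proof induction
      case (base Y)
      show ?case
      proof (cases "V = Y")
        case True then show ?thesis using XS by auto
      next
        case False
        then have "V \<subset> Y" using TU[OF chain_to_in[OF V] base] by blast
        then have "chain_to S Y (Suc p)" using XS base assms by (auto intro: chain_to.step)
        then show ?thesis by (intro exI[of _ "Suc p"]) auto
      qed
    next
      case (step Y n Z)
      then obtain r where "chain_to S Y r" "p + n \<le> r" by blast
      then show ?case using step assms by (intro exI[of _ "Suc r"]) (auto intro: chain_to.step)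
    qed
    then obtain r where "chain_to S Y r" "p + q \<le> r" by blast
    then show ?thesis using chain_le_height[of S Y r] order_trans[of "enat (p+q)" "enat r"] by simp
  qed
  show ?thesis
  proof (cases "height S")
    case (enat s)
    \<comment> \<open>Taking 0 for the other summand in \<open>*\<close> shows that finiteness of
      \<open>height S\<close> passes to both heights.\<close>
    have "\<not> enat (Suc s) \<le> height T" using *[of "Suc s" 0] enat by (auto simp flip: zero_enat_def)
    then obtain t where t: "height T = enat t" by (cases "height T") auto
    have "\<not> enat (Suc s) \<le> height U" using *[of 0 "Suc s"] enat by (auto simp flip: zero_enat_def)
    then obtain u where u: "height U = enat u" by (cases "height U") auto
    show ?thesis using *[of t u] t u by simp
  qed simp
qed

section \<open>Lengths of subquotients of a ring\<close>

text \<open>For ideals \<open>A\<close> contained in \<open>B\<close> this is the length of the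
  module B/A, by the correspondence between its submodules and the ideals in between; no quotient
  module has to be formed.\<close>

definition ideal_length :: "('a, 'b) ring_scheme \<Rightarrow> 'a set \<Rightarrow> 'a set \<Rightarrow> enat"
  where "ideal_length R A B = height {I. ideal I R \<and> A \<subseteq> I \<and> I \<subseteq> B}"

context cring
begin

lemma mem_set_add: "u \<in> A <+> B \<longleftrightarrow> (\<exists>a\<in>A. \<exists>b\<in>B. u = a \<oplus> b)"
  by (auto simp: set_add_def')

lemma mem_PIdl: "u \<in> PIdl a \<longleftrightarrow> (\<exists>r\<in>carrier R. u = r \<otimes> a)"
  by (auto simp: cgenideal_def)

lemma mem_add_PIdl: "u \<in> A <+> PIdl g \<longleftrightarrow> (\<exists>a\<in>A. \<exists>r\<in>carrier R. u = a \<oplus> r \<otimes> g)"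
  unfolding mem_set_add Bex_def mem_PIdl by blast

lemma ideal_subset: "ideal I R \<Longrightarrow> I \<subseteq> carrier R"
  by (meson ideal.Icarr subsetI)

lemma ideal_zero: "ideal I R \<Longrightarrow> \<zero> \<in> I"
  by (simp add: additive_subgroup.zero_closed ideal.axioms(1))

lemma ideal_add: "ideal I R \<Longrightarrow> a \<in> I \<Longrightarrow> b \<in> I \<Longrightarrow> a \<oplus> b \<in> I"
  by (simp add: additive_subgroup.a_closed ideal.axioms(1))

lemma ideal_mult: "ideal I R \<Longrightarrow> a \<in> I \<Longrightarrow> r \<in> carrier R \<Longrightarrow> r \<otimes> a \<in> I"
  by (rule ideal.I_l_closed)

lemma ideal_minus: "ideal I R \<Longrightarrow> a \<in> I \<Longrightarrow> b \<in> I \<Longrightarrow> a \<ominus> b \<in> I"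
  unfolding minus_eq by (simp add: additive_subgroup.a_closed additive_subgroup.a_inv_closed ideal.axioms(1))

lemma ideal_cancel_l:
  assumes "ideal I R" "a \<in> I" "b \<in> carrier R" "a \<oplus> b \<in> I" shows "b \<in> I"
proof -
  have "(a \<oplus> b) \<ominus> a = b" using assms ideal.Icarr[OF assms(1)] by (simp add: minus_eq a_comm[of a b] a_assoc r_neg)
  then show ?thesis using ideal_minus[OF assms(1,4,2)] by simp
qed

lemma idealI':
  assumes "I \<subseteq> carrier R" "\<zero> \<in> I" "\<And>a b. a \<in> I \<Longrightarrow> b \<in> I \<Longrightarrow> a \<oplus> b \<in> I"
    "\<And>a r. a \<in> I \<Longrightarrow> r \<in> carrier R \<Longrightarrow> r \<otimes> a \<in> I"
  shows "ideal I R"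
proof (rule idealI[OF ring_axioms])
  show "subgroup I (add_monoid R)"
  proof (rule add.subgroupI)
    fix a assume a: "a \<in> I"
    have "\<ominus> \<one> \<otimes> a = \<ominus> a" using a assms(1) by (auto simp: l_minus)
    then show "\<ominus> a \<in> I" using assms(4)[OF a, of "\<ominus> \<one>"] by simp
  qed (use assms in auto)
qed (use assms m_comm in \<open>auto simp: subset_eq\<close>)

lemma set_add_le: "ideal I R \<Longrightarrow> A \<subseteq> I \<Longrightarrow> B \<subseteq> I \<Longrightarrow> A <+> B \<subseteq> I"
  by (auto simp: mem_set_add intro!: ideal_add)

lemma set_add_ge1: "ideal B R \<Longrightarrow> A \<subseteq> carrier R \<Longrightarrow> A \<subseteq> A <+> B"
proof
  fix a assume "ideal B R" "A \<subseteq> carrier R" "a \<in> A"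
  then show "a \<in> A <+> B" unfolding mem_set_add using ideal_zero by (intro bexI[of _ a] bexI[of _ \<zero>]) auto
qed

lemma set_add_ge2: "ideal A R \<Longrightarrow> B \<subseteq> carrier R \<Longrightarrow> B \<subseteq> A <+> B"
proof
  fix a assume "ideal A R" "B \<subseteq> carrier R" "a \<in> B"
  then show "a \<in> A <+> B" unfolding mem_set_add using ideal_zero by (intro bexI[of _ a] bexI[of _ \<zero>]) auto
qed

lemma PIdl_le: "ideal I R \<Longrightarrow> a \<in> I \<Longrightarrow> PIdl a \<subseteq> I"
  by (rule cgenideal_minimal)

lemma mem_adjoin: "ideal A R \<Longrightarrow> g \<in> carrier R \<Longrightarrow> g \<in> A <+> PIdl g"
  by (meson cgenideal_ideal cgenideal_self ideal_subset set_add_ge2 subsetD)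

lemma ideal_adjoin: "ideal A R \<Longrightarrow> g \<in> carrier R \<Longrightarrow> ideal (A <+> PIdl g) R"
  by (simp add: add_ideals cgenideal_ideal)

lemma ideal_colon:
  assumes "ideal I R" "g \<in> carrier R" shows "ideal {r \<in> carrier R. r \<otimes> g \<in> I} R"
proof (rule idealI')
  fix a r assume a: "a \<in> {r \<in> carrier R. r \<otimes> g \<in> I}" "r \<in> carrier R"
  then have "r \<otimes> (a \<otimes> g) \<in> I" using ideal_mult assms by auto
  then show "r \<otimes> a \<in> {r \<in> carrier R. r \<otimes> g \<in> I}" using a assms by (auto simp: m_assoc)
qed (use assms ideal_zero in \<open>auto simp: l_distr intro: ideal_add\<close>)

lemma ideal_scale:
  assumes "ideal I R" "g \<in> carrier R" shows "ideal ((\<otimes>) g ` I) R"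
proof (rule idealI')
  have c: "a \<in> I \<Longrightarrow> a \<in> carrier R" for a using ideal_subset[OF assms(1)] by blast
  show "(\<otimes>) g ` I \<subseteq> carrier R" using c assms by auto
  show "\<zero> \<in> (\<otimes>) g ` I" using ideal_zero[OF assms(1)] assms(2) by (force intro: image_eqI[of _ _ \<zero>])
  fix a assume a: "a \<in> (\<otimes>) g ` I"
  { fix b assume b: "b \<in> (\<otimes>) g ` I"
    obtain u v where "u \<in> I" "v \<in> I" "a = g \<otimes> u" "b = g \<otimes> v" using a b by blast
    then show "a \<oplus> b \<in> (\<otimes>) g ` I" using c assms by (intro image_eqI[of _ _ "u \<oplus> v"]) (auto simp: r_distr intro: ideal_add) }
  { fix r assume r: "r \<in> carrier R"
    obtain u where "u \<in> I" "a = g \<otimes> u" using a by blast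
    then show "r \<otimes> a \<in> (\<otimes>) g ` I" using r c assms by (intro image_eqI[of _ _ "r \<otimes> u"]) (auto simp: m_lcomm intro: ideal_mult) }
qed

lemma scale_le: "ideal I R \<Longrightarrow> g \<in> carrier R \<Longrightarrow> (\<otimes>) g ` I \<subseteq> I"
  by (auto intro: ideal_mult)

lemma PIdl_scale: "g \<in> carrier R \<Longrightarrow> PIdl g = (\<otimes>) g ` carrier R"
  by (auto simp: mem_PIdl m_comm)

section \<open>Additivity and comparison of lengths\<close>

lemma ideal_length_refl: assumes "ideal A R" shows "ideal_length R A A = 0"
proof -
  have "{I. ideal I R \<and> A \<subseteq> I \<and> I \<subseteq> A} = {A}" using assms by auto
  moreover have "n = 0 \<and> V = A" if "chain_to {A} V n" for V n
    using that by induction auto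
  ultimately have "ideal_length R A A \<le> 0"
    unfolding ideal_length_def height_le_iff by (auto simp: zero_enat_def)
  then show ?thesis by simp
qed

lemma ideal_length_ge_1:
  assumes "ideal A R" "ideal B R" "A \<subset> B" shows "1 \<le> ideal_length R A B"
proof -
  have "chain_to {I. ideal I R \<and> A \<subseteq> I \<and> I \<subseteq> B} B (Suc 0)"
    using assms by (intro chain_to.step[OF chain_to.base[of A]]) auto
  from chain_le_height[OF this] show ?thesis unfolding ideal_length_def by (simp add: one_enat_def)
qed

text \<open>A chain from \<open>A\<close> to \<open>C\<close> is cut down to \<open>B\<close> and
  enlarged by \<open>B\<close>; by the modular law one of the two images grows at each step.
  Conversely, a chain up to \<open>B\<close> is continued by one starting at
  \<open>B\<close>.\<close>

lemma ideal_length_add: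
  assumes A: "ideal A R" and B: "ideal B R" and C: "ideal C R" and AB: "A \<subseteq> B" and BC: "B \<subseteq> C"
  shows "ideal_length R A C = ideal_length R A B + ideal_length R B C"
proof (rule antisym)
  show "ideal_length R A C \<le> ideal_length R A B + ideal_length R B C"
    unfolding ideal_length_def
  proof (rule height_le_add[where f = "\<lambda>I. I \<inter> B" and g = "\<lambda>I. I <+> B"])
    fix I J assume IJ: "I \<in> {I. ideal I R \<and> A \<subseteq> I \<and> I \<subseteq> C}" "J \<in> {I. ideal I R \<and> A \<subseteq> I \<and> I \<subseteq> C}" "I \<subset> J"
    have "J \<subseteq> I" if e: "I \<inter> B = J \<inter> B" "I <+> B = J <+> B"
    proof
      fix u assume u: "u \<in> J"
      then have "u \<in> I <+> B" using e set_add_ge1[OF B ideal_subset[of J]] IJ by auto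
      then obtain i b where ib: "i \<in> I" "b \<in> B" "u = i \<oplus> b" unfolding mem_set_add by blast
      have "b \<in> J" using ideal_cancel_l[of J i b] IJ ib u ideal_subset[OF B] by auto
      then have "b \<in> I" using e ib by blast
      then show "u \<in> I" using ideal_add[of I] IJ ib by auto
    qed
    moreover have "I <+> B \<subseteq> J <+> B" using IJ(3) unfolding set_add_def' by blast
    ultimately show "I \<inter> B \<subseteq> J \<inter> B \<and> I <+> B \<subseteq> J <+> B \<and> (I \<inter> B \<noteq> J \<inter> B \<or> I <+> B \<noteq> J <+> B)"
      using IJ(3) by blast
  next
    fix I assume I: "I \<in> {I. ideal I R \<and> A \<subseteq> I \<and> I \<subseteq> C}"
    then show "I \<inter> B \<in> {I. ideal I R \<and> A \<subseteq> I \<and> I \<subseteq> B}" using B AB i_intersect by auto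
    show "I <+> B \<in> {I. ideal I R \<and> B \<subseteq> I \<and> I \<subseteq> C}"
      using I B BC add_ideals set_add_le[OF C] set_add_ge2[OF _ ideal_subset[OF B]] by auto
  qed
  show "ideal_length R A B + ideal_length R B C \<le> ideal_length R A C"
    unfolding ideal_length_def
    by (rule height_add_le) (use assms in auto)
qed

lemma ideal_length_eq_0:
  assumes "ideal A R" "ideal B R" "A \<subseteq> B" "ideal_length R A B = 0" shows "A = B"
  using ideal_length_ge_1[OF assms(1,2)] assms by auto

lemma ideal_length_antimono:
  assumes "A \<subseteq> A'" shows "ideal_length R A' B \<le> ideal_length R A B"
  unfolding ideal_length_def by (rule height_mono_map[where f = id]) (use assms in auto)

text \<open>Multiplication by \<open>x\<close> identifies B/A with xB/xA. Its inverse on ideals is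
  the colon by \<open>x\<close>, which is strict because every element of an ideal below xB is a
  multiple of \<open>x\<close>.\<close>

lemma ideal_length_scale:
  assumes x: "x \<in> nonzero_divisors R" and A: "ideal A R" and B: "ideal B R"
  shows "ideal_length R ((\<otimes>) x ` A) ((\<otimes>) x ` B) = ideal_length R A B"
proof (rule antisym)
  have xc: "x \<in> carrier R" using x nzdD by auto
  show "ideal_length R A B \<le> ideal_length R ((\<otimes>) x ` A) ((\<otimes>) x ` B)"
    unfolding ideal_length_def
  proof (rule height_mono_map[where f = "\<lambda>I. (\<otimes>) x ` I"])
    fix I J assume IJ: "I \<in> {I. ideal I R \<and> A \<subseteq> I \<and> I \<subseteq> B}" "J \<in> {I. ideal I R \<and> A \<subseteq> I \<and> I \<subseteq> B}" "I \<subset> J"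
    then obtain u where u: "u \<in> J" "u \<notin> I" by blast
    have "x \<otimes> u \<notin> (\<otimes>) x ` I"
    proof
      assume "x \<otimes> u \<in> (\<otimes>) x ` I"
      then obtain v where "v \<in> I" "x \<otimes> u = x \<otimes> v" by auto
      then show False using u nzd_cancel[OF x, of u v] IJ ideal_subset[of I] ideal_subset[of J] by auto
    qed
    then show "(\<otimes>) x ` I \<subset> (\<otimes>) x ` J" using u IJ by blast
  qed (use ideal_scale xc in auto)
  show "ideal_length R ((\<otimes>) x ` A) ((\<otimes>) x ` B) \<le> ideal_length R A B"
    unfolding ideal_length_def
  proof (rule height_mono_map[where f = "\<lambda>I. {r \<in> carrier R. r \<otimes> x \<in> I}"])
    fix I J assume IJ: "I \<in> {I. ideal I R \<and> (\<otimes>) x ` A \<subseteq> I \<and> I \<subseteq> (\<otimes>) x ` B}"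
      "J \<in> {I. ideal I R \<and> (\<otimes>) x ` A \<subseteq> I \<and> I \<subseteq> (\<otimes>) x ` B}" "I \<subset> J"
    then obtain u where u: "u \<in> J" "u \<notin> I" by blast
    then have "u \<in> (\<otimes>) x ` B" using IJ by blast
    then obtain b where b: "b \<in> B" "u = x \<otimes> b" by blast
    then have "b \<in> carrier R" using ideal_subset[OF B] by auto
    then have "b \<in> {r \<in> carrier R. r \<otimes> x \<in> J}" "b \<notin> {r \<in> carrier R. r \<otimes> x \<in> I}"
      using u b m_comm[of b x] xc by auto
    then show "{r \<in> carrier R. r \<otimes> x \<in> I} \<subset> {r \<in> carrier R. r \<otimes> x \<in> J}"
      using IJ(3) by blast
  next
    fix I assume I: "I \<in> {I. ideal I R \<and> (\<otimes>) x ` A \<subseteq> I \<and> I \<subseteq> (\<otimes>) x ` B}"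
    have 1: "A \<subseteq> {r \<in> carrier R. r \<otimes> x \<in> I}"
    proof
      fix a assume a: "a \<in> A"
      then have ac: "a \<in> carrier R" using ideal_subset[OF A] by auto
      have "x \<otimes> a \<in> I" using I a by auto
      then show "a \<in> {r \<in> carrier R. r \<otimes> x \<in> I}" using m_comm[OF ac xc] ac by simp
    qed
    have 2: "{r \<in> carrier R. r \<otimes> x \<in> I} \<subseteq> B"
    proof safe
      fix r assume r: "r \<in> carrier R" "r \<otimes> x \<in> I"
      then obtain b where b: "b \<in> B" "r \<otimes> x = x \<otimes> b" using I by auto
      then have "b \<in> carrier R" using ideal_subset[OF B] by auto
      then have "r = b" using nzd_cancel[OF x, of r b] b r m_comm[OF r(1) xc] by simp
      then show "r \<in> B" using b by simp
    qed
    show "{r \<in> carrier R. r \<otimes> x \<in> I} \<in> {I. ideal I R \<and> A \<subseteq> I \<and> I \<subseteq> B}"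
      using ideal_colon[OF _ xc] 1 2 I by auto
  qed
qed

text \<open>The module (A + gR)/A is cyclic with annihilator A : g, which contains \<open>B\<close>.
  The colon by \<open>g\<close> is strict on the ideals below A + gR, since modulo \<open>A\<close>
  their elements are multiples of \<open>g\<close>.\<close>

lemma ideal_length_adjoin_le:
  assumes A: "ideal A R" and g: "g \<in> carrier R" and gB: "\<And>b. b \<in> B \<Longrightarrow> b \<in> carrier R \<and> b \<otimes> g \<in> A"
  shows "ideal_length R A (A <+> PIdl g) \<le> ideal_length R B (carrier R)"
  unfolding ideal_length_def
proof (rule height_mono_map[where f = "\<lambda>I. {r \<in> carrier R. r \<otimes> g \<in> I}"])
  fix I J assume IJ: "I \<in> {I. ideal I R \<and> A \<subseteq> I \<and> I \<subseteq> A <+> PIdl g}"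
    "J \<in> {I. ideal I R \<and> A \<subseteq> I \<and> I \<subseteq> A <+> PIdl g}" "I \<subset> J"
  then obtain u where u: "u \<in> J" "u \<notin> I" by blast
  then have "u \<in> A <+> PIdl g" using IJ by blast
  then obtain a r where ar: "a \<in> A" "r \<in> carrier R" "u = a \<oplus> r \<otimes> g" unfolding mem_add_PIdl by blast
  have "r \<otimes> g \<in> J" using ideal_cancel_l[of J a "r \<otimes> g"] IJ u ar g by auto
  moreover have "r \<otimes> g \<notin> I" using ideal_add[of I a] IJ u ar by auto
  ultimately show "{r \<in> carrier R. r \<otimes> g \<in> I} \<subset> {r \<in> carrier R. r \<otimes> g \<in> J}" using IJ ar by auto
qed (use ideal_colon[OF _ g] gB in auto)

lemma coset_eq_imp:
  assumes I: "ideal I R" and K: "ideal K R" "I \<subseteq> K" and "u \<in> carrier R" "v \<in> K" "I +> u = I +> v"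
  shows "u \<in> K"
proof -
  interpret I: ideal I R by fact
  have "u \<in> I +> v" using I.a_rcos_self[OF assms(4)] assms by simp
  then obtain i where "i \<in> I" "u = i \<oplus> v" unfolding a_r_coset_def' by blast
  then show ?thesis using ideal_add[OF K(1)] K assms by auto
qed

text \<open>Taking preimages and taking images under the projection are both strictly monotone, and
  each gives one inequality between the heights.\<close>

lemma module_length_quot:
  assumes I: "ideal I R"
  shows "module_length R (quot_module R I) = ideal_length R I (carrier R)"
proof -
  let ?M = "quot_module R I"
  interpret I: ideal I R by fact
  interpret Q: cring "R Quot I" by (rule I.quotient_is_cring) (rule is_cring)
  interpret M: module R ?M by (rule module_quot_module[OF I])
  have Mc: "carrier ?M = {I +> r | r. r \<in> carrier R}"
    by (auto simp: quot_module_def ring.defs FactRing_def A_RCOSETS_def')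
  have hom: "(+>) I \<in> ring_hom R (R Quot I)" by (rule I.rcos_ring_hom)
  have add: "(I +> a) \<oplus>\<^bsub>?M\<^esub> (I +> b) = I +> (a \<oplus> b)" if "a \<in> carrier R" "b \<in> carrier R" for a b
    using ring_hom_add[OF hom that] by (simp add: quot_module_def ring.defs)
  have smult: "a \<odot>\<^bsub>?M\<^esub> (I +> b) = I +> (a \<otimes> b)" if "a \<in> carrier R" "b \<in> carrier R" for a b
    using ring_hom_mult[OF hom that] by (simp add: quot_module_def ring.defs)
  have zero: "\<zero>\<^bsub>?M\<^esub> = I +> \<zero>"
    using ring_hom_zero[OF hom ring_axioms Q.ring_axioms] by (simp add: quot_module_def ring.defs)
  have ideal: "ideal {r \<in> carrier R. I +> r \<in> N} R" "I \<subseteq> {r \<in> carrier R. I +> r \<in> N}"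
    if N: "Module.submodule N R ?M" for N
  proof -
    note n = M.submoduleE[OF N]
    have z: "I +> \<zero> \<in> N" using submodule.axioms(1)[OF N] subgroup.one_closed zero by fastforce
    show "ideal {r \<in> carrier R. I +> r \<in> N} R"
    proof (rule idealI')
      fix a b assume "a \<in> {r \<in> carrier R. I +> r \<in> N}" "b \<in> {r \<in> carrier R. I +> r \<in> N}"
      then show "a \<oplus> b \<in> {r \<in> carrier R. I +> r \<in> N}" using n(5)[of "I +> a" "I +> b"] add by auto
    next
      fix a b assume "a \<in> {r \<in> carrier R. I +> r \<in> N}" "b \<in> carrier R"
      then show "b \<otimes> a \<in> {r \<in> carrier R. I +> r \<in> N}" using n(4)[of b "I +> a"] smult by auto
    qed (use z in auto)
    have "I +> i = I +> \<zero>" if "i \<in> I" for i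
      using I.a_rcos_const[OF that] I.a_rcos_const[OF I.zero_closed] by simp
    then show "I \<subseteq> {r \<in> carrier R. I +> r \<in> N}" using z I.Icarr by (metis (mono_tags, lifting) mem_Collect_eq subsetI)
  qed
  have "height {N. Module.submodule N R ?M} \<le> height {K. ideal K R \<and> I \<subseteq> K \<and> K \<subseteq> carrier R}"
  proof (rule height_mono_map[where f = "\<lambda>N. {r \<in> carrier R. I +> r \<in> N}"])
    fix N N' assume N: "N \<in> {N. Module.submodule N R ?M}" "N' \<in> {N. Module.submodule N R ?M}" "N \<subset> N'"
    then obtain u where u: "u \<in> N'" "u \<notin> N" by blast
    then obtain r where "r \<in> carrier R" "u = I +> r" using M.submoduleE(1)[of N'] N Mc by auto
    then show "{r \<in> carrier R. I +> r \<in> N} \<subset> {r \<in> carrier R. I +> r \<in> N'}" using u N by auto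
  qed (use ideal in auto)
  moreover have "height {K. ideal K R \<and> I \<subseteq> K \<and> K \<subseteq> carrier R} \<le> height {N. Module.submodule N R ?M}"
  proof (rule height_mono_map[where f = "(`) ((+>) I)"])
    fix K K' assume K: "K \<in> {K. ideal K R \<and> I \<subseteq> K \<and> K \<subseteq> carrier R}" "K' \<in> {K. ideal K R \<and> I \<subseteq> K \<and> K \<subseteq> carrier R}" "K \<subset> K'"
    then obtain u where u: "u \<in> K'" "u \<notin> K" by blast
    then have "I +> u \<notin> (+>) I ` K" using coset_eq_imp[OF I, of K u] K by blast
    then show "(+>) I ` K \<subset> (+>) I ` K'" using u K by blast
  next
    fix K assume K: "K \<in> {K. ideal K R \<and> I \<subseteq> K \<and> K \<subseteq> carrier R}"
    have inv: "\<ominus>\<^bsub>?M\<^esub> (I +> a) = I +> (\<ominus> a)" if "a \<in> carrier R" for a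
    proof (rule M.minus_equality)
      show "(I +> \<ominus> a) \<oplus>\<^bsub>?M\<^esub> (I +> a) = \<zero>\<^bsub>?M\<^esub>" using that by (simp add: add l_neg zero)
    qed (use that Mc in auto)
    have "Module.submodule ((+>) I ` K) R ?M"
    proof (rule M.submoduleI)
      show "(+>) I ` K \<subseteq> carrier ?M" using K Mc by auto
      show "\<zero>\<^bsub>?M\<^esub> \<in> (+>) I ` K" using zero ideal_zero[of K] K by auto
      fix a assume a: "a \<in> (+>) I ` K"
      then obtain k where k: "k \<in> K" "a = I +> k" by blast
      then have kc: "k \<in> carrier R" using K by auto
      have "\<ominus> k \<in> K" using ideal_minus[of K \<zero> k] K k ideal_zero[of K] kc by (auto simp: minus_eq)
      then show "\<ominus>\<^bsub>?M\<^esub> a \<in> (+>) I ` K" using inv kc k by auto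
      { fix b assume b: "b \<in> (+>) I ` K"
        then obtain l where l: "l \<in> K" "b = I +> l" by blast
        then have lc: "l \<in> carrier R" using K by auto
        show "a \<oplus>\<^bsub>?M\<^esub> b \<in> (+>) I ` K" using add[OF kc lc] k l ideal_add[of K k l] K by auto }
      { fix r assume r: "r \<in> carrier R"
        then show "r \<odot>\<^bsub>?M\<^esub> a \<in> (+>) I ` K" using smult[OF r kc] k ideal_mult[of K k r] K by auto }
    qed
    then show "(+>) I ` K \<in> {N. Module.submodule N R ?M}" by simp
  qed
  ultimately have "height {N. Module.submodule N R ?M} = height {K. ideal K R \<and> I \<subseteq> K \<and> K \<subseteq> carrier R}"
    by (rule antisym)
  then show ?thesis by (simp add: module_length_def ideal_length_def height_def)
qed

end

section \<open>Products and generators of ideals\<close>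

lemma (in cring) set_add_mono: "A \<subseteq> A' \<Longrightarrow> B \<subseteq> B' \<Longrightarrow> A <+> B \<subseteq> A' <+> B'"
  unfolding set_add_def' by (intro UN_mono) auto

lemma (in cring) ideal_prod_le:
  assumes "ideal K R" "\<And>a b. a \<in> I \<Longrightarrow> b \<in> J \<Longrightarrow> a \<otimes> b \<in> K" shows "I \<cdot> J \<subseteq> K"
proof
  fix u assume "u \<in> I \<cdot> J"
  then show "u \<in> K" by induction (use assms ideal_add in auto)
qed

lemma (in cring) ideal_prod_PIdl:
  assumes "a \<in> carrier R" "ideal I R" shows "(PIdl a) \<cdot> I = (\<otimes>) a ` I"
proof (rule antisym)
  show "(PIdl a) \<cdot> I \<subseteq> (\<otimes>) a ` I"
  proof (rule ideal_prod_le[OF ideal_scale[OF assms(2,1)]])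
    fix u v assume u: "u \<in> PIdl a" and v: "v \<in> I"
    then obtain r where r: "r \<in> carrier R" "u = r \<otimes> a" unfolding mem_PIdl by blast
    have "v \<in> carrier R" using v ideal_subset[OF assms(2)] by blast
    then have "u \<otimes> v = a \<otimes> (r \<otimes> v)" using r assms(1) by (simp add: m_ac)
    then show "u \<otimes> v \<in> (\<otimes>) a ` I" using ideal_mult[OF assms(2) v r(1)] by blast
  qed
  show "(\<otimes>) a ` I \<subseteq> (PIdl a) \<cdot> I"
    using ideal_prod.prod[of a "PIdl a" _ I R] cgenideal_self[OF assms(1)] by auto
qed

lemma (in cring) ideal_prod_scale:
  assumes "a \<in> carrier R" "ideal I R" "ideal J R"
  shows "((\<otimes>) a ` I) \<cdot> J = (\<otimes>) a ` (I \<cdot> J)"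
  using ideal_prod_assoc[of "PIdl a" I J] assms cgenideal_ideal ideal_prod_is_ideal
  by (simp flip: ideal_prod_PIdl)

lemma (in cring) Idl_insert:
  assumes "S \<subseteq> carrier R" "g \<in> carrier R"
  shows "Idl (insert g S) = Idl S <+> PIdl g"
proof (rule antisym)
  have I: "ideal (Idl S) R" by (rule genideal_ideal[OF assms(1)])
  show "Idl (insert g S) \<subseteq> Idl S <+> PIdl g"
    using genideal_minimal[OF ideal_adjoin[OF I assms(2)]] mem_adjoin[OF I assms(2)]
      set_add_ge1[OF cgenideal_ideal[OF assms(2)] ideal_subset[OF I]] genideal_self[OF assms(1)] by blast
  have J: "ideal (Idl (insert g S)) R" using assms by (intro genideal_ideal) auto
  have "insert g S \<subseteq> Idl (insert g S)" using assms by (intro genideal_self) auto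
  then show "Idl S <+> PIdl g \<subseteq> Idl (insert g S)"
    using set_add_le[OF J genideal_minimal[OF J] PIdl_le[OF J]] by blast
qed

lemma (in cring) Idl_ideal: "ideal A R \<Longrightarrow> Idl A = A"
  using genideal_minimal[of A A] genideal_self[OF ideal_subset, of A] by blast

text \<open>The generators are adjoined one at a time; each adds a cyclic module killed by
  \<open>B\<close>.\<close>

lemma (in cring) ideal_length_finite_gen:
  assumes "finite F" "F \<subseteq> carrier R" "ideal A R"
    and "\<And>b g. b \<in> B \<Longrightarrow> g \<in> F \<Longrightarrow> b \<in> carrier R \<and> b \<otimes> g \<in> A"
  shows "ideal_length R A (Idl (A \<union> F)) \<le> enat (card F) * ideal_length R B (carrier R)"
  using assms
proof (induction F)
  case empty
  then show ?case by (simp add: Idl_ideal ideal_length_refl)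
next
  case (insert g F)
  let ?C = "Idl (A \<union> F)" and ?l = "ideal_length R B (carrier R)"
  have Ac: "A \<subseteq> carrier R" using ideal_subset insert by blast
  have C: "ideal ?C R" using Ac insert by (intro genideal_ideal) auto
  have AC: "A \<subseteq> ?C" using genideal_self[of "A \<union> F"] Ac insert by auto
  have eq: "Idl (A \<union> insert g F) = ?C <+> PIdl g" using Idl_insert[of "A \<union> F" g] insert Ac by auto
  have "ideal_length R A (?C <+> PIdl g) = ideal_length R A ?C + ideal_length R ?C (?C <+> PIdl g)"
    using ideal_length_add[OF _ C ideal_adjoin[OF C]] insert AC set_add_ge1[OF cgenideal_ideal ideal_subset[OF C]] by auto
  also have "\<dots> \<le> enat (card F) * ?l + ?l"
    using insert ideal_length_adjoin_le[OF C, of g B] AC by (intro add_mono) auto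
  also have "\<dots> = enat (card (insert g F)) * ?l"
    using insert(1,2) by (simp add: distrib_right add.commute flip: eSuc_enat plus_1_eSuc)
  finally show ?case unfolding eq .
qed

text \<open>Each generator chosen outside the ideal reached so far uses up at least one unit of
  length, so \<open>l\<close> of them suffice.\<close>

lemma (in cring) ideal_length_obtain_gen:
  assumes "ideal A R" "ideal C R" "A \<subseteq> C" "ideal_length R A C \<le> enat l"
  shows "\<exists>F. finite F \<and> F \<subseteq> C \<and> card F \<le> l \<and> Idl (A \<union> F) = C"
  using assms
proof (induction l arbitrary: A)
  case 0
  then have "A = C" by (intro ideal_length_eq_0) (auto simp flip: zero_enat_def)
  then show ?case using Idl_ideal 0 by (intro exI[of _ "{}"]) auto
next
  case (Suc l)
  show ?case
  proof (cases "A = C")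
    case True then show ?thesis using Idl_ideal Suc by (intro exI[of _ "{}"]) auto
  next
    case False
    then obtain g where g: "g \<in> C" "g \<notin> A" using Suc by blast
    have gc: "g \<in> carrier R" using g ideal_subset[OF Suc.prems(2)] by blast
    let ?B = "A <+> PIdl g"
    have B: "ideal ?B R" by (rule ideal_adjoin[OF Suc.prems(1) gc])
    have BC: "?B \<subseteq> C" using set_add_le[OF Suc.prems(2,3)] PIdl_le[OF Suc.prems(2) g(1)] by blast
    have AB: "A \<subset> ?B" using set_add_ge1[OF cgenideal_ideal[OF gc] ideal_subset[OF Suc.prems(1)]]
        mem_adjoin[OF Suc.prems(1) gc] g by blast
    have "1 + ideal_length R ?B C \<le> ideal_length R A ?B + ideal_length R ?B C"
      using ideal_length_ge_1[OF Suc.prems(1) B AB] by (rule add_right_mono)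
    also have "\<dots> \<le> enat (Suc l)" using Suc.prems AB ideal_length_add[OF Suc.prems(1) B Suc.prems(2) _ BC] by auto
    finally have "ideal_length R ?B C \<le> enat l"
      by (cases "ideal_length R ?B C") (auto simp: one_enat_def)
    from Suc.IH[OF B Suc.prems(2) BC this] obtain F
      where F: "finite F" "F \<subseteq> C" "card F \<le> l" "Idl (?B \<union> F) = C" by blast
    have c: "A \<union> insert g F \<subseteq> carrier R" using ideal_subset[OF Suc.prems(2)] Suc.prems(3) F gc by auto
    have I: "ideal (Idl (A \<union> insert g F)) R" by (rule genideal_ideal[OF c])
    have s: "A \<union> insert g F \<subseteq> Idl (A \<union> insert g F)" by (rule genideal_self[OF c])
    have "?B \<subseteq> Idl (A \<union> insert g F)" using s by (intro set_add_le[OF I] PIdl_le[OF I]) auto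
    then have "C \<subseteq> Idl (A \<union> insert g F)" using genideal_minimal[OF I, of "?B \<union> F"] s F(4) by auto
    moreover have "Idl (A \<union> insert g F) \<subseteq> C" using genideal_minimal[OF Suc.prems(2)] F g Suc.prems(3) by auto
    ultimately show ?thesis using F g
      by (intro exI[of _ "insert g F"]) (auto simp: card_insert_if)
  qed
qed

section \<open>Noetherian local rings\<close>

lemma (in noetherian_ring) exists_maximal_ideal_in:
  assumes "S \<noteq> {}" "\<And>I. I \<in> S \<Longrightarrow> ideal I R"
  obtains M where "M \<in> S" "\<And>I. I \<in> S \<Longrightarrow> M \<subseteq> I \<Longrightarrow> I = M"
proof -
  have "\<exists>M\<in>S. \<forall>I\<in>S. M \<subseteq> I \<longrightarrow> I = M"
  proof (rule subset_Zorn_nonempty[OF assms(1)])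
    fix C assume C: "C \<noteq> {}" "subset.chain S C"
    then have "subset.chain {I. ideal I R} C" using assms(2) by (auto simp: subset.chain_def)
    from ideal_chain_is_trivial[OF C(1) this] show "\<Union> C \<in> S" using C by (auto simp: subset.chain_def)
  qed
  then show ?thesis using that by blast
qed

lemma (in noetherian_ring) ideal_seq_stabilizes:
  fixes I :: "nat \<Rightarrow> 'a set"
  assumes "\<And>n. ideal (I n) R" "\<And>n. I n \<subseteq> I (Suc n)"
  obtains n where "\<And>k. I k \<subseteq> I n"
proof -
  obtain M where M: "M \<in> range I" "\<And>J. J \<in> range I \<Longrightarrow> M \<subseteq> J \<Longrightarrow> J = M"
    using exists_maximal_ideal_in[of "range I"] assms(1) by blast
  then obtain n where n: "M = I n" by blast
  have mono: "k \<le> l \<Longrightarrow> I k \<subseteq> I l" for k l using lift_Suc_mono_le[of I] assms(2) by blast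
  have "I k \<subseteq> I n" for k
    using mono[of k "max k n"] mono[of n "max k n"] M(2)[of "I (max k n)"] n by auto
  then show ?thesis by (rule that)
qed

locale noetherian_local_ring = local_ring R m + noetherian_ring R for R (structure) and m
begin

lemma m_ideal: "ideal m R"
  using maximal_ideal maximalideal.axioms(1) by blast

lemma m_carr: "a \<in> m \<Longrightarrow> a \<in> carrier R"
  using ideal_subset[OF m_ideal] by blast

lemma m_proper: "m \<noteq> carrier R"
  using maximalideal.I_notcarr[OF maximal_ideal] by blast

lemma one_notin: assumes "ideal I R" "I \<noteq> carrier R" shows "\<one> \<notin> I"
  using ideal.one_imp_carrier[OF assms(1)] assms(2) by blast

lemma one_notin_m: "\<one> \<notin> m"
  by (rule one_notin[OF m_ideal m_proper])

lemma one_neq_zero: "\<one> \<noteq> \<zero>"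
  using one_notin_m ideal_zero[OF m_ideal] by metis

lemma m_maximal: assumes "ideal I R" "m \<subseteq> I" shows "I = m \<or> I = carrier R"
  using maximalideal.I_maximal[OF maximal_ideal assms(1,2) ideal_subset[OF assms(1)]] .

lemma proper_le_m:
  assumes "ideal I R" "I \<noteq> carrier R" shows "I \<subseteq> m"
proof -
  obtain M where M: "M \<in> {M. ideal M R \<and> I \<subseteq> M \<and> M \<noteq> carrier R}"
    "\<And>J. J \<in> {M. ideal M R \<and> I \<subseteq> M \<and> M \<noteq> carrier R} \<Longrightarrow> M \<subseteq> J \<Longrightarrow> J = M"
    using exists_maximal_ideal_in[of "{M. ideal M R \<and> I \<subseteq> M \<and> M \<noteq> carrier R}"] assms by blast
  have "maximalideal M R"
  proof (rule maximalidealI)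
    show "ideal M R" "carrier R \<noteq> M" using M by auto
    fix J assume "ideal J R" "M \<subseteq> J" "J \<subseteq> carrier R"
    then show "J = M \<or> J = carrier R" using M by blast
  qed
  then show ?thesis using maximal_ideal_unique M by blast
qed

lemma unit_if_notin_m:
  assumes "a \<in> carrier R" "a \<notin> m"
  obtains b where "b \<in> carrier R" "b \<otimes> a = \<one>"
proof -
  have "PIdl a = carrier R" using proper_le_m[OF cgenideal_ideal[OF assms(1)]] cgenideal_self[OF assms(1)] assms by blast
  then have "\<one> \<in> PIdl a" by simp
  then show ?thesis using that unfolding mem_PIdl by metis
qed

text \<open>A maximal member \<open>N\<close> of the ideals that contain \<open>J\<close> and lie
  strictly below \<open>I\<close> replaces a minimal system of generators. Then I = N + gR, the
  inclusion gives g = n + g\<mu> with n in \<open>N\<close> and \<mu> in \<open>m\<close>, and 1 -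
  \<mu> is a unit, so g would lie in \<open>N\<close>.\<close>

lemma nakayama:
  assumes I: "ideal I R" and J: "ideal J R" and JI: "J \<subseteq> I" and le: "I \<subseteq> J <+> (m \<cdot> I)"
  shows "I = J"
proof (rule ccontr)
  assume "I \<noteq> J"
  then obtain N where N: "N \<in> {N. ideal N R \<and> J \<subseteq> N \<and> N \<subset> I}"
    "\<And>K. K \<in> {N. ideal N R \<and> J \<subseteq> N \<and> N \<subset> I} \<Longrightarrow> N \<subseteq> K \<Longrightarrow> K = N"
    using exists_maximal_ideal_in[of "{N. ideal N R \<and> J \<subseteq> N \<and> N \<subset> I}"] J JI by blast
  then obtain g where g: "g \<in> I" "g \<notin> N" by blast
  have gc: "g \<in> carrier R" using g ideal_subset[OF I] by blast
  have Ni: "ideal N R" using N by simp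
  have "ideal (N <+> PIdl g) R" by (rule ideal_adjoin[OF Ni gc])
  moreover have Ns: "N \<subseteq> N <+> PIdl g" by (rule set_add_ge1[OF cgenideal_ideal[OF gc] ideal_subset[OF Ni]])
  moreover have "N <+> PIdl g \<subseteq> I" using N g by (intro set_add_le[OF I] PIdl_le[OF I]) auto
  moreover have "g \<in> N <+> PIdl g" by (rule mem_adjoin[OF Ni gc])
  ultimately have eq: "N <+> PIdl g = I" using N(1) N(2)[of "N <+> PIdl g"] g by blast
  let ?K = "N <+> (\<otimes>) g ` m"
  have K: "ideal ?K R" by (intro add_ideals Ni ideal_scale m_ideal gc)
  have "m \<cdot> I \<subseteq> ?K"
  proof (rule ideal_prod_le[OF K])
    fix a b assume a: "a \<in> m" and "b \<in> I"
    then have "b \<in> N <+> PIdl g" using eq by simp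
    then obtain n r where b: "n \<in> N" "r \<in> carrier R" "b = n \<oplus> r \<otimes> g" unfolding mem_add_PIdl by blast
    have c: "n \<in> carrier R" "a \<in> carrier R" using b ideal_subset[OF Ni] a m_carr by auto
    have "a \<otimes> b = a \<otimes> n \<oplus> g \<otimes> (r \<otimes> a)" using b c gc by (simp add: r_distr m_ac)
    moreover have "r \<otimes> a \<in> m" using ideal_mult[OF m_ideal a b(2)] .
    moreover have "a \<otimes> n \<in> N" using ideal_mult[OF Ni b(1) c(2)] .
    ultimately show "a \<otimes> b \<in> ?K" unfolding mem_set_add by blast
  qed
  moreover have "J \<subseteq> ?K" using N set_add_ge1[OF ideal_scale[OF m_ideal gc] ideal_subset[OF Ni]] by blast
  ultimately have "g \<in> ?K" using le g set_add_le[OF K] by blast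
  then obtain n \<mu> where n: "n \<in> N" "\<mu> \<in> m" "g = n \<oplus> g \<otimes> \<mu>" unfolding mem_set_add by blast
  have c: "n \<in> carrier R" "\<mu> \<in> carrier R" using n ideal_subset[OF Ni] m_carr by auto
  have u: "\<one> \<ominus> \<mu> \<notin> m"
  proof
    assume "\<one> \<ominus> \<mu> \<in> m"
    then have "(\<one> \<ominus> \<mu>) \<oplus> \<mu> \<in> m" using ideal_add[OF m_ideal] n by blast
    then show False using one_notin_m c by (simp add: minus_eq a_assoc l_neg)
  qed
  then obtain b where b: "b \<in> carrier R" "b \<otimes> (\<one> \<ominus> \<mu>) = \<one>" using unit_if_notin_m[of "\<one> \<ominus> \<mu>"] c by auto
  have "(\<one> \<ominus> \<mu>) \<otimes> g = g \<ominus> g \<otimes> \<mu>" using c gc m_comm[of \<mu> g] by (simp add: minus_eq l_distr l_minus)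
  also have "\<dots> = (n \<oplus> g \<otimes> \<mu>) \<ominus> g \<otimes> \<mu>" using n by simp
  also have "\<dots> = n" using c gc by (simp add: minus_eq a_assoc r_neg)
  finally have *: "(\<one> \<ominus> \<mu>) \<otimes> g = n" .
  have "g = (b \<otimes> (\<one> \<ominus> \<mu>)) \<otimes> g" using b gc by simp
  also have "\<dots> = b \<otimes> ((\<one> \<ominus> \<mu>) \<otimes> g)" by (rule m_assoc) (use b(1) c gc in auto)
  finally have "g = b \<otimes> n" unfolding * .
  then have "g \<in> N" using ideal_mult[OF Ni n(1) b(1)] by simp
  then show False using g by simp
qed

lemma nakayama_scale:
  assumes "ideal I R" "ideal J R" "J \<subseteq> I" "a \<in> m" "I \<subseteq> J <+> ((\<otimes>) a ` I)"
  shows "I = J"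
proof (rule nakayama[OF assms(1-3)])
  have "(\<otimes>) a ` I \<subseteq> m \<cdot> I" using ideal_prod.prod[of a m _ I R] assms(4) by auto
  then show "I \<subseteq> J <+> (m \<cdot> I)" using assms(5) set_add_mono[of J J] by blast
qed

lemma ideal_length_m: "ideal_length R m (carrier R) = 1"
proof (rule antisym)
  let ?S = "{I. ideal I R \<and> m \<subseteq> I \<and> I \<subseteq> carrier R}"
  have "n = 0 \<or> (n = 1 \<and> V = carrier R)" if "chain_to ?S V n" for V n
    using that
  proof induction
    case (step V n Y)
    have "n = 0" using step ideal_subset[of Y] by blast
    moreover have "m \<subseteq> V" using chain_to_in[OF step.hyps(1)] by blast
    then have "Y = carrier R" using step m_maximal[of Y] by blast
    ultimately show ?case by simp
  qed simp
  then have "\<forall>V n. chain_to ?S V n \<longrightarrow> enat n \<le> 1" by (auto simp: one_enat_def)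
  then show "ideal_length R m (carrier R) \<le> 1" unfolding ideal_length_def height_le_iff .
  show "1 \<le> ideal_length R m (carrier R)"
    using ideal_length_ge_1[OF m_ideal oneideal] ideal_subset[OF m_ideal] m_proper by blast
qed

section \<open>Powers of the maximal ideal\<close>

abbreviation pw :: "nat \<Rightarrow> 'a set" where "pw \<equiv> ideal_pow R m"

lemma pw_ideal: "ideal (pw k) R"
  by (rule ideal_pow_ideal[OF m_ideal])

lemma pw_0: "pw 0 = carrier R"
  by (simp add: ideals_set_def)

lemma pw_Suc: "pw (Suc k) = pw k \<cdot> m"
  by (simp add: ideals_set_def)

lemma pw_1: "pw (Suc 0) = m"
  using ideal_prod_one[OF m_ideal] ideal_prod_commute[OF oneideal m_ideal] pw_Suc[of 0] pw_0 by simp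

lemma pw_2: "pw 2 = m \<cdot> m"
  using pw_Suc[of "Suc 0"] pw_1 by (simp add: numeral_2_eq_2)

lemma pw_antimono: "k \<le> l \<Longrightarrow> pw l \<subseteq> pw k"
  using lift_Suc_antimono_le[of pw] ideal_pow_Suc_subset[OF m_ideal] by blast

lemma ideal_length_mult_m_finite:
  assumes I: "ideal I R" shows "\<exists>n. ideal_length R (I \<cdot> m) I = enat n"
proof -
  obtain F where F: "F \<subseteq> carrier R" "finite F" "I = Idl F" using finetely_gen[OF I] by blast
  have FI: "F \<subseteq> I" using genideal_self[OF F(1)] F by simp
  have P: "ideal (I \<cdot> m) R" using ideal_prod_is_ideal[OF I m_ideal] .
  have PI: "I \<cdot> m \<subseteq> I" using ideal_prod_inter[OF I m_ideal] by blast
  have c: "(I \<cdot> m) \<union> F \<subseteq> carrier R" using ideal_subset[OF P] F by auto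
  have "Idl ((I \<cdot> m) \<union> F) = I"
  proof (rule antisym)
    show "Idl ((I \<cdot> m) \<union> F) \<subseteq> I" using genideal_minimal[OF I] PI FI by auto
    show "I \<subseteq> Idl ((I \<cdot> m) \<union> F)"
      using genideal_minimal[OF genideal_ideal[OF c], of F] genideal_self[OF c] F by auto
  qed
  moreover have "ideal_length R (I \<cdot> m) (Idl ((I \<cdot> m) \<union> F)) \<le> enat (card F) * ideal_length R m (carrier R)"
  proof (rule ideal_length_finite_gen[OF F(2,1) P])
    fix b g assume b: "b \<in> m" "g \<in> F"
    then have "g \<otimes> b \<in> I \<cdot> m" using FI by (auto intro: ideal_prod.prod)
    then show "b \<in> carrier R \<and> b \<otimes> g \<in> I \<cdot> m" using b F m_carr m_comm[of b g] by auto
  qed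
  ultimately have "ideal_length R (I \<cdot> m) I \<le> enat (card F)" using ideal_length_m by simp
  then show ?thesis by (cases "ideal_length R (I \<cdot> m) I") auto
qed

lemma ideal_length_pw_finite: "\<exists>n. ideal_length R (pw k) (carrier R) = enat n"
proof (induction k)
  case 0
  show ?case using ideal_length_refl[OF oneideal] pw_0 by (auto simp: zero_enat_def)
next
  case (Suc k)
  obtain a where a: "ideal_length R (pw k) (carrier R) = enat a" using Suc by blast
  obtain b where b: "ideal_length R (pw k \<cdot> m) (pw k) = enat b" using ideal_length_mult_m_finite[OF pw_ideal] by blast
  have "ideal_length R (pw (Suc k)) (carrier R) = ideal_length R (pw (Suc k)) (pw k) + ideal_length R (pw k) (carrier R)"
    using ideal_length_add[OF pw_ideal pw_ideal oneideal, of "Suc k" k]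
      ideal_pow_Suc_subset[OF m_ideal, of k] ideal_subset[OF pw_ideal] by simp
  then show ?case using a b pw_Suc by simp
qed

lemma ideal_length_finite_if_pw:
  assumes "pw k \<subseteq> I" obtains n where "ideal_length R I (carrier R) = enat n"
proof -
  obtain a where a: "ideal_length R (pw k) (carrier R) = enat a" using ideal_length_pw_finite by blast
  have "ideal_length R I (carrier R) \<le> enat a" using ideal_length_antimono[OF assms, of "carrier R"] a by simp
  then show ?thesis using that by (cases "ideal_length R I (carrier R)") auto
qed

text \<open>By Nakayama's lemma, generators of \<open>m\<close> modulo A + m^2 also generate
  \<open>m\<close> modulo \<open>A\<close>, and each of them is killed by \<open>B\<close> modulo
  \<open>A\<close>. The bound is applied with A = xR and B = c + xR.\<close>

lemma ideal_length_m_le: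
  assumes A: "ideal A R" "A \<subseteq> m" and BA: "\<And>a b. a \<in> m \<Longrightarrow> b \<in> B \<Longrightarrow> b \<in> carrier R \<and> b \<otimes> a \<in> A"
    and l: "ideal_length R (A <+> pw 2) m \<le> enat l"
  shows "ideal_length R A m \<le> enat l * ideal_length R B (carrier R)"
proof -
  have A2: "ideal (A <+> pw 2) R" by (rule add_ideals[OF A(1) pw_ideal])
  have "pw 2 \<subseteq> m" using pw_antimono[of "Suc 0" 2] pw_1 by auto
  then have A2m: "A <+> pw 2 \<subseteq> m" using set_add_le[OF m_ideal A(2)] by blast
  obtain F where F: "finite F" "F \<subseteq> m" "card F \<le> l" "Idl ((A <+> pw 2) \<union> F) = m"
    using ideal_length_obtain_gen[OF A2 m_ideal A2m l] by blast
  let ?C = "Idl (A \<union> F)"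
  have c: "A \<union> F \<subseteq> carrier R" using ideal_subset[OF A(1)] F m_carr by auto
  have C: "ideal ?C R" by (rule genideal_ideal[OF c])
  have s: "A \<union> F \<subseteq> ?C" by (rule genideal_self[OF c])
  have "m = ?C"
  proof (rule nakayama[OF m_ideal C])
    show "?C \<subseteq> m" using genideal_minimal[OF m_ideal] A F by auto
    have I: "ideal (?C <+> (m \<cdot> m)) R" using pw_2 add_ideals[OF C pw_ideal[of 2]] by simp
    have "?C \<subseteq> ?C <+> (m \<cdot> m)" using set_add_ge1[OF pw_ideal[of 2] ideal_subset[OF C]] pw_2 by simp
    moreover have "m \<cdot> m \<subseteq> ?C <+> (m \<cdot> m)" using set_add_ge2[OF C ideal_subset[OF pw_ideal[of 2]]] pw_2 by simp
    ultimately have "A \<subseteq> ?C <+> (m \<cdot> m)" "F \<subseteq> ?C <+> (m \<cdot> m)" "A <+> pw 2 \<subseteq> ?C <+> (m \<cdot> m)"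
      using set_add_le[OF I, of A "pw 2"] s unfolding pw_2 by blast+
    then have "(A <+> pw 2) \<union> F \<subseteq> ?C <+> (m \<cdot> m)" by blast
    from genideal_minimal[OF I this] show "m \<subseteq> ?C <+> (m \<cdot> m)" using F by simp
  qed
  then have "ideal_length R A m \<le> enat (card F) * ideal_length R B (carrier R)"
    using ideal_length_finite_gen[OF F(1) _ A(1), of B] BA subsetD[OF F(2)] m_carr by (metis subsetI)
  also have "\<dots> \<le> enat l * ideal_length R B (carrier R)" using F by (intro mult_right_mono) auto
  finally show ?thesis .
qed

end

section \<open>The cotangent space and the embedding dimension\<close>

context noetherian_local_ring
begin

text \<open>\<open>rcoset_mult\<close> is a union over all representatives. Changing
  \<open>a\<close> by an element of \<open>m\<close>, or \<open>y\<close> by one of m^2, changes the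
  product by an element of m^2, so they all yield the same coset.\<close>

lemma cotangent_smult:
  assumes a: "a \<in> carrier R" and y: "y \<in> m"
  shows "(m +> a) \<odot>\<^bsub>cotangent_space R m\<^esub> (pw 2 +> y) = pw 2 +> (a \<otimes> y)"
proof -
  interpret m: ideal m R by (rule m_ideal)
  interpret J: ideal "pw 2" R by (rule pw_ideal)
  have yc: "y \<in> carrier R" using y m_carr by blast
  have "pw 2 +> (a' \<otimes> y') = pw 2 +> (a \<otimes> y)" if ay: "a' \<in> m +> a" "y' \<in> pw 2 +> y" for a' y'
  proof -
    obtain p q where p: "p \<in> m" "a' = p \<oplus> a" and q: "q \<in> pw 2" "y' = q \<oplus> y"
      using ay unfolding a_r_coset_def' by blast
    have pq: "p \<in> carrier R" "q \<in> carrier R" using p q m_carr J.Icarr by auto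
    have "p \<otimes> y \<in> pw 2" unfolding pw_2 using p y by (auto intro: ideal_prod.prod)
    moreover have "a' \<otimes> q \<in> pw 2" using q p pq a by (auto intro: J.I_l_closed)
    ultimately have j: "a' \<otimes> q \<oplus> p \<otimes> y \<in> pw 2" by (intro ideal_add[OF pw_ideal])
    have "a' \<otimes> y' = (a' \<otimes> q \<oplus> p \<otimes> y) \<oplus> a \<otimes> y"
      using p q pq yc a by (simp add: l_distr r_distr a_assoc)
    then have "a' \<otimes> y' \<in> pw 2 +> (a \<otimes> y)" unfolding a_r_coset_def' using j by blast
    then show ?thesis using J.a_repr_independence' yc a m_closed by metis
  qed
  then have "rcoset_mult R (pw 2) (m +> a) (pw 2 +> y) = (\<Union>a'\<in>m +> a. \<Union>y'\<in>pw 2 +> y. pw 2 +> (a \<otimes> y))"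
    unfolding rcoset_mult_def by (intro SUP_cong refl)
  also have "\<dots> = pw 2 +> (a \<otimes> y)"
    using m.a_rcos_self[OF a] J.a_rcos_self[OF yc] by (metis SUP_const empty_iff)
  finally show ?thesis by (simp add: cotangent_space_def)
qed

text \<open>The dimension of a vector space is defined as the least size of a generating set, so it
  suffices to compare generating sets of \<open>m/m\<^sup>2\<close> with those of \<open>m\<close> modulo \<open>m\<^sup>2\<close>.\<close>
lemma ideal_length_pw_2: "ideal_length R (pw 2) m = enat (embedding_dim R m)"
proof -
  let ?V = "cotangent_space R m" and ?c = "(+>) (pw 2)"
  interpret V: vectorspace "R Quot m" ?V by (rule vectorspace_cotangent_space)
  interpret m: ideal m R by (rule m_ideal)
  interpret J: ideal "pw 2" R by (rule pw_ideal)
  have V: "carrier ?V = ?c ` m" "\<zero>\<^bsub>?V\<^esub> = pw 2"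
    by (simp_all add: cotangent_space_def)
  have add: "?c u \<oplus>\<^bsub>?V\<^esub> ?c v = ?c (u \<oplus> v)" if "u \<in> m" "v \<in> m" for u v
    using that m_carr J.a_rcos_sum by (simp add: cotangent_space_def)
  have Jm: "pw 2 \<subseteq> m" using pw_antimono[of "Suc 0" 2] pw_1 by auto
  have c0: "?c u = pw 2" if "u \<in> pw 2" for u using that by (rule J.a_rcos_const)
  have car: "carrier (R Quot m) = {m +> a | a. a \<in> carrier R}"
    by (auto simp: FactRing_def A_RCOSETS_def')
  have gen: "V.gen_set (?c ` F) \<longleftrightarrow> Idl (pw 2 \<union> F) = m" if F: "F \<subseteq> m" for F
  proof
    have sub: "pw 2 \<union> F \<subseteq> carrier R" using F Jm m_carr by blast
    let ?I = "Idl (pw 2 \<union> F)"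
    have I: "ideal ?I R" by (rule genideal_ideal[OF sub])
    have sI: "pw 2 \<union> F \<subseteq> ?I" by (rule genideal_self[OF sub])
    have Im: "?I \<subseteq> m" using genideal_minimal[OF m_ideal] Jm F by simp
    { assume g: "V.gen_set (?c ` F)"
      have "LinearCombinations.submodule (R Quot m) (?c ` ?I) ?V"
      proof (rule LinearCombinations.submodule.intro)
        show "module (R Quot m) ?V" by (rule V.module_axioms)
        show "?c ` ?I \<subseteq> carrier ?V" using Im V by blast
        show "\<zero>\<^bsub>?V\<^esub> \<in> ?c ` ?I" using V(2) c0[OF ideal_zero[OF pw_ideal]] ideal_zero[OF I] by (metis image_eqI)
      next
        fix v w assume "v \<in> ?c ` ?I" "w \<in> ?c ` ?I"
        then obtain p q where pq: "p \<in> ?I" "q \<in> ?I" "v = ?c p" "w = ?c q" by blast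
        then show "v \<oplus>\<^bsub>?V\<^esub> w \<in> ?c ` ?I" using add[of p q] Im ideal_add[OF I pq(1,2)] by auto
      next
        fix a v assume "a \<in> carrier (R Quot m)" "v \<in> ?c ` ?I"
        then obtain b p where bp: "b \<in> carrier R" "a = m +> b" "p \<in> ?I" "v = ?c p" unfolding car by blast
        then show "a \<odot>\<^bsub>?V\<^esub> v \<in> ?c ` ?I" using cotangent_smult[of b p] Im ideal_mult[OF I bp(3,1)] by auto
      qed
      moreover have "?c ` F \<subseteq> ?c ` ?I" using sI by blast
      ultimately have "?c ` m \<subseteq> ?c ` ?I" using V.span_is_subset g V(1) by metis
      have "m \<subseteq> ?I"
      proof
        fix u assume u: "u \<in> m"
        then obtain v where "v \<in> ?I" "?c u = ?c v" using \<open>?c ` m \<subseteq> ?c ` ?I\<close> by blast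
        then show "u \<in> ?I" using coset_eq_imp[OF pw_ideal I _ m_carr[OF u]] sI by blast
      qed
      then show "?I = m" using Im by blast }
    { assume gI: "?I = m"
      have Fc: "?c ` F \<subseteq> carrier ?V" using F V by blast
      have S: "LinearCombinations.submodule (R Quot m) (V.span (?c ` F)) ?V" by (rule V.span_is_submodule[OF Fc])
      let ?T = "{u \<in> m. ?c u \<in> V.span (?c ` F)}"
      have "ideal ?T R"
      proof (rule idealI')
        show "\<zero> \<in> ?T" using ideal_zero[OF m_ideal] c0[OF ideal_zero[OF pw_ideal]]
            LinearCombinations.submodule.zero_closed[OF S] V(2) by simp
        fix u assume u: "u \<in> ?T"
        { fix v assume "v \<in> ?T"
          then show "u \<oplus> v \<in> ?T" using u add[of u v] LinearCombinations.submodule.m_closed[OF S, of "?c u" "?c v"]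
              ideal_add[OF m_ideal, of u v] by auto }
        { fix r assume r: "r \<in> carrier R"
          then have "m +> r \<in> carrier (R Quot m)" unfolding car by blast
          then show "r \<otimes> u \<in> ?T" using r u cotangent_smult[of r u] ideal_mult[OF m_ideal _ r, of u]
              LinearCombinations.submodule.smult_closed[OF S, of "m +> r" "?c u"] by auto }
      qed (use m_carr in blast)
      moreover have "pw 2 \<subseteq> ?T"
        using Jm c0 LinearCombinations.submodule.zero_closed[OF S] unfolding V(2) by auto
      moreover have "F \<subseteq> ?T" using F V.in_own_span[OF Fc] by blast
      ultimately have "m \<subseteq> ?T" using genideal_minimal[of ?T "pw 2 \<union> F"] gI by simp
      then have "carrier ?V \<subseteq> V.span (?c ` F)" unfolding V(1) by blast
      then show "V.gen_set (?c ` F)" by (rule equalityI[OF V.span_is_subset2[OF Fc]]) }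
  qed
  let ?P = "\<lambda>n. \<exists>A. finite A \<and> card A = n \<and> A \<subseteq> carrier ?V \<and> V.gen_set A"
  have dim: "embedding_dim R m = (LEAST n. ?P n)" unfolding embedding_dim_def V.dim_def ..
  obtain l where l: "ideal_length R (pw 2) m = enat l"
    using ideal_length_mult_m_finite[OF m_ideal] pw_2 by auto
  obtain F where F: "finite F" "F \<subseteq> m" "card F \<le> l" "Idl (pw 2 \<union> F) = m"
    using ideal_length_obtain_gen[OF pw_ideal m_ideal Jm, of l] l by auto
  have P: "?P (card (?c ` F))" using gen[OF F(2)] F(1,2,4) V(1) by (intro exI[of _ "?c ` F"]) auto
  have "embedding_dim R m \<le> card (?c ` F)" unfolding dim by (rule Least_le[of ?P, OF P])
  also have "\<dots> \<le> l" using card_image_le[OF F(1), of ?c] F(3) by simp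
  finally have le: "embedding_dim R m \<le> l" .
  obtain A where A: "finite A" "card A = embedding_dim R m" "A \<subseteq> ?c ` m" "V.gen_set A"
    using LeastI[of ?P, OF P] unfolding dim V(1) by blast
  \<comment> \<open>One preimage per vector keeps the number of generators equal to the
    dimension.\<close>
  then obtain G where G: "G \<subseteq> m" "inj_on ?c G" "A = ?c ` G" unfolding subset_image_inj by blast
  have G2: "finite G" "card G = embedding_dim R m" using A G finite_imageD card_image by metis+
  have GI: "Idl (pw 2 \<union> G) = m" using gen[OF G(1)] A G by blast
  have "b \<in> carrier R \<and> b \<otimes> g \<in> pw 2" if "b \<in> m" "g \<in> G" for b g
    using that G m_carr unfolding pw_2 by (auto intro: ideal_prod.prod)
  then have "ideal_length R (pw 2) (Idl (pw 2 \<union> G)) \<le> enat (card G) * ideal_length R m (carrier R)"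
    using G m_carr by (intro ideal_length_finite_gen[OF G2(1) _ pw_ideal]) blast+
  then have "l \<le> embedding_dim R m" unfolding GI G2(2) ideal_length_m l by simp
  then show ?thesis using l le by simp
qed

end

section \<open>One-dimensional local rings with a principal reduction\<close>

text \<open>From the exponent \<open>N\<close> on, multiplying a power of \<open>m\<close> by
  \<open>m\<close> amounts to multiplying it by \<open>x\<close>. The hypotheses of the theorem lead
  to this situation through \<open>principal_reductionI\<close>.\<close>

locale principal_reduction = noetherian_local_ring R m for R (structure) and m +
  fixes x N
  assumes x_m: "x \<in> m" and x_nzd: "x \<in> nonzero_divisors R"
    and reduction_pw: "pw (Suc N) = (\<otimes>) x ` pw N"
begin

lemma x_carr [simp]: "x \<in> carrier R"
  using x_m m_carr by blast

lemma x_pow_nzd: "x [^] (k::nat) \<in> nonzero_divisors R"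
  by (induction k) (auto simp: nzd_one intro: nzd_mult x_nzd)

lemma x_pow_cancel: "\<lbrakk>a \<in> carrier R; b \<in> carrier R; x [^] (k::nat) \<otimes> a = x [^] k \<otimes> b\<rbrakk> \<Longrightarrow> a = b"
  using nzd_cancel[OF x_pow_nzd] .

lemma x_pow_neq_zero: "x [^] (k::nat) \<noteq> \<zero>"
  using x_pow_cancel[of \<one> \<zero> k] one_neq_zero by auto

lemma PIdl_x_ideal [simp]: "ideal (PIdl (x [^] (k::nat))) R" "ideal (PIdl x) R"
  by (auto intro: cgenideal_ideal)

lemma PIdl_pow_mono: "k \<le> l \<Longrightarrow> PIdl (x [^] (l::nat)) \<subseteq> PIdl (x [^] (k::nat))"
proof -
  assume "k \<le> l"
  then have "x [^] l = x [^] (l - k) \<otimes> x [^] k" by (simp add: nat_pow_mult)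
  then have "x [^] l \<in> PIdl (x [^] k)" unfolding mem_PIdl by (intro bexI[of _ "x [^] (l - k)"]) auto
  then show ?thesis using PIdl_le[OF PIdl_x_ideal(1)] by blast
qed

lemma PIdl_x_le_m: "PIdl x \<subseteq> m"
  using PIdl_le[OF m_ideal x_m] .

lemma pw_Suc_scale: "pw (Suc (N + k)) = (\<otimes>) x ` pw (N + k)"
proof (induction k)
  case (Suc k)
  have "pw (Suc (N + Suc k)) = ((\<otimes>) x ` pw (N + k)) \<cdot> m" using pw_Suc[of "Suc (N + k)"] Suc by simp
  also have "\<dots> = (\<otimes>) x ` pw (N + Suc k)" using ideal_prod_scale[OF x_carr pw_ideal m_ideal] pw_Suc[of "N + k"] by simp
  finally show ?case .
qed (use reduction_pw in simp)

lemma pw_add: "pw (N + k) = (\<otimes>) (x [^] k) ` pw N"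
proof (induction k)
  case 0
  have "a \<in> carrier R" if "a \<in> pw N" for a using that ideal_subset[OF pw_ideal] by blast
  then show ?case by (auto simp: image_iff)
next
  case (Suc k)
  have "a \<in> carrier R" if "a \<in> pw N" for a using that ideal_subset[OF pw_ideal] by blast
  then have "(\<otimes>) x ` (\<otimes>) (x [^] k) ` pw N = (\<otimes>) (x [^] Suc k) ` pw N"
    unfolding image_image by (intro image_cong) (auto simp: m_ac)
  then show ?case using pw_Suc_scale[of k] Suc by simp
qed

text \<open>Together with \<open>PIdl_le_pw\<close>: the m-adic and the x-adic filtrations differ
  only by the shift \<open>N\<close>.\<close>

lemma pw_le_PIdl: "pw (N + k) \<subseteq> PIdl (x [^] k)"
  unfolding pw_add PIdl_scale[OF nat_pow_closed[OF x_carr]] using ideal_subset[OF pw_ideal] by blast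

lemma pow_in_pw: "a \<in> m \<Longrightarrow> a [^] k \<in> pw k"
proof (induction k)
  case 0 then show ?case using pw_0 by simp
next
  case (Suc k) then show ?case unfolding pw_Suc by (auto intro: ideal_prod.prod)
qed

lemma PIdl_le_pw: "PIdl (x [^] k) \<subseteq> pw k"
  using PIdl_le[OF pw_ideal pow_in_pw[OF x_m]] .

text \<open>The multiplicity of the ring, by \<open>hilbert_samuel_eq_e\<close>.\<close>
definition e :: nat where "e = the_enat (ideal_length R (PIdl x) (carrier R))"

lemma ideal_length_x: "ideal_length R (PIdl x) (carrier R) = enat e"
proof -
  have "pw (Suc N) \<subseteq> PIdl x" using pw_le_PIdl[of 1] by simp
  then show ?thesis using ideal_length_finite_if_pw[of "Suc N" "PIdl x"] unfolding e_def by (metis the_enat.simps)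
qed

lemma ideal_length_x_pow_finite: obtains n where "ideal_length R (PIdl (x [^] (k::nat))) (carrier R) = enat n"
  using ideal_length_finite_if_pw[OF pw_le_PIdl] .

text \<open>Compute \<ell>(R/xA) along \<open>A\<close> and along xR, and use \<ell>(xR/xA) =
  \<ell>(R/A). Cancelling this length requires it to be finite, which the power of \<open>x\<close>
  in \<open>A\<close> guarantees.\<close>

lemma ideal_length_scale_x:
  assumes A: "ideal A R" and k: "PIdl (x [^] (k::nat)) \<subseteq> A"
  shows "ideal_length R ((\<otimes>) x ` A) A = enat e"
proof -
  obtain n where n: "ideal_length R (PIdl (x [^] k)) (carrier R) = enat n" by (rule ideal_length_x_pow_finite)
  have "ideal_length R A (carrier R) \<le> enat n" using ideal_length_antimono[OF k, of "carrier R"] n by simp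
  then obtain a where a: "ideal_length R A (carrier R) = enat a" by (cases "ideal_length R A (carrier R)") auto
  have xA: "ideal ((\<otimes>) x ` A) R" by (rule ideal_scale[OF A x_carr])
  have "(\<otimes>) x ` A \<subseteq> PIdl x" using ideal_subset[OF A] PIdl_scale[OF x_carr] by auto
  then have "ideal_length R ((\<otimes>) x ` A) (carrier R) =
    ideal_length R ((\<otimes>) x ` A) (PIdl x) + ideal_length R (PIdl x) (carrier R)"
    using ideal_length_add[OF xA PIdl_x_ideal(2) oneideal] ideal_subset by auto
  also have "ideal_length R ((\<otimes>) x ` A) (PIdl x) = enat a"
    unfolding PIdl_scale[OF x_carr] using ideal_length_scale[OF x_nzd A oneideal] a by simp
  finally have "ideal_length R ((\<otimes>) x ` A) A + enat a = enat a + enat e"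
    using ideal_length_add[OF xA A oneideal scale_le[OF A x_carr] ideal_subset[OF A]] ideal_length_x a by simp
  then show ?thesis by (cases "ideal_length R ((\<otimes>) x ` A) A") auto
qed

lemma ideal_length_pw:
  obtains c where "\<And>k. ideal_length R (pw (N + k)) (carrier R) = enat (c + k * e)"
proof -
  obtain c where c: "ideal_length R (pw N) (carrier R) = enat c" using ideal_length_pw_finite by blast
  have "ideal_length R (pw (N + k)) (carrier R) = enat (c + k * e)" for k
  proof (induction k)
    case (Suc k)
    have "ideal_length R (pw (Suc (N + k))) (pw (N + k)) = enat e"
      unfolding pw_Suc_scale using ideal_length_scale_x[OF pw_ideal PIdl_le_pw] .
    then show ?case
      using ideal_length_add[OF pw_ideal pw_ideal oneideal, of "Suc (N + k)" "N + k"]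
        ideal_pow_Suc_subset[OF m_ideal, of "N + k"] ideal_subset[OF pw_ideal] Suc by simp
  qed (use c in simp)
  then show ?thesis by (rule that)
qed

text \<open>From \<open>N\<close> on the Hilbert function is linear with slope \<open>e\<close>; in
  dimension 1 it is divided by n, and the contribution of the constant term tends to 0.\<close>

lemma hilbert_samuel_eq_e:
  assumes "krull_dim R = 1" shows "hilbert_samuel_multiplicity R m = real e"
proof -
  obtain c where c: "\<And>k. ideal_length R (pw (N + k)) (carrier R) = enat (c + k * e)"
    using ideal_length_pw by blast
  let ?f = "\<lambda>n. real (the_enat (module_length R (quot_module R (pw n)))) / real n"
  have "?f n = real e + (real c - real N * real e) / real n" if "n > N" for n
  proof -
    obtain k where k: "n = N + k" using \<open>n > N\<close> less_imp_add_positive by blast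
    have "?f n = (real c + real k * real e) / real n"
      using c[of k] module_length_quot[OF pw_ideal] k by simp
    also have "\<dots> = real e + (real c - real N * real e) / real n"
      using that k by (simp add: field_simps)
    finally show ?thesis .
  qed
  then have "\<forall>\<^sub>F n in sequentially. real e + (real c - real N * real e) / real n = ?f n"
    by (intro eventually_sequentiallyI[of "Suc N"]) auto
  moreover have "(\<lambda>n. real e + (real c - real N * real e) / real n) \<longlonglongrightarrow> real e + 0"
    by (intro tendsto_add tendsto_const lim_const_over_n)
  ultimately have "?f \<longlonglongrightarrow> real e" using Lim_transform_eventually by fastforce
  then have "lim ?f = real e" by (rule limI)
  then show ?thesis unfolding hilbert_samuel_multiplicity_def assms by (simp add: one_enat_def)
qed

text \<open>Otherwise m^(N+1) = x m^N would lie in m^(N+2) and vanish by Nakayama's lemma, although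
  it contains the non-zero element x^(N+1).\<close>

lemma x_notin_pw_2: "x \<notin> pw 2"
proof
  assume x2: "x \<in> pw 2"
  have "pw (Suc N) \<subseteq> pw (Suc N) \<cdot> m"
  proof -
    have "(\<otimes>) x ` pw N \<subseteq> pw 2 \<cdot> pw N" using x2 by (auto intro: ideal_prod.prod)
    also have "\<dots> = pw N \<cdot> (m \<cdot> m)" using pw_2 ideal_prod_commute[OF pw_ideal pw_ideal, of 2 N] by simp
    also have "\<dots> = pw (Suc N) \<cdot> m" using ideal_prod_assoc[OF pw_ideal m_ideal m_ideal] pw_Suc[of N] by simp
    finally show ?thesis using reduction_pw by simp
  qed
  also have "\<dots> = m \<cdot> pw (Suc N)" by (rule ideal_prod_commute[OF pw_ideal m_ideal])
  also have "\<dots> \<subseteq> {\<zero>} <+> (m \<cdot> pw (Suc N))"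
    using set_add_ge2[OF zeroideal ideal_subset[OF ideal_prod_is_ideal[OF m_ideal pw_ideal]]] .
  finally have "pw (Suc N) = {\<zero>}"
    using nakayama[OF pw_ideal zeroideal, of "Suc N"] ideal_zero[OF pw_ideal] by blast
  then show False using pow_in_pw[OF x_m, of "Suc N"] x_pow_neq_zero by blast
qed

text \<open>The saturations of the powers of \<open>s\<close> with respect to \<open>x\<close> descend; modulo \<open>x\<close> they stabilise
  because \<open>R/xR\<close> has finite length, hence they stabilise themselves by Nakayama's lemma.\<close>
lemma nzd_divides_x_pow:
  assumes s: "s \<in> nonzero_divisors R"
  obtains k t where "t \<in> carrier R" "x [^] (k::nat) = s \<otimes> t"
proof -
  have sc: "s \<in> carrier R" using s nzdD by blast
  define S where "S i = {t \<in> carrier R. \<exists>k::nat. x [^] k \<otimes> t \<in> PIdl (s [^] (i::nat))}" for i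
  have P: "ideal (PIdl (s [^] i)) R" for i :: nat using sc by (intro cgenideal_ideal) auto
  have S: "ideal (S i) R" for i
  proof (rule idealI')
    fix a b assume "a \<in> S i" "b \<in> S i"
    then obtain k l :: nat where ab: "a \<in> carrier R" "b \<in> carrier R"
      "x [^] k \<otimes> a \<in> PIdl (s [^] i)" "x [^] l \<otimes> b \<in> PIdl (s [^] i)" unfolding S_def by blast
    have "x [^] (k + l) \<otimes> (a \<oplus> b) = x [^] l \<otimes> (x [^] k \<otimes> a) \<oplus> x [^] k \<otimes> (x [^] l \<otimes> b)"
      using ab by (simp add: nat_pow_mult[symmetric] r_distr m_ac)
    also have "\<dots> \<in> PIdl (s [^] i)" by (intro ideal_add[OF P] ideal_mult[OF P] ab nat_pow_closed x_carr)
    finally show "a \<oplus> b \<in> S i" using ab unfolding S_def by blast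
  next
    fix a r assume "a \<in> S i" and r: "r \<in> carrier R"
    then obtain k :: nat where a: "a \<in> carrier R" "x [^] k \<otimes> a \<in> PIdl (s [^] i)" unfolding S_def by blast
    have "x [^] k \<otimes> (r \<otimes> a) = r \<otimes> (x [^] k \<otimes> a)" using a r by (simp add: m_lcomm)
    then have "x [^] k \<otimes> (r \<otimes> a) \<in> PIdl (s [^] i)" using ideal_mult[OF P a(2) r] by simp
    then show "r \<otimes> a \<in> S i" using a r unfolding S_def by blast
  qed (use ideal_zero[OF P] in \<open>auto simp: S_def intro!: exI[of _ "0::nat"]\<close>)
  have anti: "S (Suc i) \<subseteq> S i" for i
  proof -
    have "s [^] Suc i \<in> PIdl (s [^] i)" using sc m_comm unfolding mem_PIdl by auto
    then have "PIdl (s [^] Suc i) \<subseteq> PIdl (s [^] i)" using PIdl_le[OF P] by blast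
    then show ?thesis unfolding S_def by blast
  qed
  have sum: "ideal (S i <+> PIdl x) R" for i using S add_ideals by auto
  \<comment> \<open>Strict descent forever is impossible above xR, where only the length
    \<open>e\<close> is available.\<close>
  have "\<exists>i. S i <+> PIdl x \<subseteq> S (Suc i) <+> PIdl x"
  proof (rule ccontr)
    assume "\<not> ?thesis"
    then have strict: "S (Suc i) <+> PIdl x \<subset> S i <+> PIdl x" for i using set_add_mono[OF anti] by blast
    have low: "enat i \<le> ideal_length R (S i <+> PIdl x) (carrier R)" for i
    proof (induction i)
      case (Suc i)
      have "enat (Suc i) = 1 + enat i" by (simp add: one_enat_def)
      also have "\<dots> \<le> ideal_length R (S (Suc i) <+> PIdl x) (S i <+> PIdl x) + ideal_length R (S i <+> PIdl x) (carrier R)"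
        using Suc ideal_length_ge_1[OF sum sum strict] by (intro add_mono)
      also have "\<dots> = ideal_length R (S (Suc i) <+> PIdl x) (carrier R)"
        using ideal_length_add[OF sum sum oneideal, of "Suc i" i] strict[of i] ideal_subset[OF sum[of i]] by simp
      finally show ?case .
    qed (simp add: zero_enat_def[symmetric])
    have up: "ideal_length R (S i <+> PIdl x) (carrier R) \<le> enat e" for i
      using ideal_length_antimono[of "PIdl x" "S i <+> PIdl x" "carrier R"] set_add_ge2[OF S ideal_subset[OF PIdl_x_ideal(2)]]
        ideal_length_x by auto
    show False using order_trans[OF low[of "Suc e"] up] by simp
  qed
  then obtain i where i: "S i <+> PIdl x \<subseteq> S (Suc i) <+> PIdl x" by blast
  have "S i = S (Suc i)"
  proof (rule nakayama_scale[OF S S anti x_m])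
    show "S i \<subseteq> S (Suc i) <+> (\<otimes>) x ` S i"
    proof
      fix a assume a: "a \<in> S i"
      then have "a \<in> S (Suc i) <+> PIdl x" using i set_add_ge1[OF PIdl_x_ideal(2) ideal_subset[OF S[of i]]] by blast
      then obtain b r where b: "b \<in> S (Suc i)" "r \<in> carrier R" "a = b \<oplus> r \<otimes> x" unfolding mem_add_PIdl by blast
      \<comment> \<open>\<open>S i\<close> is saturated: r x in it forces \<open>r\<close> into it,
        so the part of \<open>a\<close> divisible by \<open>x\<close> comes from x S_i.\<close>
      have "r \<otimes> x \<in> S i" using ideal_cancel_l[OF S, of b i "r \<otimes> x"] a b anti by auto
      then obtain k :: nat where k: "x [^] k \<otimes> (r \<otimes> x) \<in> PIdl (s [^] i)" unfolding S_def by blast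
      have "x [^] k \<otimes> (r \<otimes> x) = x [^] Suc k \<otimes> r" using b by (simp add: m_ac)
      then have "r \<in> S i" using b k unfolding S_def by (metis (mono_tags, lifting) mem_Collect_eq)
      then show "a \<in> S (Suc i) <+> (\<otimes>) x ` S i" using b m_comm[of r x] unfolding mem_set_add by auto
    qed
  qed
  \<comment> \<open>As s^i lies in \<open>S (Suc i)\<close>, some x^k s^i is a multiple of s^(i+1),
    and s^i cancels.\<close>
  moreover have "s [^] i \<in> S i" using cgenideal_self[of "s [^] i"] sc unfolding S_def by (auto intro!: exI[of _ "0::nat"])
  ultimately obtain k :: nat where "x [^] k \<otimes> s [^] i \<in> PIdl (s [^] Suc i)" unfolding S_def by blast
  then obtain t where t: "t \<in> carrier R" "x [^] k \<otimes> s [^] i = t \<otimes> s [^] Suc i" unfolding mem_PIdl by blast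
  have "s [^] i \<in> nonzero_divisors R" by (induction i) (auto simp: nzd_one intro: nzd_mult s)
  then have "x [^] k = s \<otimes> t" using nzd_cancel[of "s [^] i" "x [^] k" "s \<otimes> t"] t sc by (auto simp: m_ac)
  then show ?thesis using that t by blast
qed

end

section \<open>Numerators of integral fractions\<close>

context principal_reduction
begin

lemma PIdl_pow_mult:
  assumes "a \<in> PIdl (x [^] (k::nat))" "b \<in> PIdl (x [^] (l::nat))"
  shows "a \<otimes> b \<in> PIdl (x [^] (k + l))"
proof -
  obtain r s where "r \<in> carrier R" "a = r \<otimes> x [^] k" "s \<in> carrier R" "b = s \<otimes> x [^] l"
    using assms unfolding mem_PIdl by blast
  then show ?thesis unfolding mem_PIdl
    by (intro bexI[of _ "r \<otimes> s"]) (simp_all add: nat_pow_mult[symmetric] m_ac)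
qed

lemma PIdl_carr: "a \<in> PIdl (x [^] (k::nat)) \<Longrightarrow> a \<in> carrier R"
  using ideal_subset[OF PIdl_x_ideal(1)] by blast

lemma x_pow_mem_PIdl: "x [^] (k::nat) \<in> PIdl (x [^] k)"
  by (rule cgenideal_self) simp

lemma PIdl_pow_cancel:
  assumes "a \<in> carrier R" "x [^] (k::nat) \<otimes> a \<in> PIdl (x [^] (k + l))"
  shows "a \<in> PIdl (x [^] (l::nat))"
proof -
  obtain r where r: "r \<in> carrier R" "x [^] k \<otimes> a = r \<otimes> x [^] (k + l)"
    using assms unfolding mem_PIdl by blast
  have "x [^] k \<otimes> a = x [^] k \<otimes> (r \<otimes> x [^] l)" unfolding r(2) using r(1) by (simp add: nat_pow_mult[symmetric] m_ac)
  then have "a = r \<otimes> x [^] l" using x_pow_cancel[of a "r \<otimes> x [^] l" k] assms(1) r(1) by simp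
  then show ?thesis using r(1) unfolding mem_PIdl by blast
qed

text \<open>By \<open>mk_frac_integral_iff\<close> below, \<open>y \<in> H n\<close> means that the fraction \<open>y/x\<^sup>n\<close> is integral over \<open>R\<close>:
  in the Noetherian case this is equivalent to its powers having a common denominator.\<close>
definition H :: "nat \<Rightarrow> 'a set"
  where "H n = {y \<in> carrier R. \<exists>d::nat. \<forall>j::nat. x [^] d \<otimes> y [^] j \<in> PIdl (x [^] (n * j))}"

lemma H_mult:
  assumes "y \<in> H n" "z \<in> H k" shows "y \<otimes> z \<in> H (n + k)"
proof -
  obtain d f :: nat where yz: "y \<in> carrier R" "z \<in> carrier R" "\<And>j::nat. x [^] d \<otimes> y [^] j \<in> PIdl (x [^] (n * j))"
    "\<And>j::nat. x [^] f \<otimes> z [^] j \<in> PIdl (x [^] (k * j))" using assms unfolding H_def by blast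
  have "x [^] (d + f) \<otimes> (y \<otimes> z) [^] j \<in> PIdl (x [^] ((n + k) * j))" for j :: nat
  proof -
    have "x [^] (d + f) \<otimes> (y \<otimes> z) [^] j = (x [^] d \<otimes> y [^] j) \<otimes> (x [^] f \<otimes> z [^] j)"
      using yz(1,2) by (simp add: nat_pow_mult[symmetric] nat_pow_distrib m_ac)
    then show ?thesis using PIdl_pow_mult[OF yz(3,4)] by (simp add: distrib_right)
  qed
  then show ?thesis using yz(1,2) unfolding H_def by blast
qed

lemma H_antimono: "n \<le> k \<Longrightarrow> H k \<subseteq> H n"
  unfolding H_def using PIdl_pow_mono[of "n * _" "k * _"] by (blast intro: mult_right_mono)

lemma x_pow_in_H: "x [^] n \<in> H n"
  unfolding H_def
  using x_pow_mem_PIdl by (auto simp: nat_pow_pow intro!: exI[of _ "0::nat"])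

lemma carrier_in_H_0: "a \<in> carrier R \<Longrightarrow> a \<in> H 0"
  unfolding H_def using genideal_one cgenideal_eq_genideal[OF one_closed] by (auto intro!: exI[of _ "0::nat"])

text \<open>If x^d is a common denominator for the powers of one fraction and x^f for those of
  another, then x^(d+f) is one for the powers of their sum.\<close>

lemma H_ideal: "ideal (H n) R"
proof (rule idealI')
  show "H n \<subseteq> carrier R" unfolding H_def by blast
  show H_smult: "r \<otimes> a \<in> H n" if "a \<in> H n" "r \<in> carrier R" for a r
    using H_mult[OF carrier_in_H_0[OF that(2)] that(1)] by simp
  show "\<zero> \<in> H n" using H_smult[OF x_pow_in_H zero_closed] by simp
  fix a b assume "a \<in> H n" "b \<in> H n"
  then obtain d f :: nat where ab: "a \<in> carrier R" "b \<in> carrier R" "\<And>j::nat. x [^] d \<otimes> a [^] j \<in> PIdl (x [^] (n * j))"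
    "\<And>j::nat. x [^] f \<otimes> b [^] j \<in> PIdl (x [^] (n * j))" unfolding H_def by blast
  \<comment> \<open>The extra factors a^i b^l let the induction peel off one factor a + b at a time,
    which avoids the binomial formula.\<close>
  have "x [^] (d + f) \<otimes> ((a \<oplus> b) [^] j \<otimes> (a [^] i \<otimes> b [^] l)) \<in> PIdl (x [^] (n * (i + l + j)))" for j i l :: nat
  proof (induction j arbitrary: i l)
    case 0
    have "x [^] (d + f) \<otimes> ((a \<oplus> b) [^] (0::nat) \<otimes> (a [^] i \<otimes> b [^] l)) = (x [^] d \<otimes> a [^] i) \<otimes> (x [^] f \<otimes> b [^] l)"
      using ab(1,2) by (simp add: nat_pow_mult[symmetric] m_ac)
    then show ?case using PIdl_pow_mult[OF ab(3)[of i] ab(4)[of l]] by (simp add: distrib_left)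
  next
    case (Suc j)
    have "x [^] (d + f) \<otimes> ((a \<oplus> b) [^] Suc j \<otimes> (a [^] i \<otimes> b [^] l)) =
      x [^] (d + f) \<otimes> ((a \<oplus> b) [^] j \<otimes> (a [^] Suc i \<otimes> b [^] l)) \<oplus> x [^] (d + f) \<otimes> ((a \<oplus> b) [^] j \<otimes> (a [^] i \<otimes> b [^] Suc l))"
    proof -
      define c q p s where "c = (a \<oplus> b) [^] j" and "q = x [^] (d + f)" and "p = a [^] i" and "s = b [^] l"
      have "c \<in> carrier R" "q \<in> carrier R" "p \<in> carrier R" "s \<in> carrier R"
        unfolding c_def q_def p_def s_def using ab(1,2) by auto
      then have "q \<otimes> (c \<otimes> (a \<oplus> b) \<otimes> (p \<otimes> s)) = q \<otimes> (c \<otimes> (p \<otimes> a \<otimes> s)) \<oplus> q \<otimes> (c \<otimes> (p \<otimes> (s \<otimes> b)))"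
        using ab(1,2) by (simp add: r_distr l_distr m_ac)
      then show ?thesis unfolding c_def q_def p_def s_def by simp
    qed
    also have "\<dots> \<in> PIdl (x [^] (n * (i + l + Suc j)))"
      using Suc.IH[of "Suc i" l] Suc.IH[of i "Suc l"] by (intro ideal_add) simp_all
    finally show ?case .
  qed
  from this[of _ 0 0] have "x [^] (d + f) \<otimes> (a \<oplus> b) [^] j \<in> PIdl (x [^] (n * j))" for j :: nat
    using ab(1,2) by simp
  then show "a \<oplus> b \<in> H n" using ab(1,2) unfolding H_def by blast
qed

text \<open>This is where the reduction makes y/x integral: x^N y^j lies in m^(N+j) = x^j m^N, so
  x^N is a common denominator of the powers of y/x.\<close>

lemma m_le_H_1: "m \<subseteq> H (Suc 0)"
proof
  fix y assume y: "y \<in> m"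
  have "x [^] N \<otimes> y [^] j \<in> pw (N + j)" for j :: nat
  proof (induction j)
    case 0 then show ?case using pow_in_pw[OF x_m] by simp
  next
    case (Suc j)
    have "(x [^] N \<otimes> y [^] j) \<otimes> y \<in> pw (N + j) \<cdot> m" using Suc y by (auto intro: ideal_prod.prod)
    then show ?case using pw_Suc[of "N + j"] m_carr[OF y] by (simp add: m_assoc)
  qed
  then show "y \<in> H (Suc 0)" unfolding H_def using pw_le_PIdl m_carr[OF y] by auto
qed

lemma H_cancel:
  assumes "y \<in> carrier R" "x \<otimes> y \<in> H (Suc n)" shows "y \<in> H n"
proof -
  obtain d :: nat where d: "\<And>j::nat. x [^] d \<otimes> (x \<otimes> y) [^] j \<in> PIdl (x [^] (Suc n * j))"
    using assms(2) unfolding H_def by blast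
  have "x [^] d \<otimes> y [^] j \<in> PIdl (x [^] (n * j))" for j :: nat
  proof (rule PIdl_pow_cancel[of _ j])
    have "x [^] d \<otimes> (x \<otimes> y) [^] j = x [^] j \<otimes> (x [^] d \<otimes> y [^] j)"
      using assms(1) by (simp add: nat_pow_distrib m_ac)
    then show "x [^] j \<otimes> (x [^] d \<otimes> y [^] j) \<in> PIdl (x [^] (j + n * j))" using d[of j] by simp
  qed (use assms(1) in simp)
  then show ?thesis using assms(1) unfolding H_def by blast
qed

text \<open>Put \<open>z = y/x\<^sup>n\<close> and let \<open>x\<^sup>d\<close> be a common denominator of the powers of \<open>z\<close>, so that
  \<open>b\<^sub>i = x\<^sup>d z\<^sup>i\<close> is in \<open>R\<close>. The ideal \<open>J\<close> generated by all \<open>b\<^sub>i\<close> satisfies \<open>\<ell>(J/xJ) = e\<close>, so for some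
  \<open>i \<le> e\<close> already \<open>J\<close> is generated by \<open>b\<^sub>0, \<dots>, b\<^bsub>i-1\<^esub>\<close>. Hence \<open>z\<close> is a root of a monic polynomial whose
  degree \<open>i\<close> is bounded independently of \<open>z\<close>.\<close>
lemma H_monic_relation:
  assumes y: "y \<in> H n"
  obtains i d b where "i \<le> e" "\<And>j. b j \<in> carrier R"
    "\<And>j::nat. x [^] (d::nat) \<otimes> y [^] j = x [^] (n * j) \<otimes> b j" "b i \<in> Idl (b ` {..<i})"
proof -
  have yc: "y \<in> carrier R" using y unfolding H_def by blast
  obtain d :: nat where d: "\<And>j::nat. x [^] d \<otimes> y [^] j \<in> PIdl (x [^] (n * j))"
    using y unfolding H_def by blast
  then have "\<forall>j::nat. \<exists>b. b \<in> carrier R \<and> x [^] d \<otimes> y [^] j = x [^] (n * j) \<otimes> b"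
    unfolding PIdl_scale[OF nat_pow_closed[OF x_carr]] by blast
  then obtain b where b: "\<And>j. b j \<in> carrier R" "\<And>j::nat. x [^] d \<otimes> y [^] j = x [^] (n * j) \<otimes> b j"
    by metis
  have b0: "b 0 = x [^] d" using b(1)[of 0] b(2)[of 0] by simp
  \<comment> \<open>The recurrence b_(i+1) = z b_i, written without fractions.\<close>
  have shift: "x [^] n \<otimes> b (Suc i) = y \<otimes> b i" for i
  proof (rule x_pow_cancel[of _ _ "n * i"])
    have "x [^] (n * i) \<otimes> (x [^] n \<otimes> b (Suc i)) = x [^] (n * Suc i) \<otimes> b (Suc i)"
      using b(1) by (simp add: nat_pow_mult[symmetric] m_ac)
    also have "\<dots> = y \<otimes> (x [^] d \<otimes> y [^] i)" unfolding b(2)[symmetric] using yc by (simp add: m_ac)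
    also have "\<dots> = x [^] (n * i) \<otimes> (y \<otimes> b i)" unfolding b(2) using yc b(1) by (simp add: m_ac)
    finally show "x [^] (n * i) \<otimes> (x [^] n \<otimes> b (Suc i)) = x [^] (n * i) \<otimes> (y \<otimes> b i)" .
  qed (use b(1) yc in auto)
  define J where "J i = Idl (b ` {..<i})" for i :: nat
  have bc: "b ` {..<i} \<subseteq> carrier R" for i using b(1) by blast
  have J: "ideal (J i) R" for i unfolding J_def by (rule genideal_ideal[OF bc])
  have bJ: "b l \<in> J i" if "l < i" for l i unfolding J_def using genideal_self[OF bc] that by blast
  have Jmin: "J i \<subseteq> I" if "ideal I R" "\<And>l. l < i \<Longrightarrow> b l \<in> I" for I i
    unfolding J_def using that by (intro genideal_minimal) auto
  have Jmono: "J i \<subseteq> J k" if "i \<le> k" for i k using that by (intro Jmin J bJ) auto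
  obtain n0 where n0: "\<And>k. J k \<subseteq> J n0" by (rule ideal_seq_stabilizes[of J, OF J Jmono[OF le_SucI[OF order_refl]]]) blast
  have bn0: "b l \<in> J n0" for l using n0 bJ[of l "Suc l"] by blast
  \<comment> \<open>Multiplication by z maps \<open>J i\<close> into \<open>J (Suc i)\<close>; the
    witness \<open>v\<close> stands for z u.\<close>
  have shiftJ: "\<exists>v\<in>J (Suc i). x [^] n \<otimes> v = y \<otimes> u" if u: "u \<in> J i" for u i
  proof -
    have "J i \<subseteq> {u \<in> carrier R. \<exists>v\<in>J (Suc i). x [^] n \<otimes> v = y \<otimes> u}"
    proof (intro Jmin idealI')
      show "\<zero> \<in> {u \<in> carrier R. \<exists>v\<in>J (Suc i). x [^] n \<otimes> v = y \<otimes> u}"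
        using ideal_zero[OF J] yc by (auto intro!: bexI[of _ \<zero>])
      fix u assume "u \<in> {u \<in> carrier R. \<exists>v\<in>J (Suc i). x [^] n \<otimes> v = y \<otimes> u}"
      then obtain v where v: "u \<in> carrier R" "v \<in> J (Suc i)" "x [^] n \<otimes> v = y \<otimes> u" by blast
      have vc: "v \<in> carrier R" using v ideal_subset[OF J] by blast
      { fix u' assume "u' \<in> {u \<in> carrier R. \<exists>v\<in>J (Suc i). x [^] n \<otimes> v = y \<otimes> u}"
        then obtain v' where v': "u' \<in> carrier R" "v' \<in> J (Suc i)" "x [^] n \<otimes> v' = y \<otimes> u'" by blast
        have "v' \<in> carrier R" using v' ideal_subset[OF J] by blast
        then have "x [^] n \<otimes> (v \<oplus> v') = y \<otimes> (u \<oplus> u')" using v v' vc yc by (simp add: r_distr)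
        then show "u \<oplus> u' \<in> {u \<in> carrier R. \<exists>v\<in>J (Suc i). x [^] n \<otimes> v = y \<otimes> u}"
          using v v' ideal_add[OF J, of v "Suc i" v'] by blast }
      { fix r assume r: "r \<in> carrier R"
        have "x [^] n \<otimes> (r \<otimes> v) = r \<otimes> (x [^] n \<otimes> v)" using vc r by (simp add: m_lcomm)
        also have "\<dots> = y \<otimes> (r \<otimes> u)" unfolding v(3) using v(1) yc r by (simp add: m_lcomm)
        finally show "r \<otimes> u \<in> {u \<in> carrier R. \<exists>v\<in>J (Suc i). x [^] n \<otimes> v = y \<otimes> u}"
          using v(1) r ideal_mult[OF J v(2) r] by blast }
    next
      fix l assume "l < i"
      then show "b l \<in> {u \<in> carrier R. \<exists>v\<in>J (Suc i). x [^] n \<otimes> v = y \<otimes> u}"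
        using b(1) bJ[of "Suc l" "Suc i"] shift[of l] by blast
    qed blast
    then show ?thesis using u by blast
  qed
  \<comment> \<open>All \<open>K i\<close> lie between xJ and J, where J is \<open>J n0\<close>; an
    increasing chain of them has at most \<open>e\<close> strict steps.\<close>
  define K where "K i = J i <+> (\<otimes>) x ` J n0" for i
  have xJ: "ideal ((\<otimes>) x ` J n0) R" by (rule ideal_scale[OF J x_carr])
  have K: "ideal (K i) R" for i unfolding K_def by (rule add_ideals[OF J xJ])
  have JK: "J i \<subseteq> K i" for i unfolding K_def by (rule set_add_ge1[OF xJ ideal_subset[OF J]])
  have xJK: "(\<otimes>) x ` J n0 \<subseteq> K i" for i unfolding K_def by (rule set_add_ge2[OF J ideal_subset[OF xJ]])
  have KJ: "K i \<subseteq> J n0" for i unfolding K_def using set_add_le[OF J n0] scale_le[OF J x_carr] by blast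
  have Kmono: "K i \<subseteq> K (Suc i)" for i unfolding K_def using set_add_mono[OF Jmono[of i "Suc i"]] by simp
  have "\<exists>i\<le>e. K (Suc i) \<subseteq> K i"
  proof (rule ccontr)
    assume "\<not> ?thesis"
    then have strict: "K i \<subset> K (Suc i)" if "i \<le> e" for i using that Kmono by blast
    have "enat i \<le> ideal_length R ((\<otimes>) x ` J n0) (K i)" if "i \<le> Suc e" for i
      using that
    proof (induction i)
      case (Suc i)
      have "enat (Suc i) = enat i + 1" by (simp add: one_enat_def)
      also have "\<dots> \<le> ideal_length R ((\<otimes>) x ` J n0) (K i) + ideal_length R (K i) (K (Suc i))"
        using Suc ideal_length_ge_1[OF K K strict, of i] by (intro add_mono) auto
      also have "\<dots> = ideal_length R ((\<otimes>) x ` J n0) (K (Suc i))"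
        using ideal_length_add[OF xJ K K xJK Kmono] by simp
      finally show ?case .
    qed (simp add: zero_enat_def[symmetric])
    then have "enat (Suc e) \<le> ideal_length R ((\<otimes>) x ` J n0) (K (Suc e))" by blast
    also have "\<dots> \<le> ideal_length R ((\<otimes>) x ` J n0) (J n0)"
      using ideal_length_add[OF xJ K J xJK KJ, of "Suc e"] by simp
    also have "\<dots> = enat e"
      using ideal_length_scale_x[OF J PIdl_le[OF J], of d n0] bn0[of 0] b0 by simp
    finally show False by simp
  qed
  then obtain i where i: "i \<le> e" "K (Suc i) \<subseteq> K i" by blast
  \<comment> \<open>Multiplication by z maps \<open>K i\<close> into \<open>K (Suc i)\<close>, hence
    into \<open>K i\<close> itself, and so carries membership from b_l to b_(l+1).\<close>
  have "b l \<in> K i" for l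
  proof (cases "l < i")
    case True then show ?thesis using bJ JK by blast
  next
    case False
    then have "i \<le> l" by simp
    then show ?thesis
    proof (induction l rule: dec_induct)
      case base then show ?case using bJ[of i "Suc i"] JK i by blast
    next
      case (step l)
      then obtain u v where uv: "u \<in> J i" "v \<in> J n0" "b l = u \<oplus> x \<otimes> v" unfolding K_def mem_set_add by blast
      obtain u' where u': "u' \<in> J (Suc i)" "x [^] n \<otimes> u' = y \<otimes> u" using shiftJ[OF uv(1)] by blast
      obtain v' where v': "v' \<in> J n0" "x [^] n \<otimes> v' = y \<otimes> v" using shiftJ[OF uv(2)] n0 by blast
      have c: "u \<in> carrier R" "v \<in> carrier R" "u' \<in> carrier R" "v' \<in> carrier R"
        using uv u' v' ideal_subset[OF J] by blast+
      have "x [^] n \<otimes> (u' \<oplus> x \<otimes> v') = x [^] n \<otimes> u' \<oplus> x \<otimes> (x [^] n \<otimes> v')" using c by (simp add: r_distr m_lcomm)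
      also have "\<dots> = y \<otimes> (u \<oplus> x \<otimes> v)" unfolding u' v' using c yc by (simp add: r_distr m_lcomm)
      also have "\<dots> = x [^] n \<otimes> b (Suc l)" using uv(3) shift[of l] by simp
      finally have "b (Suc l) = u' \<oplus> x \<otimes> v'" using x_pow_cancel[of "u' \<oplus> x \<otimes> v'" "b (Suc l)" n] c b(1) by simp
      then have "b (Suc l) \<in> K (Suc i)" using u' v' unfolding K_def mem_set_add by blast
      then show ?case using i by blast
    qed
  qed
  then have "J n0 \<subseteq> J i <+> (\<otimes>) x ` J n0" using Jmin[OF K] unfolding K_def by blast
  then have "J n0 = J i" by (intro nakayama_scale[OF J J n0 x_m])
  then have "b i \<in> J i" using bn0 by blast
  then show ?thesis using that[of i b d] i b unfolding J_def by blast
qed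

lemma H_pow_e:
  assumes y: "y \<in> H n" shows "y [^] e \<in> PIdl (x [^] n)"
proof -
  have yc: "y \<in> carrier R" using y unfolding H_def by blast
  obtain i d b where i: "i \<le> e" and b: "\<And>j. b j \<in> carrier R"
      "\<And>j::nat. x [^] (d::nat) \<otimes> y [^] j = x [^] (n * j) \<otimes> b j"
    and bi: "b i \<in> Idl (b ` {..<i})" by (rule H_monic_relation[OF y]) blast
  \<comment> \<open>The monic relation is read off in a colon ideal that contains each b_l with l <
    i, because b_l x^(ni) = x^d x^(n(i-l)) y^l and i - l is at least 1. The factor y^(e-i) at the
    end makes the exponent uniform.\<close>
  have "Idl (b ` {..<i}) \<subseteq> {r \<in> carrier R. r \<otimes> x [^] (n * i) \<in> PIdl (x [^] (d + n))}"
  proof (intro genideal_minimal[OF ideal_colon] image_subsetI)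
    fix l assume "l \<in> {..<i}"
    then have l: "l < i" by simp
    have "b l \<otimes> x [^] (n * i) = x [^] (n * (i - l)) \<otimes> (x [^] (n * l) \<otimes> b l)"
    proof -
      have "n * i = n * (i - l) + n * l" using l by (simp flip: distrib_left)
      then have "x [^] (n * i) = x [^] (n * (i - l)) \<otimes> x [^] (n * l)" by (simp add: nat_pow_mult)
      then show ?thesis using b(1)[of l] by (simp add: m_ac)
    qed
    also have "\<dots> = y [^] l \<otimes> (x [^] d \<otimes> x [^] (n * (i - l)))" unfolding b(2)[symmetric] using yc by (simp add: m_ac)
    also have "\<dots> \<in> PIdl (x [^] (d + n * (i - l)))"
      using yc by (intro ideal_mult PIdl_pow_mult x_pow_mem_PIdl) auto
    also have "\<dots> \<subseteq> PIdl (x [^] (d + n))" using l by (intro PIdl_pow_mono) (cases "i - l"; simp)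
    finally show "b l \<in> {r \<in> carrier R. r \<otimes> x [^] (n * i) \<in> PIdl (x [^] (d + n))}" using b(1) by blast
  qed auto
  then have "x [^] (n * i) \<otimes> b i \<in> PIdl (x [^] (d + n))" using bi m_comm[OF b(1)] by auto
  then have "y [^] i \<in> PIdl (x [^] n)" using PIdl_pow_cancel[of "y [^] i" d n] yc b(2)[of i] by simp
  then have "y [^] (e - i) \<otimes> y [^] i \<in> PIdl (x [^] n)" using yc by (intro ideal_mult) auto
  then show ?thesis using i yc by (simp add: nat_pow_mult)
qed

end

section \<open>Finite length of the conductor\<close>

context principal_reduction
begin

lemma one_notin_H: "\<one> \<notin> H (Suc n)"
proof
  assume "\<one> \<in> H (Suc n)"
  then obtain d :: nat where "\<And>j::nat. x [^] d \<otimes> \<one> [^] j \<in> PIdl (x [^] (Suc n * j))"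
    unfolding H_def by blast
  \<comment> \<open>The power \<open>Suc d\<close> is large enough that a factor \<open>x\<close> is
    left over after x^d is cancelled.\<close>
  then have "x [^] d \<otimes> \<one> \<in> PIdl (x [^] (Suc n * Suc d))" by (metis nat_pow_one)
  then have "x [^] d \<otimes> \<one> \<in> PIdl (x [^] (d + 1))" using PIdl_pow_mono[of "d + 1" "Suc n * Suc d"] by auto
  then have "\<one> \<in> PIdl (x [^] (1::nat))" by (rule PIdl_pow_cancel[rotated]) simp
  then show False using PIdl_x_le_m one_notin_m by auto
qed

lemma H_Suc_le_m: "H (Suc n) \<subseteq> m"
  using proper_le_m[OF H_ideal] one_notin_H one_closed by blast

text \<open>R/x^k R has finite length. The index \<open>n\<close> is one at which the length of
  R/(G_n + x^k R), bounded by that of R/x^k R, is largest.\<close>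

lemma descending_mod_x_pow:
  assumes G: "\<And>n. ideal (G n) R" and anti: "\<And>n. G (Suc n) \<subseteq> G n"
  obtains n where "\<And>l. G n \<subseteq> G l <+> PIdl (x [^] (k::nat))"
proof -
  let ?S = "\<lambda>n. G n <+> PIdl (x [^] k)"
  have mono: "l \<ge> n \<Longrightarrow> G l \<subseteq> G n" for l n using lift_Suc_antimono_le[of G] anti by blast
  have S: "ideal (?S n) R" for n using add_ideals[OF G] by simp
  have ge: "PIdl (x [^] k) \<subseteq> ?S n" for n using set_add_ge2[OF G ideal_subset[OF PIdl_x_ideal(1)]] .
  have "\<exists>c. ideal_length R (?S n) (carrier R) = enat c" for n
    using ideal_length_antimono[OF ge, of n "carrier R"] ideal_length_x_pow_finite[of k] by (metis enat_ile)
  then obtain c where c: "\<And>n. ideal_length R (?S n) (carrier R) = enat (c n)" by metis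
  obtain b where b: "ideal_length R (PIdl (x [^] k)) (carrier R) = enat b" by (rule ideal_length_x_pow_finite)
  have "c n \<le> b" for n using ideal_length_antimono[OF ge, of n "carrier R"] unfolding c b by simp
  then have "finite (range c)" using finite_subset[of "range c" "{..b}"] by blast
  then obtain n where n: "\<And>l. c l \<le> c n" using Max_in[of "range c"] Max_ge[of "range c"] by (metis imageE UNIV_I image_eqI empty_iff)
  show ?thesis
  proof (rule that)
    fix l
    let ?l = "max n l"
    have sub: "?S ?l \<subseteq> ?S n" using set_add_mono[OF mono] by simp
    have "enat (c ?l) = ideal_length R (?S ?l) (?S n) + enat (c n)"
      using ideal_length_add[OF S S oneideal sub ideal_subset[OF S]] c by simp
    then have "ideal_length R (?S ?l) (?S n) = 0" using n[of ?l]
      by (cases "ideal_length R (?S ?l) (?S n)") (auto simp: zero_enat_def)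
    then have "?S n = ?S ?l" using ideal_length_eq_0[OF S S sub] by simp
    then have "G n \<subseteq> ?S ?l" using set_add_ge1[OF PIdl_x_ideal(1) ideal_subset[OF G], of n k] by simp
    also have "\<dots> \<subseteq> ?S l" using set_add_mono[OF mono, of l ?l] by simp
    finally show "G n \<subseteq> ?S l" .
  qed
qed

text \<open>If no \<open>H n\<close> were contained in \<open>xR\<close>, compactness would give a coherent sequence of elements of
  \<open>H n + x\<^sup>kR\<close> that represents a nonzero element of the completion; its \<open>e\<close>-th power vanishes.\<close>
lemma H_le_PIdl_x:
  assumes au: "analytically_unramified R m"
  obtains n where "H (Suc n) \<subseteq> PIdl x"
proof (rule ccontr)
  assume "\<not> thesis"
  with that have not: "\<not> H (Suc n) \<subseteq> PIdl x" for n by blast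
  define P where "P k a \<longleftrightarrow> (\<forall>n. a \<in> H n <+> PIdl (x [^] Suc k))" for k :: nat and a
  have Panti: "H (Suc n) \<subseteq> H n" for n by (rule H_antimono) simp
  obtain n0 where n0: "\<And>l. H n0 \<subseteq> H l <+> PIdl (x [^] Suc 0)"
    using descending_mod_x_pow[of H, OF H_ideal Panti] by blast
  \<comment> \<open>\<open>H n0\<close> is contained in every \<open>H l\<close> modulo
    \<open>x\<close>, so any of its elements outside xR can start the sequence.\<close>
  obtain a0 where a0: "a0 \<in> H (Suc n0)" "a0 \<notin> PIdl x" using not by blast
  then have P0: "P 0 a0" unfolding P_def using n0 Panti[of n0] by blast
  have step: "\<exists>b. P (Suc k) b \<and> b \<ominus> a \<in> PIdl (x [^] Suc k)" if Pa: "P k a" for k a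
  proof -
    \<comment> \<open>The component of \<open>a\<close> in this \<open>H n\<close> satisfies the
      condition for \<open>Suc k\<close>, and it differs from \<open>a\<close> by a multiple of
      x^(k+1) only.\<close>
    obtain n where n: "\<And>l. H n \<subseteq> H l <+> PIdl (x [^] Suc (Suc k))"
      using descending_mod_x_pow[of H, OF H_ideal Panti] by blast
    obtain b c where bc: "b \<in> H n" "c \<in> PIdl (x [^] Suc k)" "a = b \<oplus> c" using Pa unfolding P_def mem_set_add by blast
    have "b \<in> carrier R" "c \<in> carrier R" using bc ideal_subset[OF H_ideal] PIdl_carr by blast+
    then have "b \<ominus> a = \<ominus> c" unfolding bc(3) by (simp add: minus_eq minus_add a_assoc[symmetric] r_neg)
    moreover have "\<ominus> c \<in> PIdl (x [^] Suc k)" using bc(2) PIdl_x_ideal(1)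
      by (metis additive_subgroup.a_inv_closed ideal.axioms(1))
    ultimately show ?thesis using n bc(1) unfolding P_def by (intro exI[of _ b]) auto
  qed
  obtain a where a: "a 0 = a0" "\<And>k. P k (a k)" "\<And>k. a (Suc k) \<ominus> a k \<in> PIdl (x [^] Suc k)"
    using dependent_nat_choice[of "\<lambda>k a. P k a \<and> (k = 0 \<longrightarrow> a = a0)" "\<lambda>k a b. b \<ominus> a \<in> PIdl (x [^] Suc k)"] P0 step
    by (metis (no_types, lifting) nat.distinct(1))
  have ac: "a k \<in> carrier R" for k
    using a(2)[of k] ideal_subset[OF add_ideals[OF H_ideal PIdl_x_ideal(1)]] unfolding P_def by blast
  \<comment> \<open>Modulo x^(k+1) the term \<open>a k\<close> is an element of
    \<open>H (Suc k)\<close>, to which \<open>H_pow_e\<close> applies.\<close>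
  have ae: "a k [^] e \<in> PIdl (x [^] Suc k)" for k
  proof -
    obtain b c where bc: "b \<in> H (Suc k)" "c \<in> PIdl (x [^] Suc k)" "a k = b \<oplus> c" using a(2) unfolding P_def mem_set_add by blast
    have bcc: "b \<in> carrier R" "c \<in> carrier R" using bc ideal_subset[OF H_ideal] PIdl_carr by blast+
    have "(b \<oplus> c) [^] j \<ominus> b [^] j \<in> PIdl (x [^] Suc k)" for j :: nat
    proof (induction j)
      case 0 show ?case using ideal_zero[OF PIdl_x_ideal(1), of "Suc k"] by (simp add: minus_eq r_neg)
    next
      case (Suc j)
      define u v where "u = (b \<oplus> c) [^] j" and "v = b [^] j"
      have uv: "u \<in> carrier R" "v \<in> carrier R" unfolding u_def v_def using bcc by auto
      have "u \<otimes> (b \<oplus> c) \<ominus> v \<otimes> b = b \<otimes> (u \<ominus> v) \<oplus> u \<otimes> c"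
        using uv bcc by (simp add: minus_eq r_distr l_distr m_ac a_ac r_minus)
      also have "\<dots> \<in> PIdl (x [^] Suc k)" using Suc[folded u_def v_def] bc uv bcc
        by (intro ideal_add[OF PIdl_x_ideal(1)] ideal_mult[OF PIdl_x_ideal(1)])
      finally show ?case unfolding u_def v_def by simp
    qed
    then have "a k [^] e \<ominus> b [^] e \<oplus> b [^] e \<in> PIdl (x [^] Suc k)"
      unfolding bc(3) using H_pow_e[OF bc(1)] by (intro ideal_add[OF PIdl_x_ideal(1)])
    then show ?thesis using ac bcc by (simp add: minus_eq a_assoc l_neg)
  qed
  let ?C = "completion R m"
  define f where "f n = pw n +> a n" for n
  have coset: "pw n +> u = pw n +> v" if "u \<ominus> v \<in> pw n" "u \<in> carrier R" "v \<in> carrier R" for u v n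
  proof -
    interpret n: ideal "pw n" R by (rule pw_ideal)
    have "u = (u \<ominus> v) \<oplus> v" using that by (simp add: minus_eq a_assoc l_neg)
    then have "u \<in> pw n +> v" using that unfolding a_r_coset_def' by blast
    then show ?thesis using n.a_repr_independence' that by metis
  qed
  have le: "PIdl (x [^] Suc k) \<subseteq> pw k" "PIdl (x [^] Suc k) \<subseteq> pw (Suc k)" for k
    using PIdl_le_pw[of "Suc k"] pw_antimono[of k "Suc k"] by auto
  have fC: "f \<in> carrier ?C"
  proof -
    have "f n \<in> carrier (R Quot pw n)" for n
      unfolding f_def using ac by (auto simp: FactRing_def A_RCOSETS_def')
    moreover have "f (Suc n) \<subseteq> f n" for n
    proof -
      have "pw n +> a (Suc n) = f n" unfolding f_def using a(3)[of n] le ac by (intro coset) auto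
      moreover have "f (Suc n) \<subseteq> pw n +> a (Suc n)"
        unfolding f_def a_r_coset_def' by (rule UN_mono[OF pw_antimono]) simp_all
      ultimately show ?thesis by blast
    qed
    ultimately show ?thesis unfolding completion_def by simp
  qed
  have "f [^]\<^bsub>?C\<^esub> j = (\<lambda>n. pw n +> a n [^] j)" for j :: nat
  proof (induction j)
    case 0
    show ?case by (simp add: nat_pow_def completion_def FactRing_def)
  next
    case (Suc j)
    have "(pw n +> a n [^] j) \<otimes>\<^bsub>R Quot pw n\<^esub> (pw n +> a n) = pw n +> a n [^] Suc j" for n
      using ring_hom_mult[OF ideal.rcos_ring_hom[OF pw_ideal], of "a n [^] j" "a n" n] ac by simp
    then show ?case using Suc by (simp add: nat_pow_def completion_def f_def)
  qed
  moreover have "(\<lambda>n. pw n +> a n [^] e) = \<zero>\<^bsub>?C\<^esub>"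
  proof -
    have "pw n +> a n [^] e = pw n" for n
    proof -
      interpret n: ideal "pw n" R by (rule pw_ideal)
      show ?thesis using ae[of n] le n.a_rcos_const by blast
    qed
    then show ?thesis by (simp add: completion_def FactRing_def)
  qed
  ultimately have "f = \<zero>\<^bsub>?C\<^esub>"
    using au fC unfolding analytically_unramified_def reduced_ring_def by metis
  then have "pw n +> a n = pw n" for n by (simp add: f_def completion_def FactRing_def fun_eq_iff)
  moreover have "a n \<in> pw n +> a n" for n
  proof -
    interpret n: ideal "pw n" R by (rule pw_ideal)
    show ?thesis by (rule n.a_rcos_self[OF ac])
  qed
  ultimately have an: "a n \<in> pw n" for n by simp
  \<comment> \<open>The vanishing of \<open>f\<close> is tested at N + 1, because m^(N+1) lies in xR
    while every term is congruent to \<open>a0\<close> modulo \<open>x\<close>.\<close>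
  have "a k \<ominus> a 0 \<in> PIdl x" for k
  proof (induction k)
    case 0 show ?case using ac ideal_zero[OF PIdl_x_ideal(2)] by (simp add: minus_eq r_neg)
  next
    case (Suc k)
    have "a (Suc k) \<ominus> a k \<in> PIdl x" using a(3)[of k] PIdl_pow_mono[of 1 "Suc k"] by auto
    then have "(a (Suc k) \<ominus> a k) \<oplus> (a k \<ominus> a 0) \<in> PIdl x" using Suc by (intro ideal_add) auto
    moreover have "(a (Suc k) \<ominus> a k) \<oplus> (a k \<ominus> a 0) = a (Suc k) \<ominus> a 0"
      using ac[of k] ac[of "Suc k"] ac[of 0] by (simp add: minus_eq a_assoc r_neg1)
    ultimately show ?case by simp
  qed
  moreover have "a (N + 1) \<in> PIdl x" using an[of "N + 1"] pw_le_PIdl[of 1] by auto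
  ultimately have "a (N + 1) \<ominus> (a (N + 1) \<ominus> a 0) \<in> PIdl x" by (rule ideal_minus[OF PIdl_x_ideal(2), rotated])
  moreover have "a (N + 1) \<ominus> (a (N + 1) \<ominus> a 0) = a 0"
    using ac[of "N + 1"] ac[of 0] by (simp add: minus_eq minus_add r_neg1 r_neg2)
  ultimately show False using a(1) a0(2) by simp
qed

text \<open>A numerator over x^l with l > k is divisible by \<open>x\<close>, so the fraction can be
  reduced until its denominator is x^k. Hence x^k is a common denominator of all integral
  fractions.\<close>

lemma x_pow_mult_H:
  assumes n: "H (Suc k) \<subseteq> PIdl x" and y: "y \<in> H l"
  shows "x [^] k \<otimes> y \<in> PIdl (x [^] l)"
  using y
proof (induction l arbitrary: y)
  case 0
  then have "x [^] k \<otimes> y \<in> carrier R" using ideal_subset[OF H_ideal, of 0] by (intro m_closed) auto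
  then show ?case unfolding mem_PIdl by (auto intro!: bexI[of _ "x [^] k \<otimes> y"])
next
  case (Suc l)
  have yc: "y \<in> carrier R" using Suc.prems ideal_subset[OF H_ideal] by blast
  show ?case
  proof (cases "Suc l \<le> k")
    case True
    then show ?thesis using ideal_mult[OF PIdl_x_ideal(1) x_pow_mem_PIdl yc, of k] PIdl_pow_mono[of "Suc l" k] yc m_comm[of y "x [^] k"] by auto
  next
    case False
    then have "y \<in> PIdl x" using n Suc.prems H_antimono[of "Suc k" "Suc l"] by auto
    then obtain r where r: "r \<in> carrier R" "y = x \<otimes> r" unfolding PIdl_scale[OF x_carr] by blast
    have "x [^] k \<otimes> r \<in> PIdl (x [^] l)" using Suc H_cancel[OF r(1)] r(2) by blast
    then have "x [^] (1::nat) \<otimes> (x [^] k \<otimes> r) \<in> PIdl (x [^] (1 + l))" by (intro PIdl_pow_mult x_pow_mem_PIdl)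
    moreover have "x \<otimes> (x [^] k \<otimes> r) = x [^] k \<otimes> y" using r by (simp add: m_lcomm)
    ultimately show ?thesis by simp
  qed
qed

end

section \<open>Integral fractions and the conductor\<close>

context cring
begin

lemma mk_frac_closed: "\<lbrakk>a \<in> carrier R; s \<in> nonzero_divisors R\<rbrakk> \<Longrightarrow> mk_frac R a s \<in> carrier (total_frac_ring R)"
  unfolding carrier_total_frac_ring by blast

lemma mk_frac_pow:
  assumes "a \<in> carrier R" "s \<in> nonzero_divisors R"
  shows "mk_frac R a s [^]\<^bsub>total_frac_ring R\<^esub> (j::nat) = mk_frac R (a [^] j) (s [^] j)
    \<and> s [^] j \<in> nonzero_divisors R"
proof -
  interpret Q: cring "total_frac_ring R" by (rule cring_total_frac_ring)
  show ?thesis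
    by (induction j) (simp_all add: frac_one_zero nzd_one nzd_mult mk_frac_mult assms)
qed

lemma mk_frac_in_range_iff:
  assumes "a \<in> carrier R" "s \<in> nonzero_divisors R"
  shows "mk_frac R a s \<in> frac_embed R ` carrier R \<longleftrightarrow> a \<in> PIdl s"
  unfolding mem_PIdl image_iff
  using assms nzdD(1)[OF assms(2)] by (intro bex_cong) (auto simp: frac_embed_def mk_frac_eq_iff nzd_one)

lemma (in ring) eval_map_minus:
  assumes "set p \<subseteq> carrier R" "z \<in> carrier R"
  shows "eval (map (\<lambda>a. \<ominus> a) p) z = \<ominus> eval p z"
  using assms by (induction p) (simp_all add: l_minus minus_add eval_in_carrier)

end

context principal_reduction
begin

lemma frac_eq_div_x_pow:
  assumes "w \<in> carrier (total_frac_ring R)"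
  obtains n y where "y \<in> carrier R" "w = mk_frac R y (x [^] (n::nat))"
proof -
  obtain a s where w: "a \<in> carrier R" "s \<in> nonzero_divisors R" "w = mk_frac R a s"
    using assms unfolding carrier_total_frac_ring by blast
  obtain k t where t: "t \<in> carrier R" "x [^] (k::nat) = s \<otimes> t" using nzd_divides_x_pow[OF w(2)] by blast
  have "w = mk_frac R (a \<otimes> t) (x [^] k)"
    unfolding w(3) using w t nzdD(1)[OF w(2)] x_pow_nzd[of k] by (subst mk_frac_eq_iff) (auto simp: m_ac)
  then show ?thesis using that w t by blast
qed

lemma mk_frac_in_range_iff_x: "y \<in> carrier R \<Longrightarrow> mk_frac R y (x [^] (n::nat)) \<in> frac_embed R ` carrier R \<longleftrightarrow> y \<in> PIdl (x [^] n)"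
  by (rule mk_frac_in_range_iff[OF _ x_pow_nzd])

text \<open>For \<open>y\<close> in \<open>H n\<close>, the relation of
  \<open>H_monic_relation\<close> is divided by the common denominator x^d. Conversely, if the monic
  equation has degree L, the powers below L have the common denominator x^(nL), and the equation
  passes it on to the higher ones.\<close>

lemma mk_frac_integral_iff:
  assumes y: "y \<in> carrier R"
  shows "mk_frac R y (x [^] (n::nat)) \<in> integral_closure R \<longleftrightarrow> y \<in> H n"
proof -
  let ?Q = "total_frac_ring R" and ?K = "frac_embed R ` carrier R"
  define z where "z = mk_frac R y (x [^] n)"
  interpret Q: cring ?Q by (rule cring_total_frac_ring)
  interpret h: ring_hom_ring R ?Q "frac_embed R"
    by (rule ring_hom_ringI2[OF ring_axioms Q.ring_axioms frac_embed_hom])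
  have sub: "subring ?K ?Q" by (rule h.img_is_subring[OF carrier_is_subring])
  have K: "?K \<subseteq> carrier ?Q" by (rule subringE(1)[OF sub])
  have z: "z \<in> carrier ?Q" unfolding z_def by (rule mk_frac_closed[OF y x_pow_nzd])
  have zpow: "z [^]\<^bsub>?Q\<^esub> j = mk_frac R (y [^] j) (x [^] (n * j))" for j :: nat
    using mk_frac_pow[OF y x_pow_nzd, of n j] by (simp add: z_def nat_pow_pow)
  have Qnz: "\<one>\<^bsub>?Q\<^esub> \<noteq> \<zero>\<^bsub>?Q\<^esub>"
    using one_neq_zero by (simp add: frac_one_zero mk_frac_eq_iff nzd_one)
  have scale: "frac_embed R a \<otimes>\<^bsub>?Q\<^esub> mk_frac R c s = mk_frac R (a \<otimes> c) s"
    if "a \<in> carrier R" "c \<in> carrier R" "s \<in> nonzero_divisors R" for a c s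
    using that nzdD(1)[of s] by (simp add: frac_embed_def mk_frac_mult nzd_one)
  show ?thesis
  proof
    assume "y \<in> H n"
    then obtain i d b where b: "\<And>j. b j \<in> carrier R"
      "\<And>j::nat. x [^] (d::nat) \<otimes> y [^] j = x [^] (n * j) \<otimes> b j" and bi: "b i \<in> Idl (b ` {..<i})"
      by (rule H_monic_relation) blast
    let ?D = "frac_embed R (x [^] d)"
    have D: "?D \<in> carrier ?Q" by simp
    have Dz: "frac_embed R (b j) = ?D \<otimes>\<^bsub>?Q\<^esub> z [^]\<^bsub>?Q\<^esub> j" for j
      unfolding zpow using b[of j] y
      by (simp add: scale x_pow_nzd) (simp add: frac_embed_def mk_frac_eq_iff x_pow_nzd nzd_one m_ac)
    \<comment> \<open>The list has exactly \<open>k\<close> entries, leading zeros included, so that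
      a coefficient put in front of it belongs to z^k.\<close>
    have "\<exists>p. set p \<subseteq> ?K \<and> length p = k \<and> frac_embed R u = ?D \<otimes>\<^bsub>?Q\<^esub> Q.eval p z"
      if "u \<in> Idl (b ` {..<k})" for k u
      using that
    proof (induction k arbitrary: u)
      case 0
      have "Idl {} \<subseteq> {\<zero>}" by (rule genideal_minimal[OF zeroideal]) simp
      then show ?case using 0 D by (intro exI[of _ "[]"]) auto
    next
      case (Suc k)
      have "u \<in> Idl (b ` {..<k}) <+> PIdl (b k)"
        using Suc.prems Idl_insert[of "b ` {..<k}" "b k"] b(1) by (auto simp: lessThan_Suc)
      then obtain v r where v: "v \<in> Idl (b ` {..<k})" "r \<in> carrier R" "u = v \<oplus> r \<otimes> b k"
        unfolding mem_add_PIdl by blast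
      have vc: "v \<in> carrier R" using v(1) b(1) ideal_subset[OF genideal_ideal[of "b ` {..<k}"]] by blast
      obtain p where p: "set p \<subseteq> ?K" "length p = k" "frac_embed R v = ?D \<otimes>\<^bsub>?Q\<^esub> Q.eval p z"
        using Suc.IH[OF v(1)] by blast
      have pe: "Q.eval p z \<in> carrier ?Q" using Q.eval_in_carrier[OF _ z] p(1) K by blast
      have "frac_embed R u = ?D \<otimes>\<^bsub>?Q\<^esub> Q.eval p z \<oplus>\<^bsub>?Q\<^esub> frac_embed R r \<otimes>\<^bsub>?Q\<^esub> (?D \<otimes>\<^bsub>?Q\<^esub> z [^]\<^bsub>?Q\<^esub> k)"
        unfolding v(3) using v(2) vc b(1)[of k] p(3) Dz[of k] by simp
      also have "\<dots> = ?D \<otimes>\<^bsub>?Q\<^esub> Q.eval (frac_embed R r # p) z"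
        using z D pe v(2) p(2) by (simp add: Q.r_distr Q.m_ac Q.a_ac)
      finally show ?case using p v(2) by (intro exI[of _ "frac_embed R r # p"]) auto
    qed
    then obtain p where p: "set p \<subseteq> ?K" "length p = i" "frac_embed R (b i) = ?D \<otimes>\<^bsub>?Q\<^esub> Q.eval p z"
      using bi by blast
    have pe: "Q.eval p z \<in> carrier ?Q" using Q.eval_in_carrier[OF _ z] p(1) K by blast
    have inv: "mk_frac R \<one> (x [^] d) \<otimes>\<^bsub>?Q\<^esub> (?D \<otimes>\<^bsub>?Q\<^esub> w) = w" if w: "w \<in> carrier ?Q" for w
    proof -
      have "mk_frac R \<one> (x [^] d) \<otimes>\<^bsub>?Q\<^esub> ?D = \<one>\<^bsub>?Q\<^esub>"
        by (simp add: frac_embed_def mk_frac_mult mk_frac_eq_iff frac_one_zero nzd_one x_pow_nzd)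
      then show ?thesis using w D mk_frac_closed[OF one_closed x_pow_nzd, of d] by (simp flip: Q.m_assoc)
    qed
    have zi: "z [^]\<^bsub>?Q\<^esub> i = Q.eval p z"
      using inv[OF Q.nat_pow_closed[OF z], of i] inv[OF pe] unfolding Dz[of i, symmetric] p(3)[symmetric] by (rule trans[OF sym])
    \<comment> \<open>Although \<open>p\<close> may begin with zeros, the 1 in front makes the list
      a polynomial in the normalised representation.\<close>
    let ?p = "\<one>\<^bsub>?Q\<^esub> # map (\<lambda>a. \<ominus>\<^bsub>?Q\<^esub> a) p"
    have "Q.eval ?p z = \<zero>\<^bsub>?Q\<^esub>"
      using Q.eval_map_minus[of p z] z zi p(1,2) K pe by (auto simp: Q.r_neg)
    moreover have "?p \<in> carrier (?K[X]\<^bsub>?Q\<^esub>)"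
      using p(1) Qnz subringE(3,5)[OF sub] by (auto simp: univ_poly_def polynomial_def)
    ultimately show "mk_frac R y (x [^] n) \<in> integral_closure R"
      unfolding integral_closure_def integral_over_def z_def[symmetric]
      by (intro CollectI conjI z bexI[of _ ?p]) simp_all
  next
    assume "mk_frac R y (x [^] n) \<in> integral_closure R"
    then obtain p where p: "p \<in> carrier (?K[X]\<^bsub>?Q\<^esub>)" "p \<noteq> []" "hd p = \<one>\<^bsub>?Q\<^esub>" "Q.eval p z = \<zero>\<^bsub>?Q\<^esub>"
      unfolding integral_closure_def integral_over_def z_def by blast
    obtain q where q: "p = \<one>\<^bsub>?Q\<^esub> # q" using p by (cases p) auto
    have qK: "set q \<subseteq> ?K" using p(1) q by (auto simp: univ_poly_def polynomial_def)
    define L where "L = length q"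
    have qe: "Q.eval q z \<in> carrier ?Q" using Q.eval_in_carrier[OF _ z] qK K by blast
    have "z [^]\<^bsub>?Q\<^esub> L \<oplus>\<^bsub>?Q\<^esub> Q.eval q z = \<zero>\<^bsub>?Q\<^esub>" using p(4) z qe unfolding q L_def by simp
    then have zL: "z [^]\<^bsub>?Q\<^esub> L = \<ominus>\<^bsub>?Q\<^esub> Q.eval q z" using z qe by (metis Q.minus_equality Q.nat_pow_closed)
    let ?D = "frac_embed R (x [^] (n * L))"
    have D: "?D \<in> carrier ?Q" by simp
    define M where "M = {w \<in> carrier ?Q. ?D \<otimes>\<^bsub>?Q\<^esub> w \<in> ?K}"
    have M_add: "w \<oplus>\<^bsub>?Q\<^esub> w' \<in> M" if "w \<in> M" "w' \<in> M" for w w'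
      using that D subringE(7)[OF sub] unfolding M_def by (auto simp: Q.r_distr)
    have M_mult: "a \<otimes>\<^bsub>?Q\<^esub> w \<in> M" if "a \<in> ?K" "w \<in> M" for a w
    proof -
      have "a \<in> carrier ?Q" using that K by blast
      then have "?D \<otimes>\<^bsub>?Q\<^esub> (a \<otimes>\<^bsub>?Q\<^esub> w) = a \<otimes>\<^bsub>?Q\<^esub> (?D \<otimes>\<^bsub>?Q\<^esub> w)" using that D unfolding M_def by (simp add: Q.m_lcomm)
      then show ?thesis using that \<open>a \<in> carrier ?Q\<close> subringE(6)[OF sub] unfolding M_def by simp
    qed
    have M_zero: "\<zero>\<^bsub>?Q\<^esub> \<in> M" unfolding M_def using D subringE(2)[OF sub] by simp
    have M_eval: "z [^]\<^bsub>?Q\<^esub> s \<otimes>\<^bsub>?Q\<^esub> Q.eval r z \<in> M"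
      if "set r \<subseteq> ?K" "\<And>j. j < length r \<Longrightarrow> z [^]\<^bsub>?Q\<^esub> (s + j) \<in> M" for r and s :: nat
      using that
    proof (induction r)
      case Nil
      then show ?case using z M_zero by simp
    next
      case (Cons a r)
      have c: "a \<in> carrier ?Q" "Q.eval r z \<in> carrier ?Q" using Cons.prems(1) K Q.eval_in_carrier[OF _ z, of r] by auto
      have "z [^]\<^bsub>?Q\<^esub> s \<otimes>\<^bsub>?Q\<^esub> Q.eval (a # r) z =
        a \<otimes>\<^bsub>?Q\<^esub> z [^]\<^bsub>?Q\<^esub> (s + length r) \<oplus>\<^bsub>?Q\<^esub> z [^]\<^bsub>?Q\<^esub> s \<otimes>\<^bsub>?Q\<^esub> Q.eval r z"
        using z c by (simp add: Q.r_distr Q.nat_pow_mult[symmetric] Q.m_ac)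
      then show ?case using Cons by (simp add: M_add M_mult)
    qed
    have zM: "z [^]\<^bsub>?Q\<^esub> j \<in> M" for j :: nat
    proof (induction j rule: less_induct)
      case (less j)
      show ?case
      proof (cases "j < L")
        case True
        then have le: "n * j \<le> n * L" by simp
        have "?D \<otimes>\<^bsub>?Q\<^esub> z [^]\<^bsub>?Q\<^esub> j = mk_frac R (x [^] (n * L) \<otimes> y [^] j) (x [^] (n * j))"
          unfolding zpow using y by (simp add: scale x_pow_nzd)
        moreover have "x [^] (n * L) \<otimes> y [^] j \<in> PIdl (x [^] (n * j))"
          using PIdl_pow_mono[OF le] x_pow_mem_PIdl[of "n * L"] ideal_mult[OF PIdl_x_ideal(1), of "x [^] (n * L)" "n * j" "y [^] j"]
            m_comm[of "x [^] (n * L)" "y [^] j"] y by auto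
        ultimately show ?thesis using z y by (simp add: M_def mk_frac_in_range_iff_x)
      next
        case False
        \<comment> \<open>The equation multiplied by z^s expresses z^j through the L preceding
          powers.\<close>
        define s where "s = j - L"
        have j: "j = s + L" using False by (simp add: s_def)
        have "z [^]\<^bsub>?Q\<^esub> j = z [^]\<^bsub>?Q\<^esub> s \<otimes>\<^bsub>?Q\<^esub> (\<ominus>\<^bsub>?Q\<^esub> Q.eval q z)"
          unfolding j zL[symmetric] using z by (simp add: Q.nat_pow_mult)
        also have "\<dots> = (\<ominus>\<^bsub>?Q\<^esub> \<one>\<^bsub>?Q\<^esub>) \<otimes>\<^bsub>?Q\<^esub> (z [^]\<^bsub>?Q\<^esub> s \<otimes>\<^bsub>?Q\<^esub> Q.eval q z)"
          using z qe by (simp add: Q.r_minus Q.l_minus)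
        also have "\<dots> \<in> M"
          using less.IH j L_def by (intro M_mult M_eval qK subringE(5)[OF sub subringE(3)[OF sub]]) auto
        finally show ?thesis .
      qed
    qed
    have "x [^] (n * L) \<otimes> y [^] j \<in> PIdl (x [^] (n * j))" for j :: nat
    proof -
      have "mk_frac R (x [^] (n * L) \<otimes> y [^] j) (x [^] (n * j)) \<in> ?K"
        using zM[of j] y unfolding M_def zpow by (simp add: scale x_pow_nzd)
      then show ?thesis using y by (simp add: mk_frac_in_range_iff_x)
    qed
    then show "y \<in> H n" unfolding H_def using y by blast
  qed
qed

text \<open>By \<open>frac_eq_div_x_pow\<close> only the denominators x^n have to be tested, which
  expresses the conductor inside R, without fractions.\<close>

lemma conductor_ideal_eq:
  "conductor_ideal R = {a \<in> carrier R. \<forall>n. \<forall>y\<in>H n. a \<otimes> y \<in> PIdl (x [^] n)}"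
proof -
  have emb: "frac_embed R a \<otimes>\<^bsub>total_frac_ring R\<^esub> mk_frac R y (x [^] n) = mk_frac R (a \<otimes> y) (x [^] n)"
    if "a \<in> carrier R" "y \<in> carrier R" for a y and n :: nat
    using that by (simp add: frac_embed_def mk_frac_mult nzd_one x_pow_nzd)
  have Hc: "y \<in> carrier R" if "y \<in> H n" for y n using that ideal_subset[OF H_ideal] by blast
  show ?thesis
  proof (intro equalityI subsetI)
    fix a assume "a \<in> conductor_ideal R"
    then have a: "a \<in> carrier R"
      "\<And>w. w \<in> integral_closure R \<Longrightarrow> frac_embed R a \<otimes>\<^bsub>total_frac_ring R\<^esub> w \<in> frac_embed R ` carrier R"
      unfolding conductor_ideal_def conductor_def by auto
    have "a \<otimes> y \<in> PIdl (x [^] n)" if y: "y \<in> H n" for n y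
    proof -
      have "mk_frac R y (x [^] n) \<in> integral_closure R" using mk_frac_integral_iff[OF Hc[OF y], of n] y by simp
      then show ?thesis using a(2)[of "mk_frac R y (x [^] n)"] a(1) Hc[OF y] by (simp add: emb mk_frac_in_range_iff_x)
    qed
    then show "a \<in> {a \<in> carrier R. \<forall>n. \<forall>y\<in>H n. a \<otimes> y \<in> PIdl (x [^] n)}" using a by blast
  next
    fix a assume "a \<in> {a \<in> carrier R. \<forall>n. \<forall>y\<in>H n. a \<otimes> y \<in> PIdl (x [^] n)}"
    then have a: "a \<in> carrier R" "\<And>n y. y \<in> H n \<Longrightarrow> a \<otimes> y \<in> PIdl (x [^] n)" by auto
    have "frac_embed R a \<otimes>\<^bsub>total_frac_ring R\<^esub> w \<in> frac_embed R ` carrier R" if w: "w \<in> integral_closure R" for w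
    proof -
      have "w \<in> carrier (total_frac_ring R)" using w unfolding integral_closure_def by blast
      then obtain n y where y: "y \<in> carrier R" "w = mk_frac R y (x [^] (n::nat))" by (rule frac_eq_div_x_pow)
      then have "y \<in> H n" using mk_frac_integral_iff w by blast
      then show ?thesis using a y by (simp add: emb mk_frac_in_range_iff_x)
    qed
    moreover have "frac_embed R a \<in> carrier (total_frac_ring R)"
      using ring_hom_closed[OF frac_embed_hom] a by blast
    ultimately show "a \<in> conductor_ideal R" using a unfolding conductor_ideal_def conductor_def by blast
  qed
qed

end

section \<open>The multiplicity bound\<close>

text \<open>For the empty prefix the definition speaks of the quotient by the zero ideal, from which
  regularity has to be carried back to R.\<close>

lemma (in cring) nzd_if_regular_sequence:
  assumes "regular_sequence R xs" "xs \<noteq> []" shows "hd xs \<in> nonzero_divisors R"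
proof -
  obtain s ys where xs: "xs = s # ys" using assms by (cases xs) auto
  have s: "s \<in> carrier R" using assms xs unfolding regular_sequence_def by auto
  interpret Z: ideal "{\<zero>}" R by (rule zeroideal)
  have "Idl {} = {\<zero>}" using genideal_minimal[OF zeroideal, of "{}"] ideal_zero[OF genideal_ideal[of "{}"]] by auto
  then have nz: "{\<zero>} +> s \<in> nonzero_divisors (R Quot {\<zero>})"
    using assms xs unfolding regular_sequence_def by (auto simp: Let_def)
  have "a = \<zero>" if a: "a \<in> carrier R" "s \<otimes> a = \<zero>" for a
  proof -
    have "({\<zero>} +> s) \<otimes>\<^bsub>R Quot {\<zero>}\<^esub> ({\<zero>} +> a) = {\<zero>} +> \<zero>"
      using ring_hom_mult[OF Z.rcos_ring_hom s a(1)] a(2) by simp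
    also have "\<dots> = \<zero>\<^bsub>R Quot {\<zero>}\<^esub>" by (simp add: FactRing_def Z.a_rcos_const)
    finally have "{\<zero>} +> a = \<zero>\<^bsub>R Quot {\<zero>}\<^esub>"
      using nz ring_hom_closed[OF Z.rcos_ring_hom a(1)] unfolding nonzero_divisors_def by blast
    then have "{\<zero>} +> a = {\<zero>}" by (simp add: FactRing_def)
    then show ?thesis using Z.a_rcos_self[OF a(1)] by simp
  qed
  then have "s \<in> nonzero_divisors R" using s unfolding nonzero_divisors_def by blast
  then show ?thesis unfolding xs by simp
qed

text \<open>Positive depth yields a non-zero-divisor s in \<open>m\<close>. Since s^(N+1) lies in
  m^(N+1) = x m^N, the element \<open>x\<close> divides a non-zero-divisor and is therefore one
  itself.\<close>

lemma (in noetherian_local_ring) principal_reductionI: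
  assumes depth: "depth R m \<noteq> 0" and x: "x \<in> carrier R" and red: "reduction R (PIdl x) m"
  obtains N where "principal_reduction R m x N"
proof -
  obtain N where N: "PIdl x \<subseteq> m" "(PIdl x) \<cdot> pw N = pw (Suc N)" using red unfolding reduction_def by blast
  have N2: "pw (Suc N) = (\<otimes>) x ` pw N" using N(2) ideal_prod_PIdl[OF x pw_ideal] by simp
  have xm: "x \<in> m" using N(1) cgenideal_self[OF x] by blast
  have "\<not> depth R m \<le> 0" using depth by simp
  then obtain xs where xs: "regular_sequence R xs" "set xs \<subseteq> m" "\<not> enat (length xs) \<le> 0"
    unfolding depth_def SUP_le_iff by blast
  then have "xs \<noteq> []" by (auto simp: zero_enat_def)
  then have s: "hd xs \<in> nonzero_divisors R" "hd xs \<in> m" using nzd_if_regular_sequence xs by auto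
  let ?s = "hd xs [^] Suc N"
  have sk: "hd xs [^] (k::nat) \<in> nonzero_divisors R \<and> hd xs [^] k \<in> pw k" for k
  proof (induction k)
    case 0 then show ?case using nzd_one pw_0 by simp
  next
    case (Suc k) then show ?case unfolding pw_Suc using s by (auto intro: nzd_mult ideal_prod.prod)
  qed
  obtain t where t: "t \<in> pw N" "?s = x \<otimes> t" using sk[of "Suc N"] N2 by auto
  have tc: "t \<in> carrier R" using t ideal_subset[OF pw_ideal] by blast
  have "a = \<zero>" if a: "a \<in> carrier R" "x \<otimes> a = \<zero>" for a
  proof (rule nzdD(2)[OF _ a(1)])
    show "?s \<in> nonzero_divisors R" using sk by blast
    show "?s \<otimes> a = \<zero>" unfolding t using a tc x m_comm[of x t] m_assoc[of t x a] by simp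
  qed
  then have "x \<in> nonzero_divisors R" using x unfolding nonzero_divisors_def by blast
  then have "principal_reduction R m x N"
    by (intro principal_reduction.intro principal_reduction_axioms.intro noetherian_local_ring_axioms xm N2)
  then show ?thesis by (rule that)
qed

section \<open>Discrete valuation rings\<close>

context principal_reduction
begin

text \<open>An element of the intersection I stays in I when divided by the non-zero-divisor
  \<open>x\<close>, so I = xI and Nakayama's lemma applies.\<close>

lemma Inter_PIdl_x_pow:
  assumes "\<And>k::nat. a \<in> PIdl (x [^] k)" shows "a = \<zero>"
proof -
  define I where "I = (\<Inter>k::nat. PIdl (x [^] k))"
  have I: "ideal I R" unfolding I_def by (rule i_Intersect) auto
  have "I = {\<zero>}"
  proof (rule nakayama_scale[OF I zeroideal _ x_m])
    show "{\<zero>} \<subseteq> I" using ideal_zero[OF I] by blast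
    have "I \<subseteq> (\<otimes>) x ` I"
    proof
      fix b assume b: "b \<in> I"
      then have "b \<in> PIdl (x [^] (1::nat))" unfolding I_def by blast
      then obtain r where r: "r \<in> carrier R" "b = x \<otimes> r" using PIdl_scale[OF x_carr] by auto
      have "r \<in> PIdl (x [^] k)" for k :: nat
      proof (rule PIdl_pow_cancel[OF r(1), of 1])
        have "b \<in> PIdl (x [^] (1 + k))" using b unfolding I_def by blast
        then show "x [^] (1::nat) \<otimes> r \<in> PIdl (x [^] (1 + k))" using r by simp
      qed
      then show "b \<in> (\<otimes>) x ` I" using r unfolding I_def by blast
    qed
    then show "I \<subseteq> {\<zero>} <+> (\<otimes>) x ` I"
      using set_add_ge2[OF zeroideal ideal_subset[OF ideal_scale[OF I x_carr]]] by blast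
  qed
  moreover have "a \<in> I" using assms unfolding I_def by blast
  ultimately show ?thesis by blast
qed

lemma x_pow_unit_if_m_eq:
  assumes m: "m = PIdl x" and a: "a \<in> carrier R" "a \<noteq> \<zero>"
  obtains k u v where "u \<in> carrier R" "v \<in> carrier R" "v \<otimes> u = \<one>" "a = x [^] (k::nat) \<otimes> u"
proof -
  have "\<exists>k::nat. a \<notin> PIdl (x [^] k)" using Inter_PIdl_x_pow a(2) by blast
  moreover have "a \<in> PIdl (x [^] (0::nat))"
    using a(1) unfolding mem_PIdl by (intro bexI[of _ a]) auto
  ultimately obtain k where k: "a \<in> PIdl (x [^] k)" "a \<notin> PIdl (x [^] Suc k)"
    using nat_induct[of "\<lambda>k. a \<in> PIdl (x [^] k)"] by blast
  then obtain u where u: "u \<in> carrier R" "a = x [^] k \<otimes> u" unfolding PIdl_scale[OF nat_pow_closed[OF x_carr]] by blast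
  have "u \<notin> m"
  proof
    assume "u \<in> m"
    then obtain v where v: "v \<in> carrier R" "u = v \<otimes> x" unfolding m mem_PIdl by blast
    have "a = v \<otimes> x [^] Suc k" unfolding u(2) v(2) using v(1) by (simp add: m_ac)
    then show False using k(2) v(1) unfolding mem_PIdl by blast
  qed
  then obtain v where "v \<in> carrier R" "v \<otimes> u = \<one>" using unit_if_notin_m u(1) by blast
  then show ?thesis using that u by blast
qed

text \<open>If g generates \<open>m\<close>, then x = ug with u a unit, as otherwise
  \<open>x\<close> would lie in m^2. Conversely, writing non-zero elements as a power of
  \<open>x\<close> times a unit shows that R is a domain with principal ideals.\<close>

lemma dvr_iff: "dvr R \<longleftrightarrow> m = PIdl x"
proof
  assume "dvr R"
  then have P: "principal_domain R" unfolding dvr_def by blast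
  obtain g where g: "g \<in> carrier R" "m = PIdl g" using principal_domain.exists_gen[OF P m_ideal] by blast
  then obtain u where u: "u \<in> carrier R" "x = u \<otimes> g" using x_m unfolding g(2) mem_PIdl by blast
  have gm: "g \<in> m" unfolding g(2) by (rule cgenideal_self[OF g(1)])
  have "u \<notin> m"
  proof
    assume "u \<in> m"
    then have "x \<in> pw 2" unfolding u(2) pw_2 using gm by (auto intro: ideal_prod.prod)
    then show False using x_notin_pw_2 by blast
  qed
  then obtain v where v: "v \<in> carrier R" "v \<otimes> u = \<one>" using unit_if_notin_m u(1) by blast
  have "v \<otimes> x = g" unfolding u(2) using v u(1) g(1) by (simp flip: m_assoc)
  then have "g \<in> PIdl x" using v(1) unfolding mem_PIdl by blast
  then have "m \<subseteq> PIdl x" using PIdl_le[OF PIdl_x_ideal(2)] g(2) by blast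
  then show "m = PIdl x" using PIdl_x_le_m by blast
next
  assume m: "m = PIdl x"
  have x0: "x \<noteq> \<zero>" using x_pow_neq_zero[of 1] by simp
  have "domain R"
  proof (intro domain.intro domain_axioms.intro is_cring)
    show "\<one> \<noteq> \<zero>" by (rule one_neq_zero)
    fix a b assume ab: "a \<otimes> b = \<zero>" "a \<in> carrier R" "b \<in> carrier R"
    show "a = \<zero> \<or> b = \<zero>"
    proof (rule ccontr)
      assume "\<not> (a = \<zero> \<or> b = \<zero>)"
      then have n: "a \<noteq> \<zero>" "b \<noteq> \<zero>" by auto
      obtain k u v where a: "u \<in> carrier R" "v \<in> carrier R" "v \<otimes> u = \<one>" "a = x [^] (k::nat) \<otimes> u"
        by (rule x_pow_unit_if_m_eq[OF m ab(2) n(1)])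
      have "a \<otimes> b = x [^] k \<otimes> (u \<otimes> b)" unfolding a(4) using a ab(3) by (simp add: m_assoc)
      then have "u \<otimes> b = \<zero>" using x_pow_cancel[of "u \<otimes> b" \<zero> k] a ab by simp
      moreover have "b = v \<otimes> (u \<otimes> b)" using a ab(3) by (simp flip: m_assoc)
      ultimately show False using a(2) n(2) by simp
    qed
  qed
  moreover have "\<exists>a\<in>carrier R. I = PIdl a" if I: "ideal I R" for I
  proof (cases "I = {\<zero>}")
    case True
    then have "I = PIdl \<zero>" using cgenideal_minimal[OF zeroideal, of \<zero>] cgenideal_self[of \<zero>] by auto
    then show ?thesis by blast
  next
    case False
    have x_pow_in: "\<exists>k u. u \<in> carrier R \<and> a = x [^] (k::nat) \<otimes> u \<and> x [^] k \<in> I" if a: "a \<in> I" "a \<noteq> \<zero>" for a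
    proof -
      have "a \<in> carrier R" using a I ideal_subset by blast
      then obtain k u v where u: "u \<in> carrier R" "v \<in> carrier R" "v \<otimes> u = \<one>" "a = x [^] (k::nat) \<otimes> u"
        by (rule x_pow_unit_if_m_eq[OF m _ a(2)])
      have "v \<otimes> a = (v \<otimes> u) \<otimes> x [^] k" unfolding u(4) using u(1,2) by (simp add: m_ac)
      then have "x [^] k \<in> I" using ideal_mult[OF I a(1) u(2)] u(3) by simp
      then show ?thesis using u by blast
    qed
    then have ex: "\<exists>k::nat. x [^] k \<in> I" using False ideal_zero[OF I] by blast
    define k where "k = (LEAST k::nat. x [^] k \<in> I)"
    have k: "x [^] k \<in> I" "\<And>l. x [^] l \<in> I \<Longrightarrow> k \<le> l"
      unfolding k_def using LeastI_ex[OF ex] Least_le by auto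
    have "I \<subseteq> PIdl (x [^] k)"
    proof
      fix a assume a: "a \<in> I"
      show "a \<in> PIdl (x [^] k)"
      proof (cases "a = \<zero>")
        case True then show ?thesis using ideal_zero[OF PIdl_x_ideal(1)] by simp
      next
        case False
        then obtain l u where l: "u \<in> carrier R" "a = x [^] (l::nat) \<otimes> u" "x [^] l \<in> I" using x_pow_in[OF a] by blast
        have "a \<in> PIdl (x [^] l)" using l(1,2) unfolding PIdl_scale[OF nat_pow_closed[OF x_carr]] by blast
        then show ?thesis using PIdl_pow_mono[OF k(2)[OF l(3)]] by blast
      qed
    qed
    then show ?thesis using PIdl_le[OF I k(1)] by (intro bexI[of _ "x [^] k"]) auto
  qed
  ultimately have "principal_domain R"
    by (intro principal_domain.intro principal_domain_axioms.intro)
  moreover have "\<not> field R"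
  proof
    assume "field R"
    then have "x \<in> Units R" using field.field_Units x0 by fastforce
    then obtain y where "y \<in> carrier R" "y \<otimes> x = \<one>" unfolding Units_def by blast
    then show False using ideal_mult[OF m_ideal x_m] one_notin_m by metis
  qed
  moreover have "local_ring R m" by (rule local_ring_axioms)
  ultimately show "dvr R" unfolding dvr_def by blast
qed

section \<open>The conductor as an ideal of the ring\<close>

lemma conductor_mult_H: "\<lbrakk>a \<in> conductor_ideal R; y \<in> H n\<rbrakk> \<Longrightarrow> a \<otimes> y \<in> PIdl (x [^] n)"
  unfolding conductor_ideal_eq by blast

lemma conductor_ideal_ideal: "ideal (conductor_ideal R) R"
proof (rule idealI')
  have Hc: "y \<in> carrier R" if "y \<in> H n" for y n using that ideal_subset[OF H_ideal] by blast
  show "conductor_ideal R \<subseteq> carrier R" unfolding conductor_ideal_def by blast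
  show "\<zero> \<in> conductor_ideal R"
    unfolding conductor_ideal_eq using ideal_zero[OF PIdl_x_ideal(1)] Hc by simp
  fix a assume a: "a \<in> conductor_ideal R"
  have ac: "a \<in> carrier R" using a unfolding conductor_ideal_def by blast
  { fix b assume b: "b \<in> conductor_ideal R"
    have bc: "b \<in> carrier R" using b unfolding conductor_ideal_def by blast
    have "(a \<oplus> b) \<otimes> y \<in> PIdl (x [^] n)" if "y \<in> H n" for n y
      using ideal_add[OF PIdl_x_ideal(1) conductor_mult_H[OF a that] conductor_mult_H[OF b that]]
        Hc[OF that] ac bc by (simp add: l_distr)
    then show "a \<oplus> b \<in> conductor_ideal R" using ac bc unfolding conductor_ideal_eq by blast }
  { fix r assume r: "r \<in> carrier R"
    have "(r \<otimes> a) \<otimes> y \<in> PIdl (x [^] n)" if "y \<in> H n" for n y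
      using ideal_mult[OF PIdl_x_ideal(1) conductor_mult_H[OF a that] r]
        Hc[OF that] ac r by (simp add: m_assoc)
    then show "r \<otimes> a \<in> conductor_ideal R" using ac r unfolding conductor_ideal_eq by blast }
qed

lemma conductor_mult_m: "\<lbrakk>a \<in> conductor_ideal R; b \<in> m\<rbrakk> \<Longrightarrow> a \<otimes> b \<in> PIdl x"
  using conductor_mult_H[of a b "Suc 0"] m_le_H_1 by auto

text \<open>For b in \<open>m\<close> and y in \<open>H n\<close> the product b y is in
  \<open>H (Suc n)\<close>. If \<open>x\<close> is in the conductor, x b y is divisible by x^(n+1),
  and one factor \<open>x\<close> cancels.\<close>

lemma m_le_conductor_ideal:
  assumes "x \<in> conductor_ideal R" shows "m \<subseteq> conductor_ideal R"
proof
  fix b assume b: "b \<in> m"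
  have "b \<otimes> y \<in> PIdl (x [^] n)" if y: "y \<in> H n" for n y
  proof (rule PIdl_pow_cancel[of _ 1])
    show "b \<otimes> y \<in> carrier R" using m_carr[OF b] y ideal_subset[OF H_ideal] by blast
    have "b \<otimes> y \<in> H (1 + n)" using H_mult[of b 1 y n] m_le_H_1 b y by auto
    from conductor_mult_H[OF assms this] show "x [^] (1::nat) \<otimes> (b \<otimes> y) \<in> PIdl (x [^] (1 + n))" by simp
  qed
  then show "b \<in> conductor_ideal R" unfolding conductor_ideal_eq using m_carr[OF b] by blast
qed

lemma x_pow_in_conductor_ideal: "H (Suc k) \<subseteq> PIdl x \<Longrightarrow> x [^] k \<in> conductor_ideal R"
  unfolding conductor_ideal_eq using x_pow_mult_H by simp

text \<open>If m = xR, then \<open>H (Suc 0)\<close>, being contained in \<open>m\<close>, lies in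
  xR, so x^0 is already a common denominator of the integral fractions. The converse is
  \<open>conductor_mult_m\<close> for the element 1.\<close>

lemma one_in_conductor_ideal_iff: "\<one> \<in> conductor_ideal R \<longleftrightarrow> m = PIdl x"
proof
  assume 1: "\<one> \<in> conductor_ideal R"
  have "b \<in> PIdl x" if "b \<in> m" for b using conductor_mult_m[OF 1 that] m_carr[OF that] by simp
  then show "m = PIdl x" using PIdl_x_le_m by blast
next
  assume "m = PIdl x"
  then have "H (Suc 0) \<subseteq> PIdl x" using H_Suc_le_m by blast
  then show "\<one> \<in> conductor_ideal R" using x_pow_in_conductor_ideal[of 0] by simp
qed

text \<open>As \<open>x\<close> lies in \<open>m\<close> but not in m^2, its class spans a line in
  m/m^2. The last clause makes the subtraction of natural numbers exact.\<close>

lemma ideal_length_m_mod_x: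
  "ideal (PIdl x <+> pw 2) R" "PIdl x <+> pw 2 \<subseteq> m"
    "ideal_length R (PIdl x <+> pw 2) m = enat (embedding_dim R m - 1)" "1 \<le> embedding_dim R m"
proof -
  let ?A = "PIdl x <+> pw 2"
  have pm: "pw 2 \<subseteq> m" using pw_antimono[of "Suc 0" 2] pw_1 by auto
  show A: "ideal ?A R" by (rule add_ideals[OF PIdl_x_ideal(2) pw_ideal])
  show Am: "?A \<subseteq> m" by (rule set_add_le[OF m_ideal PIdl_x_le_m pm])
  have pA: "pw 2 \<subseteq> ?A" by (rule set_add_ge2[OF PIdl_x_ideal(2) ideal_subset[OF pw_ideal]])
  have xA: "x \<in> ?A" using set_add_ge1[OF pw_ideal ideal_subset[OF PIdl_x_ideal(2)]] cgenideal_self[OF x_carr] by blast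
  have ge: "1 \<le> ideal_length R (pw 2) ?A"
    using ideal_length_ge_1[OF pw_ideal A] pA xA x_notin_pw_2 by blast
  have "ideal_length R (pw 2) (pw 2 <+> PIdl x) \<le> ideal_length R m (carrier R)"
  proof (rule ideal_length_adjoin_le[OF pw_ideal x_carr])
    fix b assume "b \<in> m"
    then show "b \<in> carrier R \<and> b \<otimes> x \<in> pw 2" using m_carr x_m unfolding pw_2 by (auto intro: ideal_prod.prod)
  qed
  moreover have "pw 2 <+> PIdl x = ?A"
    using set_add_comm[OF ideal_subset[OF pw_ideal] ideal_subset[OF PIdl_x_ideal(2)]] .
  ultimately have "ideal_length R (pw 2) ?A = 1" using ge ideal_length_m by simp
  then have "enat (embedding_dim R m) = 1 + ideal_length R ?A m"
    using ideal_length_add[OF pw_ideal A m_ideal pA Am] ideal_length_pw_2 by simp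
  then show "ideal_length R ?A m = enat (embedding_dim R m - 1)" "1 \<le> embedding_dim R m"
    by (cases "ideal_length R ?A m"; simp add: one_enat_def)+
qed

lemma e_eq: "enat e = ideal_length R (PIdl x) m + 1"
  using ideal_length_add[OF PIdl_x_ideal(2) m_ideal oneideal PIdl_x_le_m ideal_subset[OF m_ideal]]
    ideal_length_m ideal_length_x by simp

text \<open>Since \<open>m c\<close> is contained in \<open>xR\<close>, the module \<open>m/xR\<close> is a quotient of \<open>(R/(c + xR))\<^sup>\<nu>\<^sup>-\<^sup>1\<close>.\<close>
lemma multiplicity_le:
  assumes au: "analytically_unramified R m"
  obtains l where "ideal_length R (conductor_ideal R) (carrier R) = enat l"
    and "e \<le> (embedding_dim R m - 1) * l + 1"
    and "e = (embedding_dim R m - 1) * l + 1 \<longleftrightarrow> m = PIdl x \<or> l = 1"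
proof -
  let ?c = "conductor_ideal R" and ?n = "embedding_dim R m"
  note c = conductor_ideal_ideal
  obtain k where "H (Suc k) \<subseteq> PIdl x" by (rule H_le_PIdl_x[OF au])
  then have k: "PIdl (x [^] k) \<subseteq> ?c" using PIdl_le[OF c x_pow_in_conductor_ideal] by blast
  obtain l' where l': "ideal_length R (PIdl (x [^] k)) (carrier R) = enat l'" by (rule ideal_length_x_pow_finite)
  then have "ideal_length R ?c (carrier R) \<le> enat l'" using ideal_length_antimono[OF k, of "carrier R"] by simp
  then obtain l where l: "ideal_length R ?c (carrier R) = enat l" by (cases "ideal_length R ?c (carrier R)") auto
  show ?thesis
  proof (cases "m = PIdl x")
    case True
    \<comment> \<open>For a discrete valuation ring l = 0 and e = 1, so equality holds.\<close>
    then have "?c = carrier R" using one_in_conductor_ideal_iff ideal.one_imp_carrier[OF c] by blast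
    then have "l = 0" using l ideal_length_refl[OF oneideal] by (simp add: zero_enat_def)
    moreover have "e = 1" using e_eq ideal_length_refl[OF m_ideal] True[symmetric] by (simp add: one_enat_def)
    ultimately show ?thesis using that[OF l] True by simp
  next
    case False
    then have cne: "?c \<noteq> carrier R" using one_in_conductor_ideal_iff by auto
    then have cm: "?c \<subseteq> m" by (rule proper_le_m[OF c])
    let ?B = "?c <+> PIdl x"
    have B: "ideal ?B R" by (rule ideal_adjoin[OF c x_carr])
    have cB: "?c \<subseteq> ?B" by (rule set_add_ge1[OF PIdl_x_ideal(2) ideal_subset[OF c]])
    have xB: "x \<in> ?B" by (rule mem_adjoin[OF c x_carr])
    have BA: "b \<in> carrier R \<and> b \<otimes> a \<in> PIdl x" if a: "a \<in> m" and b: "b \<in> ?B" for a b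
    proof -
      obtain p q where pq: "p \<in> ?c" "q \<in> PIdl x" "b = p \<oplus> q" using b unfolding mem_set_add by blast
      have car: "p \<in> carrier R" "q \<in> carrier R" "a \<in> carrier R"
        using pq ideal_subset[OF c] ideal_subset[OF PIdl_x_ideal(2)] m_carr[OF a] by blast+
      have "b \<otimes> a = p \<otimes> a \<oplus> a \<otimes> q" unfolding pq(3) using car by (simp add: l_distr r_distr m_comm)
      also have "\<dots> \<in> PIdl x"
        by (intro ideal_add ideal_mult conductor_mult_m pq a car PIdl_x_ideal(2))
      finally show ?thesis using pq(3) car by simp
    qed
    obtain b where b: "ideal_length R ?B (carrier R) = enat b" "b \<le> l"
      using ideal_length_antimono[OF cB, of "carrier R"] l by (cases "ideal_length R ?B (carrier R)") auto
    obtain f where f: "ideal_length R (PIdl x) m = enat f" "e = f + 1"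
      using e_eq by (cases "ideal_length R (PIdl x) m") (auto simp: one_enat_def)
    have "enat f \<le> enat (?n - 1) * enat b"
      using ideal_length_m_le[of "PIdl x" ?B "?n - 1", OF PIdl_x_ideal(2) PIdl_x_le_m BA] ideal_length_m_mod_x(3) f b by simp
    then have fb: "f \<le> (?n - 1) * b" by simp
    also have "\<dots> \<le> (?n - 1) * l" using b(2) by simp
    finally have fl: "f \<le> (?n - 1) * l" .
    have l0: "l \<noteq> 0"
      using ideal_length_eq_0[OF c oneideal ideal_subset[OF c]] l cne by (auto simp: zero_enat_def)
    have m_eq: "?c = m" if "m \<subseteq> ?c" using that cm by blast
    have one: "l = 1 \<longleftrightarrow> ?c = m"
    proof
      assume "?c = m" then show "l = 1" using l ideal_length_m by (simp add: one_enat_def)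
    next
      assume "l = 1"
      then have "ideal_length R ?c m + 1 = 1"
        using ideal_length_add[OF c m_ideal oneideal cm ideal_subset[OF m_ideal]] l ideal_length_m by (simp add: one_enat_def)
      then have "ideal_length R ?c m = 0" by (cases "ideal_length R ?c m") (auto simp: one_enat_def zero_enat_def)
      then show "?c = m" by (rule ideal_length_eq_0[OF c m_ideal cm])
    qed
    have "f = (?n - 1) * l \<longleftrightarrow> ?c = m"
    proof
      assume eq: "f = (?n - 1) * l"
      \<comment> \<open>This factor is about to be cancelled; if it were 0, then \<open>m\<close>
        would be xR.\<close>
      have "?n - 1 \<noteq> 0"
      proof
        assume "?n - 1 = 0"
        then have "f = 0" using fb by simp
        then have "PIdl x = m" using ideal_length_eq_0[OF PIdl_x_ideal(2) m_ideal PIdl_x_le_m] f by (simp add: zero_enat_def)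
        then show False using False by simp
      qed
      then have "l \<le> b" using fb unfolding eq by simp
      \<comment> \<open>No length is left between c and c + xR, which puts \<open>x\<close> into
        c.\<close>
      then have "ideal_length R ?c ?B + enat l = enat l"
        using b l ideal_length_add[OF c B oneideal cB ideal_subset[OF B]] by simp
      then have "ideal_length R ?c ?B = 0" by (cases "ideal_length R ?c ?B") (auto simp: zero_enat_def)
      then have "?c = ?B" by (rule ideal_length_eq_0[OF c B cB])
      then have "x \<in> ?c" using xB by simp
      then show "?c = m" using m_le_conductor_ideal m_eq by blast
    next
      assume cm: "?c = m"
      have "pw 2 \<subseteq> PIdl x" unfolding pw_2 using conductor_mult_m cm by (intro ideal_prod_le PIdl_x_ideal(2)) auto
      then have "PIdl x <+> pw 2 = PIdl x"
        using set_add_le[OF PIdl_x_ideal(2) order_refl] set_add_ge1[OF pw_ideal ideal_subset[OF PIdl_x_ideal(2)]] by blast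
      then have "f = ?n - 1" using ideal_length_m_mod_x(3) f by simp
      then show "f = (?n - 1) * l" using one cm by simp
    qed
    then show ?thesis using that[OF l] f(2) fl False one by simp
  qed
qed

end

theorem theorem2:
  fixes R :: "('a, 'b) ring_scheme" (structure) and m :: "'a set" and x :: 'a
  assumes "local_ring R m" and "noetherian_ring R"
    and "krull_dim R = 1" and "cohen_macaulay R m" and "analytically_unramified R m"
    and "infinite (carrier (R Quot m))"
    and "x \<in> carrier R" and "minimal_reduction R (PIdl x) m"
  shows "hilbert_samuel_multiplicity R m
      \<le> (real (embedding_dim R m) - 1)
          * real (the_enat (module_length R (quot_module R (conductor_ideal R)))) + 1
    \<and> (hilbert_samuel_multiplicity R m
      = (real (embedding_dim R m) - 1)
          * real (the_enat (module_length R (quot_module R (conductor_ideal R)))) + 1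
      \<longleftrightarrow> dvr R \<or> module_length R (quot_module R (conductor_ideal R)) = 1)"
proof -
  interpret noetherian_local_ring R m
    using assms(1,2) by (rule noetherian_local_ring.intro)
  \<comment> \<open>Cohen-Macaulayness enters here, as positive depth.\<close>
  have "depth R m \<noteq> 0" using assms(3,4) unfolding cohen_macaulay_def by simp
  then obtain N where "principal_reduction R m x N"
    using principal_reductionI assms(7,8) unfolding minimal_reduction_def by blast
  then interpret principal_reduction R m x N .
  obtain l where l: "ideal_length R (conductor_ideal R) (carrier R) = enat l"
    "e \<le> (embedding_dim R m - 1) * l + 1"
    "e = (embedding_dim R m - 1) * l + 1 \<longleftrightarrow> m = PIdl x \<or> l = 1"
    by (rule multiplicity_le[OF assms(5)])
  have len: "module_length R (quot_module R (conductor_ideal R)) = enat l"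
    using module_length_quot[OF conductor_ideal_ideal] l(1) by simp
  \<comment> \<open>The embedding dimension is at least 1, so the real difference in the claim
    agrees with the natural one.\<close>
  have "(real (embedding_dim R m) - 1) * real l + 1 = real ((embedding_dim R m - 1) * l + 1)"
    using ideal_length_m_mod_x(4) by (simp add: of_nat_diff)
  then show ?thesis
    unfolding hilbert_samuel_eq_e[OF assms(3)] len the_enat.simps dvr_iff
    using l(2,3) by (simp only: of_nat_le_iff of_nat_eq_iff) (simp add: one_enat_def)
qed

end
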